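(* Every edge in $\mathrm{QB}(W^J)$ lifts to a downward Bruhat cover in $\Omega_J^\infty$, and every cover in $\Omega_J^\infty$ projects to an edge in $\mathrm{QB}(W^J)$. More precisely: (1) For any edge $w\overset{\alpha}{\longrightarrow}\lfloor wr_\alpha\rfloor$ in $\mathrm{QB}(W^J)$, any $z\in\Sigma_J$, and any $\mu\in Q^\vee$ that is $J$-superantidominant and $J$-adjusted with $z=z_\mu$ (such a $\mu$ exists), there is a covering relation $y\lessdot x$ in $\Omega_J^\infty$ where $$x=wzt_\mu,\qquad y=xr_{\widetilde\alpha}=wr_\alpha t_{\chi\alpha^\vee}zt_\mu,\qquad \widetilde\alpha=z^{-1}\alpha+\bigl(\chi+\langle\mu,z^{-1}\alpha\rangle\bigr)\delta\in\Phi^{\mathrm{af}-},$$ and $\chi$ is $0$ or $1$ according as the edge in $\mathrm{QB}(W^J)$ is of Bruhat or quantum type respectively. (2) Suppose $y\lessdot x$ is an arbitrary covering relation in $\Omega_J^\infty$. Then we can write $x=wzt_\mu$ with $w\in W^J$, $z=z_\mu\in W_J$, and $\mu\in Q^\vee$ $J$-superantidominant and $J$-adjusted, as well as $y=xr_\gamma$ with $\gamma=z^{-1}\alpha+n\delta\in\Phi^{\mathrm{af}}$, $\alpha\in\Phi^+\setminus\Phi_J^+$, and $n\in\mathbb{Z}$. With the notation $\chi:=n-\langle\mu,z^{-1}\alpha\rangle$, we have $$\chi\in\{0,1\},\qquad \gamma=z^{-1}\alpha+\bigl(\chi+\langle\mu,z^{-1}\alpha\rangle\bigr)\delta\in\Phi^{\mathrm{af}-};$$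 furthermore, there is an edge $wz\overset{z^{-1}\alpha}{\longrightarrow}wr_\alpha z$ in $\mathrm{QB}(W)$ and an edge $w\overset{\alpha}{\longrightarrow}\lfloor wr_\alpha\rfloor$ in $\mathrm{QB}(W^J)$, where both edges are of Bruhat type if $\chi=0$ and of quantum type if $\chi=1$.
   Context: Finite data. $\Phi$ is the (irreducible) root system of a finite-dimensional simple Lie algebra, with Dynkin node set $I$, simple roots $\alpha_i$, simple coroots $\alpha_i^\vee$, fundamental coweights $\omega_i^\vee$, positive roots $\Phi^+$, $\Phi^-=-\Phi^+$, highest root $\theta$, coroot lattice $Q^\vee=\bigoplus_{i\in I}\mathbb{Z}\alpha_i^\vee$, Weyl group $W$ with simple reflections $r_i$ ($i\in I$) and length function $\ell$, reflections $r_\alpha$, coroots $\alpha^\vee$, and $\rho=\frac12\sum_{\alpha\in\Phi^+}\alpha$; $\langle\cdot,\cdot\rangle$ is the coweight–weight pairing. $J\subseteq I$ is a subset (the set of $i\in I$ with $\langle\alpha_i^\vee,\lambda\rangle=0$ for a fixed dominant weight $\lambda$), $W_J=\langle r_i: i\in J\rangle$ (the stabilizer of $\lambda$), $\Phi_J=\Phi_J^+\sqcup\Phi_J^-$ its root system, $\rho_J=\frac12\sum_{\alpha\in\Phi_J^+}\alpha$, $Q_J^\vee=\bigoplus_{i\in J}\mathbb{Z}\alpha_i^\vee$, $W^J$ the set of minimum-length coset representatives of $W/W_J$, and $\lfloor w\rfloor\in W^J$ the minimum-length representative of $wW_J$. Parabolic quantum Bruhat graph $\mathrm{QB}(W^J)$: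 the directed graph with vertex set $W^J$ and, for $w\in W^J$ and $\alpha\in\Phi^+\setminus\Phi_J^+$, an edge $w\overset{\alpha}{\longrightarrow}\lfloor wr_\alpha\rfloor$ labeled $\alpha$ if either (Bruhat edge) $\ell(wr_\alpha)=\ell(w)+1$, or (quantum edge) $\ell(\lfloor wr_\alpha\rfloor)=\ell(w)+1-\langle\alpha^\vee,2\rho-2\rho_J\rangle$. $\mathrm{QB}(W)$, the quantum Bruhat graph, is the case $J=\emptyset$. Affine data. $W_{\mathrm{af}}=W\ltimes\{t_\mu:\mu\in Q^\vee\}$, with $wt_\mu w^{-1}=t_{w\mu}$, is the affine Weyl group, a Coxeter group with simple reflections $r_i$ ($i\in I$) and $r_0=r_\theta t_{-\theta^\vee}$; $\lessdot$ denotes covers in its Bruhat order. With $\delta$ the null root, the real affine roots are $\Phi^{\mathrm{af}}=\{\alpha+n\delta:\alpha\in\Phi,n\in\mathbb{Z}\}$, $\Phi^{\mathrm{af}+}=\Phi^+\sqcup(\Phi+\mathbb{Z}_{>0}\delta)$, $\Phi^{\mathrm{af}-}=-\Phi^{\mathrm{af}+}$; the classical part of $\alpha+n\delta$ is $\alpha$; the associated reflection is $r_{\alpha+n\delta}=r_\alpha t_{n\alpha^\vee}$. The elements $z_\mu$ and $\phi_J(\mu)$. Let $I_1,\dots,I_k$ be the vertex sets of the connected components of $J$. For each $m$ let $I_m^{\mathrm{af}}=I_m\sqcup\{0_m\}$ be the node set of the corresponding untwisted affine Dynkin diagram, with $0_m$ the additional affine node, and put $\omega_{0_m}^\vee:=0$.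 A node $j\in I_m^{\mathrm{af}}$ is cominuscule if it is the image of $0_m$ under some automorphism of this affine diagram (equivalently, $j=0_m$ or $\alpha_j$ has coefficient $1$ in the highest root of the subsystem with node set $I_m$). For cominuscule $j\in I_m$ define $v_j^{I_m}\in W_{I_m}$ by $w_0^{I_m}=v_j^{I_m}w_0^{I_m\setminus\{j\}}$, where $w_0^K$ is the longest element of $W_K=\langle r_i:i\in K\rangle$; put $v_{0_m}^{I_m}=\mathrm{id}$. Each $\mu\in Q^\vee$ is uniquely of the form $\mu=\sum_{i\in I\setminus J}c_i\omega_i^\vee-\phi_J(\mu)-\sum_{m=1}^k\omega_{j_m}^\vee$ with $c_i\in\mathbb{Z}$, $\phi_J(\mu)\in Q_J^\vee$ and each $j_m\in I_m^{\mathrm{af}}$ cominuscule. Put $z_\mu=\prod_{m=1}^k v_{j_m}^{I_m}\in W_J$ and $\Sigma_J=\{z_\mu:\mu\in Q^\vee\}\subset W_J$. An element $\mu\in Q^\vee$ is $J$-adjusted if $\phi_J(\mu)=0$. Superantidominance. An element $\mu\in Q^\vee$ is $J$-superantidominant if $\langle\mu,\alpha\rangle\le0$ for all $\alpha\in\Phi^+$ and $\langle\mu,\alpha\rangle\ll0$ for all $\alpha\in\Phi^+\setminus\Phi_J^+$. Let $\Omega_J^\infty\subset W_{\mathrm{af}}$ be the set of elements $wz_\mu t_\mu$ with $w\in W^J$ and $\mu\in Q^\vee$ $J$-superantidominant and $J$-adjusted. The covering relations in $\Omega_J^\infty$ are the Bruhat covers $y\lessdot x$ of $W_{\mathrm{af}}$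 with $x,y\in\Omega_J^\infty$ for which the connecting root (the root $\gamma\in\Phi^{\mathrm{af}}$, up to sign, with $y=xr_\gamma$) has classical part in $\Phi\setminus\Phi_J$. *)

theory Defs
  imports "HOL-Analysis.Analysis"
begin

text \<open>
  Weights and coweights are identified by means of a Weyl-invariant inner product: the root
  system lives in a Euclidean space, \<open>\<langle>\<mu>, \<alpha>\<rangle>\<close> is the inner product \<open>\<mu> \<bullet> \<alpha>\<close>, and the coroot of
  \<open>\<alpha>\<close> is \<open>2\<alpha>/(\<alpha> \<bullet> \<alpha>)\<close>. Dynkin nodes are identified with the corresponding simple roots, so a
  subset \<open>J\<close> of the nodes is a subset of the set \<open>\<Delta>\<close> of simple roots.
\<close>

section \<open>Finite root systems\<close>

definition coroot :: "'a::euclidean_space \<Rightarrow> 'a" where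
  "coroot \<alpha> = (2 / (\<alpha> \<bullet> \<alpha>)) *\<^sub>R \<alpha>"

definition root_refl :: "'a::euclidean_space \<Rightarrow> 'a \<Rightarrow> 'a" where
  "root_refl \<alpha> v = v - (v \<bullet> coroot \<alpha>) *\<^sub>R \<alpha>"

definition root_system :: "'a::euclidean_space set \<Rightarrow> bool" where
  "root_system \<Phi> \<longleftrightarrow>
     finite \<Phi> \<and> 0 \<notin> \<Phi> \<and> span \<Phi> = UNIV \<and>
     (\<forall>\<alpha>\<in>\<Phi>. \<forall>\<beta>\<in>\<Phi>. root_refl \<alpha> \<beta> \<in> \<Phi>) \<and>
     (\<forall>\<alpha>\<in>\<Phi>. \<forall>\<beta>\<in>\<Phi>. coroot \<alpha> \<bullet> \<beta> \<in> \<int>) \<and>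
     (\<forall>\<alpha>\<in>\<Phi>. \<forall>c. c *\<^sub>R \<alpha> \<in> \<Phi> \<longrightarrow> c = 1 \<or> c = - 1)"

definition irreducible_root_system :: "'a::euclidean_space set \<Rightarrow> bool" where
  "irreducible_root_system \<Phi> \<longleftrightarrow>
     root_system \<Phi> \<and> \<Phi> \<noteq> {} \<and>
     \<not> (\<exists>A B. A \<noteq> {} \<and> B \<noteq> {} \<and> A \<inter> B = {} \<and> A \<union> B = \<Phi> \<and> (\<forall>a\<in>A. \<forall>b\<in>B. a \<bullet> b = 0))"

definition int_span :: "'a::euclidean_space set \<Rightarrow> 'a set" where
  "int_span S = {\<Sum>s\<in>S. of_int (c s) *\<^sub>R s | c :: 'a \<Rightarrow> int. True}"

definition nat_span :: "'a::euclidean_space set \<Rightarrow> 'a set" where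
  "nat_span S = {\<Sum>s\<in>S. of_nat (c s) *\<^sub>R s | c :: 'a \<Rightarrow> nat. True}"

definition simple_roots :: "'a::euclidean_space set \<Rightarrow> 'a set \<Rightarrow> bool" where
  "simple_roots \<Phi> \<Delta> \<longleftrightarrow>
     \<Delta> \<subseteq> \<Phi> \<and> independent \<Delta> \<and> (\<forall>\<beta>\<in>\<Phi>. \<beta> \<in> nat_span \<Delta> \<or> - \<beta> \<in> nat_span \<Delta>)"

definition pos_roots :: "'a::euclidean_space set \<Rightarrow> 'a set \<Rightarrow> 'a set" where
  "pos_roots \<Phi> \<Delta> = \<Phi> \<inter> nat_span \<Delta>"

definition par_roots :: "'a::euclidean_space set \<Rightarrow> 'a set \<Rightarrow> 'a set" where
  "par_roots \<Phi> K = \<Phi> \<inter> int_span K"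

definition par_pos_roots :: "'a::euclidean_space set \<Rightarrow> 'a set \<Rightarrow> 'a set \<Rightarrow> 'a set" where
  "par_pos_roots \<Phi> \<Delta> K = par_roots \<Phi> K \<inter> pos_roots \<Phi> \<Delta>"

definition half_sum :: "'a::euclidean_space set \<Rightarrow> 'a" where
  "half_sum R = (1 / 2) *\<^sub>R (\<Sum>\<alpha>\<in>R. \<alpha>)"

text \<open>The highest root of the subsystem with (connected) node set \<open>K\<close>.\<close>

definition highest_root :: "'a::euclidean_space set \<Rightarrow> 'a set \<Rightarrow> 'a" where
  "highest_root \<Phi> K =
     (THE \<theta>. \<theta> \<in> par_roots \<Phi> K \<and> (\<forall>\<beta>\<in>par_roots \<Phi> K. \<theta> - \<beta> \<in> nat_span K))"

definition coroot_lattice :: "'a::euclidean_space set \<Rightarrow> 'a set" where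
  "coroot_lattice K = int_span (coroot ` K)"

definition fund_coweight :: "'a::euclidean_space set \<Rightarrow> 'a \<Rightarrow> 'a" where
  "fund_coweight \<Delta> i = (THE v. \<forall>k\<in>\<Delta>. v \<bullet> k = (if k = i then 1 else 0))"

section \<open>Coxeter groups realised as transformation groups\<close>

definition words_group :: "('a \<Rightarrow> 'a) set \<Rightarrow> ('a \<Rightarrow> 'a) set" where
  "words_group S = {foldr (\<circ>) ss id | ss. set ss \<subseteq> S}"

definition cox_length :: "('a \<Rightarrow> 'a) set \<Rightarrow> ('a \<Rightarrow> 'a) \<Rightarrow> nat" where
  "cox_length S x = (LEAST n. \<exists>ss. length ss = n \<and> set ss \<subseteq> S \<and> foldr (\<circ>) ss id = x)"

text \<open>Here \<open>G\<close> is a group of bijections that is a Coxeter group with simple reflections \<open>S\<close>.\<close>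

definition cox_reflections :: "('a \<Rightarrow> 'a) set \<Rightarrow> ('a \<Rightarrow> 'a) set \<Rightarrow> ('a \<Rightarrow> 'a) set" where
  "cox_reflections G S = {u \<circ> s \<circ> inv u | u s. u \<in> G \<and> s \<in> S}"

definition bruhat_less ::
    "('a \<Rightarrow> 'a) set \<Rightarrow> ('a \<Rightarrow> 'a) set \<Rightarrow> ('a \<Rightarrow> 'a) \<Rightarrow> ('a \<Rightarrow> 'a) \<Rightarrow> bool" where
  "bruhat_less G S =
     (\<lambda>y x. x \<in> G \<and> y \<in> G \<and> (\<exists>r\<in>cox_reflections G S. y = x \<circ> r) \<and>
            cox_length S y < cox_length S x)\<^sup>+\<^sup>+"

definition bruhat_cover ::
    "('a \<Rightarrow> 'a) set \<Rightarrow> ('a \<Rightarrow> 'a) set \<Rightarrow> ('a \<Rightarrow> 'a) \<Rightarrow> ('a \<Rightarrow> 'a) \<Rightarrow> bool" where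
  "bruhat_cover G S y x \<longleftrightarrow>
     bruhat_less G S y x \<and> \<not> (\<exists>v. bruhat_less G S y v \<and> bruhat_less G S v x)"

section \<open>The finite Weyl group and the parabolic quantum Bruhat graph\<close>

definition weyl :: "'a::euclidean_space set \<Rightarrow> ('a \<Rightarrow> 'a) set" where
  "weyl K = words_group (root_refl ` K)"

definition wlength :: "'a::euclidean_space set \<Rightarrow> ('a \<Rightarrow> 'a) \<Rightarrow> nat" where
  "wlength \<Delta> = cox_length (root_refl ` \<Delta>)"

definition min_reps :: "'a::euclidean_space set \<Rightarrow> 'a set \<Rightarrow> ('a \<Rightarrow> 'a) set" where
  "min_reps \<Delta> J = {w \<in> weyl \<Delta>. \<forall>u\<in>weyl J. wlength \<Delta> w \<le> wlength \<Delta> (w \<circ> u)}"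

definition min_rep :: "'a::euclidean_space set \<Rightarrow> 'a set \<Rightarrow> ('a \<Rightarrow> 'a) \<Rightarrow> 'a \<Rightarrow> 'a" where
  "min_rep \<Delta> J w = (THE v. v \<in> min_reps \<Delta> J \<and> (\<exists>u\<in>weyl J. v = w \<circ> u))"

text \<open>
  The edges of \<open>QB(W\<^sup>J)\<close>: there is an edge from \<open>w\<close> to \<open>v\<close> labelled \<open>\<alpha>\<close>, of Bruhat
  respectively of quantum type. The graph \<open>QB(W)\<close> is the case \<open>J = {}\<close>.
\<close>

definition qb_label ::
    "'a::euclidean_space set \<Rightarrow> 'a set \<Rightarrow> 'a set \<Rightarrow> ('a \<Rightarrow> 'a) \<Rightarrow> 'a \<Rightarrow> ('a \<Rightarrow> 'a) \<Rightarrow> bool" where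
  "qb_label \<Phi> \<Delta> J w \<alpha> v \<longleftrightarrow>
     w \<in> min_reps \<Delta> J \<and> \<alpha> \<in> pos_roots \<Phi> \<Delta> - par_pos_roots \<Phi> \<Delta> J \<and>
     v = min_rep \<Delta> J (w \<circ> root_refl \<alpha>)"

definition qb_bruhat_edge ::
    "'a::euclidean_space set \<Rightarrow> 'a set \<Rightarrow> 'a set \<Rightarrow> ('a \<Rightarrow> 'a) \<Rightarrow> 'a \<Rightarrow> ('a \<Rightarrow> 'a) \<Rightarrow> bool" where
  "qb_bruhat_edge \<Phi> \<Delta> J w \<alpha> v \<longleftrightarrow>
     qb_label \<Phi> \<Delta> J w \<alpha> v \<and> wlength \<Delta> (w \<circ> root_refl \<alpha>) = wlength \<Delta> w + 1"

definition qb_quantum_edge ::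
    "'a::euclidean_space set \<Rightarrow> 'a set \<Rightarrow> 'a set \<Rightarrow> ('a \<Rightarrow> 'a) \<Rightarrow> 'a \<Rightarrow> ('a \<Rightarrow> 'a) \<Rightarrow> bool" where
  "qb_quantum_edge \<Phi> \<Delta> J w \<alpha> v \<longleftrightarrow>
     qb_label \<Phi> \<Delta> J w \<alpha> v \<and>
     real (wlength \<Delta> v) =
       real (wlength \<Delta> w) + 1 -
       coroot \<alpha> \<bullet> (2 *\<^sub>R half_sum (pos_roots \<Phi> \<Delta>) - 2 *\<^sub>R half_sum (par_pos_roots \<Phi> \<Delta> J))"

section \<open>The affine Weyl group and affine roots\<close>

text \<open>
  The affine Weyl group is realised faithfully by affine transformations, \<open>t\<^sub>\<mu>\<close> being
  translation by \<open>\<mu>\<close>; the product is composition, so \<open>w t\<^sub>\<mu> w\<^sup>-\<^sup>1 = t\<^bsub>w\<mu>\<^esub>\<close>.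
\<close>

definition transl :: "'a::euclidean_space \<Rightarrow> 'a \<Rightarrow> 'a" where
  "transl \<mu> v = v + \<mu>"

definition affine_weyl :: "'a::euclidean_space set \<Rightarrow> ('a \<Rightarrow> 'a) set" where
  "affine_weyl \<Delta> = {w \<circ> transl \<mu> | w \<mu>. w \<in> weyl \<Delta> \<and> \<mu> \<in> coroot_lattice \<Delta>}"

definition affine_simple_refls :: "'a::euclidean_space set \<Rightarrow> 'a set \<Rightarrow> ('a \<Rightarrow> 'a) set" where
  "affine_simple_refls \<Phi> \<Delta> =
     insert (root_refl (highest_root \<Phi> \<Delta>) \<circ> transl (- coroot (highest_root \<Phi> \<Delta>))) (root_refl ` \<Delta>)"

definition affine_cover ::
    "'a::euclidean_space set \<Rightarrow> 'a set \<Rightarrow> ('a \<Rightarrow> 'a) \<Rightarrow> ('a \<Rightarrow> 'a) \<Rightarrow> bool" where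
  "affine_cover \<Phi> \<Delta> = bruhat_cover (affine_weyl \<Delta>) (affine_simple_refls \<Phi> \<Delta>)"

text \<open>The affine root \<open>\<alpha> + n\<delta>\<close> is encoded as the pair \<open>(\<alpha>, n)\<close> with \<open>n \<in> \<int>\<close> a real number.\<close>

definition affine_roots :: "'a::euclidean_space set \<Rightarrow> ('a \<times> real) set" where
  "affine_roots \<Phi> = \<Phi> \<times> \<int>"

definition affine_pos_roots :: "'a::euclidean_space set \<Rightarrow> 'a set \<Rightarrow> ('a \<times> real) set" where
  "affine_pos_roots \<Phi> \<Delta> = pos_roots \<Phi> \<Delta> \<times> {0} \<union> \<Phi> \<times> {n \<in> \<int>. n > 0}"

definition affine_neg_roots :: "'a::euclidean_space set \<Rightarrow> 'a set \<Rightarrow> ('a \<times> real) set" where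
  "affine_neg_roots \<Phi> \<Delta> = uminus ` affine_pos_roots \<Phi> \<Delta>"

definition affine_refl :: "'a::euclidean_space \<times> real \<Rightarrow> 'a \<Rightarrow> 'a" where
  "affine_refl \<gamma> = root_refl (fst \<gamma>) \<circ> transl (snd \<gamma> *\<^sub>R coroot (fst \<gamma>))"

section \<open>The elements \<open>z\<^sub>\<mu>\<close> and \<open>\<phi>\<^sub>J(\<mu>)\<close>\<close>

definition components :: "'a::euclidean_space set \<Rightarrow> 'a set set" where
  "components J = J // ({(a, b). a \<in> J \<and> b \<in> J \<and> a \<bullet> b \<noteq> 0}\<^sup>+)"

text \<open>
  For a component \<open>K\<close> of \<open>J\<close> the additional node of the untwisted affine Dynkin diagram is
  represented by \<open>-\<theta>\<^sub>K\<close>, the classical part of the affine simple root. Automorphisms of the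
  diagram are the permutations of the nodes that preserve the affine Cartan matrix.
\<close>

definition affine_node :: "'a::euclidean_space set \<Rightarrow> 'a set \<Rightarrow> 'a" where
  "affine_node \<Phi> K = - highest_root \<Phi> K"

definition affine_nodes :: "'a::euclidean_space set \<Rightarrow> 'a set \<Rightarrow> 'a set" where
  "affine_nodes \<Phi> K = insert (affine_node \<Phi> K) K"

definition diagram_automorphism :: "'a::euclidean_space set \<Rightarrow> 'a set \<Rightarrow> ('a \<Rightarrow> 'a) \<Rightarrow> bool" where
  "diagram_automorphism \<Phi> K \<sigma> \<longleftrightarrow>
     bij_betw \<sigma> (affine_nodes \<Phi> K) (affine_nodes \<Phi> K) \<and>
     (\<forall>i\<in>affine_nodes \<Phi> K. \<forall>k\<in>affine_nodes \<Phi> K. coroot (\<sigma> i) \<bullet> \<sigma> k = coroot i \<bullet> k)"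

definition cominuscule :: "'a::euclidean_space set \<Rightarrow> 'a set \<Rightarrow> 'a \<Rightarrow> bool" where
  "cominuscule \<Phi> K j \<longleftrightarrow> (\<exists>\<sigma>. diagram_automorphism \<Phi> K \<sigma> \<and> j = \<sigma> (affine_node \<Phi> K))"

text \<open>\<open>\<omega>\<^sub>j\<^sup>\<or>\<close> for \<open>j\<close> in \<open>\<Delta>\<close>, and \<open>0\<close> for an additional affine node.\<close>

definition node_coweight :: "'a::euclidean_space set \<Rightarrow> 'a \<Rightarrow> 'a" where
  "node_coweight \<Delta> j = (if j \<in> \<Delta> then fund_coweight \<Delta> j else 0)"

definition longest :: "'a::euclidean_space set \<Rightarrow> 'a set \<Rightarrow> 'a \<Rightarrow> 'a" where
  "longest \<Delta> K = (THE w. w \<in> weyl K \<and> (\<forall>u\<in>weyl K. wlength \<Delta> u \<le> wlength \<Delta> w))"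

definition v_elem :: "'a::euclidean_space set \<Rightarrow> 'a set \<Rightarrow> 'a \<Rightarrow> 'a \<Rightarrow> 'a" where
  "v_elem \<Delta> K j = (if j \<in> K then longest \<Delta> K \<circ> inv (longest \<Delta> (K - {j})) else id)"

text \<open>
  \<open>J_decomp \<Phi> \<Delta> J \<mu> \<phi> j\<close> says that
  \<open>\<mu> = (\<Sum>i\<in>\<Delta> - J. c\<^sub>i \<omega>\<^sub>i\<^sup>\<or>) - \<phi> - (\<Sum>K. \<omega>\<^bsub>j K\<^esub>\<^sup>\<or>)\<close> is the decomposition of \<open>\<mu>\<close>, where \<open>j\<close>
  selects a cominuscule affine node for every component \<open>K\<close> of \<open>J\<close>.
\<close>

definition J_decomp ::
    "'a::euclidean_space set \<Rightarrow> 'a set \<Rightarrow> 'a set \<Rightarrow> 'a \<Rightarrow> 'a \<Rightarrow> ('a set \<Rightarrow> 'a) \<Rightarrow> bool" where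
  "J_decomp \<Phi> \<Delta> J \<mu> \<phi> j \<longleftrightarrow>
     \<phi> \<in> coroot_lattice J \<and>
     (\<forall>K\<in>components J. cominuscule \<Phi> K (j K)) \<and>
     (\<exists>c :: 'a \<Rightarrow> int.
        \<mu> = (\<Sum>i\<in>\<Delta> - J. of_int (c i) *\<^sub>R fund_coweight \<Delta> i) - \<phi>
            - (\<Sum>K\<in>components J. node_coweight \<Delta> (j K)))"

definition phi_J :: "'a::euclidean_space set \<Rightarrow> 'a set \<Rightarrow> 'a set \<Rightarrow> 'a \<Rightarrow> 'a" where
  "phi_J \<Phi> \<Delta> J \<mu> = (THE \<phi>. \<exists>j. J_decomp \<Phi> \<Delta> J \<mu> \<phi> j)"

text \<open>The factors of \<open>z\<^sub>\<mu>\<close> belong to different components of \<open>J\<close> and hence commute.\<close>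

definition z_elem :: "'a::euclidean_space set \<Rightarrow> 'a set \<Rightarrow> 'a set \<Rightarrow> 'a \<Rightarrow> 'a \<Rightarrow> 'a" where
  "z_elem \<Phi> \<Delta> J \<mu> =
     (THE z. \<exists>\<phi> j. J_decomp \<Phi> \<Delta> J \<mu> \<phi> j \<and>
        z = Finite_Set.fold (\<lambda>K f. v_elem \<Delta> K (j K) \<circ> f) id (components J))"

definition Sigma_J :: "'a::euclidean_space set \<Rightarrow> 'a set \<Rightarrow> 'a set \<Rightarrow> ('a \<Rightarrow> 'a) set" where
  "Sigma_J \<Phi> \<Delta> J = z_elem \<Phi> \<Delta> J ` coroot_lattice \<Delta>"

definition J_adjusted :: "'a::euclidean_space set \<Rightarrow> 'a set \<Rightarrow> 'a set \<Rightarrow> 'a \<Rightarrow> bool" where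
  "J_adjusted \<Phi> \<Delta> J \<mu> \<longleftrightarrow> \<mu> \<in> coroot_lattice \<Delta> \<and> phi_J \<Phi> \<Delta> J \<mu> = 0"

section \<open>Superantidominance and the covers in \<open>\<Omega>\<^sub>J\<^sup>\<infinity>\<close>\<close>

text \<open>
  The condition \<open>\<langle>\<mu>, \<alpha>\<rangle> \<lless> 0\<close> is made precise by an explicit threshold \<open>M\<close>, as
  \<open>\<langle>\<mu>, \<alpha>\<rangle> \<le> -M\<close>; statements about superantidominant elements are to be asserted for all
  sufficiently large thresholds. The two ends of a cover have translation parts that differ
  by a coroot, so if \<open>y\<close> is obtained from \<open>x\<close>, its threshold may be smaller than that of \<open>x\<close>.
\<close>

definition J_superantidominant ::
    "'a::euclidean_space set \<Rightarrow> 'a set \<Rightarrow> 'a set \<Rightarrow> nat \<Rightarrow> 'a \<Rightarrow> bool" where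
  "J_superantidominant \<Phi> \<Delta> J M \<mu> \<longleftrightarrow>
     \<mu> \<in> coroot_lattice \<Delta> \<and>
     (\<forall>\<alpha>\<in>pos_roots \<Phi> \<Delta>. \<mu> \<bullet> \<alpha> \<le> 0) \<and>
     (\<forall>\<alpha>\<in>pos_roots \<Phi> \<Delta> - par_pos_roots \<Phi> \<Delta> J. \<mu> \<bullet> \<alpha> \<le> - real M)"

definition Omega_J ::
    "'a::euclidean_space set \<Rightarrow> 'a set \<Rightarrow> 'a set \<Rightarrow> nat \<Rightarrow> ('a \<Rightarrow> 'a) set" where
  "Omega_J \<Phi> \<Delta> J M =
     {w \<circ> z_elem \<Phi> \<Delta> J \<mu> \<circ> transl \<mu> | w \<mu>.
        w \<in> min_reps \<Delta> J \<and> J_superantidominant \<Phi> \<Delta> J M \<mu> \<and> J_adjusted \<Phi> \<Delta> J \<mu>}"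

definition Omega_cover ::
    "'a::euclidean_space set \<Rightarrow> 'a set \<Rightarrow> 'a set \<Rightarrow> nat \<Rightarrow> ('a \<Rightarrow> 'a) \<Rightarrow> ('a \<Rightarrow> 'a) \<Rightarrow> bool" where
  "Omega_cover \<Phi> \<Delta> J M y x \<longleftrightarrow>
     x \<in> Omega_J \<Phi> \<Delta> J M \<and> y \<in> Omega_J \<Phi> \<Delta> J M \<and> affine_cover \<Phi> \<Delta> y x \<and>
     (\<exists>\<gamma>\<in>affine_roots \<Phi>. y = x \<circ> affine_refl \<gamma> \<and> fst \<gamma> \<in> \<Phi> - par_roots \<Phi> J)"

end

theory Submission
  imports Defs
begin

text \<open>
  Edges and covers are both conditions on lengths, and the theorem holds because the lengths on
  the two sides differ by a simple explicit term. The length of an element of the affine Weyl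
  group is the number of positive affine roots that it makes negative, and for \<open>g t\<^sub>\<mu>\<close> with
  \<open>g \<in> W\<close> these can be counted over each \<open>\<alpha> \<in> \<Phi>\<^sup>+\<close> separately (\<open>affine_inv_num\<close>):
  \<open>\<ell>(g t\<^sub>\<mu>) = \<Sum>\<^bsub>\<alpha>\<in>\<Phi>+\<^esub> \<bar>\<langle>\<mu>, \<alpha>\<rangle> + [g\<alpha> < 0]\<bar>\<close>.

  If \<open>\<mu>\<close> is \<open>J\<close>-adjusted, its pairings with \<open>\<Phi>\<^sub>J\<^sup>+\<close> are \<open>0\<close> or \<open>-1\<close>, and \<open>z\<^sub>\<mu>\<close> is the element
  of \<open>W\<^sub>J\<close> whose inversions are the roots with pairing \<open>-1\<close> (\<open>J_adjusted_iff\<close>,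
  \<open>z_elem_straightens\<close>). Hence the roots of \<open>\<Phi>\<^sub>J\<^sup>+\<close> contribute nothing to the length of
  \<open>x = w z\<^sub>\<mu> t\<^sub>\<mu>\<close> with \<open>w \<in> W\<^sup>J\<close>, and every other summand is negative before the absolute value is
  taken. So \<open>\<ell>(x) = -\<langle>\<mu>, 2\<rho> - 2\<rho>\<^sub>J\<rangle> - \<ell>(w)\<close> (\<open>length_outer\<close>) and also
  \<open>\<ell>(x) = -\<langle>\<mu>, 2\<rho>\<rangle> - \<ell>(w z\<^sub>\<mu>)\<close> (\<open>length_balanced\<close>). Multiplying \<open>x\<close> by the reflection in
  \<open>z\<^sup>-\<^sup>1\<alpha> + (\<chi> + \<langle>\<mu>, z\<^sup>-\<^sup>1\<alpha>\<rangle>)\<delta>\<close> replaces \<open>w\<close> by \<open>w r\<^sub>\<alpha>\<close> and \<open>\<mu>\<close> by \<open>\<mu> + \<chi> z\<^sup>-\<^sup>1\<alpha>\<^sup>\<or>\<close>, so that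
  for \<open>x\<close> and \<open>y\<close> both in \<open>\<Omega>\<^sub>J\<^sup>\<infinity>\<close>
  \<open>\<ell>(x) - \<ell>(y) = \<ell>(\<lfloor>w r\<^sub>\<alpha>\<rfloor>) - \<ell>(w) + \<chi> \<langle>\<alpha>\<^sup>\<or>, 2\<rho> - 2\<rho>\<^sub>J\<rangle>\<close>.

  From an edge to a cover, the point is that \<open>y\<close> lies in \<open>\<Omega>\<^sub>J\<^sup>\<infinity>\<close> at all. For a quantum edge the
  length of \<open>y\<close> is \<open>\<ell>(x) - 1 + D\<close>, where \<open>D \<ge> 0\<close> is the contribution of \<open>\<Phi>\<^sub>J\<^sup>+\<close>. Since \<open>y\<close> arises
  from \<open>x\<close> by reflecting in a positive affine root that \<open>x\<close> makes negative, \<open>\<ell>(y) < \<ell>(x)\<close>, which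
  forces \<open>D = 0\<close>, and this is what membership in \<open>\<Omega>\<^sub>J\<^sup>\<infinity>\<close> means. For a Bruhat edge
  \<open>w r\<^sub>\<alpha>\<close> is itself a minimal representative (\<open>bruhat_cover_min_rep\<close>).

  From a cover to an edge, \<open>\<ell>(x) - \<ell>(y) = 1\<close> by the chain property of the Bruhat order
  (\<open>cover_iff\<close>). The second length formula with \<open>\<beta> = z\<^sup>-\<^sup>1\<alpha>\<close> then says that
  \<open>\<chi> \<langle>\<beta>\<^sup>\<or>, 2\<rho>\<rangle> = 1 + \<ell>(w z) - \<ell>(w z r\<^sub>\<beta>)\<close>, where the difference of lengths is at most \<open>\<ell>(r\<^sub>\<beta>)\<close> in
  absolute value. As \<open>\<ell>(r\<^sub>\<beta>) \<le> \<langle>\<beta>\<^sup>\<or>, 2\<rho>\<rangle> - 1\<close> (\<open>wlength_root_refl_le\<close>), only \<open>\<chi> = 0\<close> and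
  \<open>\<chi> = 1\<close> remain, and the two length formulas are the edge conditions in \<open>QB(W)\<close> and \<open>QB(W\<^sup>J)\<close>.

  The facts on Coxeter groups are proved once, for a group acting on a set of roots with a
  positive and a simple part (\<open>reflection_group\<close>), and are used for \<open>W\<close> acting on \<open>\<Phi>\<close> and
  for the affine Weyl group acting on the real affine roots.
\<close>

section \<open>Length, reflections and Bruhat covers in a group acting on roots\<close>

lemma foldr_comp_snoc: "foldr (\<circ>) (ss @ [s]) id = foldr (\<circ>) ss id \<circ> s"
proof -
  have "foldr (\<circ>) ss f = foldr (\<circ>) ss id \<circ> f" for f
    by (induction ss) (auto simp: comp_assoc)
  then show ?thesis by (metis foldr.simps comp_apply comp_id foldr_append id_apply)
qed

text \<open>
  The setting shared by \<open>W\<close> acting on \<open>\<Phi>\<close> and by the affine Weyl group acting on the real affine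
  roots. The group consists of transformations of a space, while the roots may be other objects,
  so the action on roots is a parameter \<open>act\<close>. No Coxeter presentation is assumed: that an
  element without simple descents is trivial takes its place.
\<close>

locale reflection_group =
  fixes G :: "('a \<Rightarrow> 'a) set" and act :: "('a \<Rightarrow> 'a) \<Rightarrow> 'r \<Rightarrow> 'r"
    and P D :: "'r set" and neg :: "'r \<Rightarrow> 'r" and refl :: "'r \<Rightarrow> 'a \<Rightarrow> 'a"
  assumes id_in: "id \<in> G"
    and comp_in: "\<And>g h. g \<in> G \<Longrightarrow> h \<in> G \<Longrightarrow> g \<circ> h \<in> G"
    and act_id: "\<And>a. act id a = a"
    and act_comp: "\<And>g h a. g \<in> G \<Longrightarrow> h \<in> G \<Longrightarrow> act (g \<circ> h) a = act g (act h a)"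
    and act_neg: "\<And>g a. g \<in> G \<Longrightarrow> act g (neg a) = neg (act g a)"
    and neg_neg: "\<And>a. neg (neg a) = a"
    and neg_notin: "\<And>a. a \<in> P \<Longrightarrow> neg a \<notin> P"
    and act_root: "\<And>g a. g \<in> G \<Longrightarrow> a \<in> P \<Longrightarrow> act g a \<in> P \<or> neg (act g a) \<in> P"
    and refl_in: "\<And>a. a \<in> P \<Longrightarrow> refl a \<in> G"
    and refl_neg: "\<And>a. refl (neg a) = refl a"
    and refl_conj: "\<And>g a. g \<in> G \<Longrightarrow> a \<in> P \<Longrightarrow> refl (act g a) = g \<circ> refl a \<circ> inv g"
    and refl_refl: "\<And>a. a \<in> P \<Longrightarrow> refl a \<circ> refl a = id"
    and act_refl_self: "\<And>a. a \<in> P \<Longrightarrow> act (refl a) a = neg a"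
    and simple_pos: "D \<subseteq> P"
    and act_simple: "\<And>d a. d \<in> D \<Longrightarrow> a \<in> P \<Longrightarrow> a \<noteq> d \<Longrightarrow> act (refl d) a \<in> P"
    and finite_inversions: "\<And>g. g \<in> G \<Longrightarrow> finite {a \<in> P. act g a \<notin> P}"
    and trivial_if_simple_pos: "\<And>g. g \<in> G \<Longrightarrow> (\<And>d. d \<in> D \<Longrightarrow> act g d \<in> P) \<Longrightarrow> g = id"
begin

definition inversions :: "('a \<Rightarrow> 'a) \<Rightarrow> 'r set" where
  "inversions g = {a \<in> P. act g a \<notin> P}"

definition inv_num :: "('a \<Rightarrow> 'a) \<Rightarrow> nat" where
  "inv_num g = card (inversions g)"

lemma simple_refl_in: "d \<in> D \<Longrightarrow> refl d \<in> G"
  using refl_in simple_pos by blast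

lemma comp_refl_refl: "a \<in> P \<Longrightarrow> g \<circ> refl a \<circ> refl a = g"
  by (simp add: comp_assoc refl_refl)

lemma act_refl_refl: "a \<in> P \<Longrightarrow> act (refl a) (act (refl a) b) = b"
  by (metis act_comp act_id refl_in refl_refl)

lemma neg_act_pos: "g \<in> G \<Longrightarrow> a \<in> P \<Longrightarrow> act g a \<notin> P \<longleftrightarrow> neg (act g a) \<in> P"
  using act_root neg_notin by (metis neg_neg)

lemma act_comp_refl_self:
  assumes "g \<in> G" "a \<in> P" shows "act (g \<circ> refl a) a \<in> P \<longleftrightarrow> act g a \<notin> P"
  using assms by (simp add: act_comp refl_in act_refl_self act_neg neg_act_pos)

text \<open>
  A simple reflection permutes the positive roots other than its own, so multiplying by it on the
  right moves the remaining inversions around without changing their number.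
\<close>

lemma inversions_comp_simple:
  assumes "g \<in> G" "d \<in> D"
  shows "inversions (g \<circ> refl d) - {d} = act (refl d) ` (inversions g - {d})"
proof -
  have dP: "d \<in> P" using assms simple_pos by blast
  have *: "act (refl d) a \<in> P" "act (refl d) a \<noteq> d" if "a \<in> P" "a \<noteq> d" for a
    using that assms act_simple apply blast
    using that dP by (metis act_refl_refl act_refl_self neg_notin)
  show ?thesis
  proof (intro equalityI subsetI)
    fix a assume a: "a \<in> inversions (g \<circ> refl d) - {d}"
    then have "act (refl d) a \<in> inversions g - {d}"
      using * by (auto simp: inversions_def act_comp assms simple_refl_in)
    then show "a \<in> act (refl d) ` (inversions g - {d})"
      using act_refl_refl[OF dP, of a] by (metis imageI)
  next
    fix a assume "a \<in> act (refl d) ` (inversions g - {d})"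
    then show "a \<in> inversions (g \<circ> refl d) - {d}"
      using * by (auto simp: inversions_def act_comp assms simple_refl_in act_refl_refl dP)
  qed
qed

lemma card_inversions_minus_simple:
  assumes "g \<in> G" "d \<in> D"
  shows "card (inversions (g \<circ> refl d) - {d}) = card (inversions g - {d})"
  unfolding inversions_comp_simple[OF assms]
  using assms simple_pos by (intro card_image inj_onI) (metis act_refl_refl subsetD)

lemma finite_inversions': "g \<in> G \<Longrightarrow> finite (inversions g)"
  by (simp add: inversions_def finite_inversions)

lemma inv_num_comp_simple:
  assumes "g \<in> G" "d \<in> D"
  shows "act g d \<in> P \<Longrightarrow> inv_num (g \<circ> refl d) = inv_num g + 1"
    and "act g d \<notin> P \<Longrightarrow> inv_num g = inv_num (g \<circ> refl d) + 1"
proof -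
  have dP: "d \<in> P" using assms simple_pos by blast
  have gd: "g \<circ> refl d \<in> G" using assms comp_in simple_refl_in by blast
  note fin = finite_inversions'[OF assms(1)] finite_inversions'[OF gd]
  note c = card_inversions_minus_simple[OF assms]
  note s = act_comp_refl_self[OF assms(1) dP]
  show "inv_num (g \<circ> refl d) = inv_num g + 1" if "act g d \<in> P"
  proof -
    have "d \<notin> inversions g" "d \<in> inversions (g \<circ> refl d)"
      using that s dP by (auto simp: inversions_def)
    then show ?thesis using c fin by (metis Diff_empty Diff_insert0 Suc_eq_plus1 card_Suc_Diff1 inv_num_def)
  qed
  show "inv_num g = inv_num (g \<circ> refl d) + 1" if "act g d \<notin> P"
  proof -
    have "d \<in> inversions g" "d \<notin> inversions (g \<circ> refl d)"
      using that s dP by (auto simp: inversions_def)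
    then show ?thesis using c fin by (metis Diff_empty Diff_insert0 Suc_eq_plus1 card_Suc_Diff1 inv_num_def)
  qed
qed

lemma descent_exists:
  assumes "g \<in> G" "g \<noteq> id" obtains d where "d \<in> D" "act g d \<notin> P"
  using assms trivial_if_simple_pos by blast

lemma inv_num_id: "inv_num id = 0"
  by (simp add: inv_num_def inversions_def act_id)

text \<open>
  As long as an element is nontrivial it has a simple descent, and splitting it off on the right
  lowers the number of inversions by one.
\<close>

lemma reduced_word_exists:
  assumes "g \<in> G"
  shows "\<exists>ss. length ss = inv_num g \<and> set ss \<subseteq> refl ` D \<and> foldr (\<circ>) ss id = g"
  using assms
proof (induction "inv_num g" arbitrary: g rule: less_induct)
  case less
  show ?case
  proof (cases "g = id")
    case True
    then show ?thesis by (intro exI[of _ "[]"]) (simp add: inv_num_id)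
  next
    case False
    then obtain d where d: "d \<in> D" "act g d \<notin> P" using less.prems descent_exists by blast
    let ?h = "g \<circ> refl d"
    have h: "inv_num g = inv_num ?h + 1" "?h \<in> G"
      using d less.prems by (auto simp: inv_num_comp_simple comp_in simple_refl_in)
    then obtain ss where ss: "length ss = inv_num ?h" "set ss \<subseteq> refl ` D" "foldr (\<circ>) ss id = ?h"
      using less.hyps[of ?h] by auto
    have "foldr (\<circ>) (ss @ [refl d]) id = ?h \<circ> refl d"
      by (simp only: foldr_comp_snoc ss)
    also have "\<dots> = g" using comp_refl_refl d simple_pos by blast
    finally show ?thesis using ss d h by (intro exI[of _ "ss @ [refl d]"]) auto
  qed
qed

lemma inv_num_word:
  assumes "set ss \<subseteq> refl ` D"
  shows "foldr (\<circ>) ss id \<in> G \<and> inv_num (foldr (\<circ>) ss id) \<le> length ss"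
  using assms
proof (induction ss rule: rev_induct)
  case Nil
  have "foldr (\<circ>) [] id = id" for id :: "'a \<Rightarrow> 'a" by simp
  then show ?case using id_in inv_num_id by (metis le0)
next
  case (snoc s ss)
  obtain d where d: "d \<in> D" "s = refl d" using snoc.prems by auto
  let ?g = "foldr (\<circ>) ss id"
  have g: "?g \<in> G" "inv_num ?g \<le> length ss"
    using snoc.IH[OF order_trans[OF _ snoc.prems]] by (simp_all only: set_append Un_upper1)
  have "foldr (\<circ>) (ss @ [s]) id = ?g \<circ> refl d" by (simp only: foldr_comp_snoc d)
  moreover have "inv_num (?g \<circ> refl d) \<le> inv_num ?g + 1"
    using inv_num_comp_simple[OF g(1) d(1)] by (cases "act ?g d \<in> P") auto
  moreover have "?g \<circ> refl d \<in> G" using g comp_in simple_refl_in d by blast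
  ultimately show ?case
    using g by (metis add_le_mono1 le_trans length_append_singleton Suc_eq_plus1)
qed

lemma cox_length_eq_inv_num:
  assumes "g \<in> G" shows "cox_length (refl ` D) g = inv_num g"
  unfolding cox_length_def
proof (rule Least_equality)
  show "\<exists>ss. length ss = inv_num g \<and> set ss \<subseteq> refl ` D \<and> foldr (\<circ>) ss id = g"
    using reduced_word_exists[OF assms] .
qed (use inv_num_word in blast)

text \<open>
  Split off a simple descent \<open>d\<close> of \<open>g\<close>. For \<open>a \<noteq> d\<close> the root \<open>r\<^sub>d a\<close> is an inversion of \<open>g r\<^sub>d\<close>,
  and \<open>(g r\<^sub>d) r\<^bsub>r\<^sub>d a\<^esub> = g r\<^sub>a r\<^sub>d\<close>. By induction this element has fewer inversions than \<open>g r\<^sub>d\<close>,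
  and the last factor \<open>r\<^sub>d\<close> changes the number by one only.
\<close>

lemma inv_num_comp_refl_less:
  assumes "g \<in> G" "a \<in> P" "act g a \<notin> P"
  shows "inv_num (g \<circ> refl a) < inv_num g"
  using assms
proof (induction "inv_num g" arbitrary: g a rule: less_induct)
  case less
  then have "g \<noteq> id" using act_id by metis
  then obtain d where d: "d \<in> D" "act g d \<notin> P" using less.prems descent_exists by blast
  have dP: "d \<in> P" using d simple_pos by blast
  show ?case
  proof (cases "a = d")
    case True
    then show ?thesis using inv_num_comp_simple(2)[OF less.prems(1) d] by simp
  next
    case False
    let ?h = "g \<circ> refl d" and ?b = "act (refl d) a"
    have h: "inv_num g = inv_num ?h + 1" "?h \<in> G"
      using d less.prems by (auto simp: inv_num_comp_simple comp_in simple_refl_in)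
    have b: "?b \<in> P" using act_simple d False less.prems by blast
    have "act ?h ?b = act g a" using less.prems d dP by (simp add: act_comp simple_refl_in act_refl_refl)
    then have lt: "inv_num (?h \<circ> refl ?b) < inv_num ?h" using less.hyps[of ?h ?b] h b less.prems by simp
    have invd: "inv (refl d) = refl d" using refl_refl[OF dP] by (metis inv_unique_comp)
    have "refl ?b = refl d \<circ> refl a \<circ> refl d"
      using refl_conj[OF simple_refl_in[OF d(1)] less.prems(2)] invd by simp
    then have "?h \<circ> refl ?b = (g \<circ> refl d \<circ> refl d) \<circ> refl a \<circ> refl d" by (simp add: comp_assoc)
    then have eq: "?h \<circ> refl ?b = (g \<circ> refl a) \<circ> refl d" by (simp only: comp_refl_refl[OF dP])
    have ga: "g \<circ> refl a \<in> G" using less.prems comp_in refl_in by blast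
    have "inv_num (g \<circ> refl a) \<le> inv_num ((g \<circ> refl a) \<circ> refl d) + 1"
      using inv_num_comp_simple[OF ga d(1)] by (cases "act (g \<circ> refl a) d \<in> P") auto
    then show ?thesis using lt eq h by simp
  qed
qed

lemma inv_num_less_comp_refl:
  assumes "g \<in> G" "a \<in> P" "act g a \<in> P"
  shows "inv_num g < inv_num (g \<circ> refl a)"
  using inv_num_comp_refl_less[of "g \<circ> refl a" a] assms
  by (simp add: act_comp_refl_self comp_in refl_in comp_refl_refl)

text \<open>
  When the simple descents of \<open>g\<close> are split off one after the other, the root \<open>a\<close> is carried along
  as an inversion of what remains, and it must become one of the simple roots split off. Applied
  to \<open>g = r\<^sub>a\<close>, this makes every positive root conjugate to a simple one.
\<close>

lemma inversion_conj_simple: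
  assumes "g \<in> G" "a \<in> P" "act g a \<notin> P"
  shows "\<exists>u\<in>G. \<exists>d\<in>D. a = act u d"
  using assms
proof (induction "inv_num g" arbitrary: g a rule: less_induct)
  case less
  then have "g \<noteq> id" using act_id by metis
  then obtain d where d: "d \<in> D" "act g d \<notin> P" using less.prems descent_exists by blast
  have dP: "d \<in> P" using d simple_pos by blast
  show ?case
  proof (cases "a = d")
    case True
    then show ?thesis using d id_in act_id by metis
  next
    case False
    let ?h = "g \<circ> refl d" and ?b = "act (refl d) a"
    have h: "inv_num g = inv_num ?h + 1" "?h \<in> G"
      using d less.prems by (auto simp: inv_num_comp_simple comp_in simple_refl_in)
    have b: "?b \<in> P" using act_simple d False less.prems by blast
    have "act ?h ?b = act g a" using less.prems d dP by (simp add: act_comp simple_refl_in act_refl_refl)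
    then obtain u c where u: "u \<in> G" "c \<in> D" "?b = act u c" using less.hyps[of ?h ?b] h b less.prems by auto
    then have "a = act (refl d \<circ> u) c" using d dP
      by (metis act_comp act_refl_refl simple_refl_in)
    then show ?thesis using u d comp_in simple_refl_in by blast
  qed
qed

lemma cox_reflections_eq: "cox_reflections G (refl ` D) = refl ` P"
proof (intro equalityI subsetI)
  fix r assume "r \<in> cox_reflections G (refl ` D)"
  then obtain u d where "u \<in> G" "d \<in> D" "r = refl (act u d)"
    unfolding cox_reflections_def using refl_conj simple_pos by fastforce
  then show "r \<in> refl ` P" using act_root simple_pos refl_neg by (metis imageI subsetD)
next
  fix r assume "r \<in> refl ` P"
  then obtain a where a: "a \<in> P" "r = refl a" by blast
  then have "act (refl a) a \<notin> P" using act_refl_self neg_notin by simp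
  then obtain u d where "u \<in> G" "d \<in> D" "a = act u d" using inversion_conj_simple a refl_in by blast
  then show "r \<in> cox_reflections G (refl ` D)"
    unfolding cox_reflections_def using a refl_conj simple_pos by blast
qed

text \<open>
  One step of the Bruhat order, downwards from \<open>x\<close> to \<open>y\<close>, where the comparison of lengths is
  replaced by the equivalent condition on the sign of a root.
\<close>

definition step :: "('a \<Rightarrow> 'a) \<Rightarrow> ('a \<Rightarrow> 'a) \<Rightarrow> bool" where
  "step y x \<longleftrightarrow> x \<in> G \<and> (\<exists>a\<in>P. y = x \<circ> refl a \<and> act x a \<notin> P)"

lemma step_in: "step y x \<Longrightarrow> x \<in> G \<and> y \<in> G"
  by (auto simp: step_def comp_in refl_in)

lemma step_inv_num: "step y x \<Longrightarrow> inv_num y < inv_num x"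
  by (auto simp: step_def inv_num_comp_refl_less)

lemma bruhat_less_eq: "bruhat_less G (refl ` D) = step\<^sup>+\<^sup>+"
proof -
  have "(\<lambda>y x. x \<in> G \<and> y \<in> G \<and> (\<exists>r\<in>cox_reflections G (refl ` D). y = x \<circ> r) \<and>
            cox_length (refl ` D) y < cox_length (refl ` D) x) = step"
    (is "?L = _")
  proof (intro ext)
    fix y x show "?L y x = step y x"
    proof
      assume L: "?L y x"
      then obtain a where a: "a \<in> P" "y = x \<circ> refl a" by (auto simp: cox_reflections_eq)
      then have "act x a \<notin> P" using L inv_num_less_comp_refl[of x a]
        by (auto simp: cox_length_eq_inv_num)
      then show "step y x" using L a by (auto simp: step_def)
    next
      assume s: "step y x"
      then show "?L y x" using step_in[OF s] step_inv_num[OF s]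
        by (auto simp: step_def cox_reflections_eq cox_length_eq_inv_num)
    qed
  qed
  then show ?thesis unfolding bruhat_less_def by simp
qed

lemma less_in: "step\<^sup>+\<^sup>+ y x \<Longrightarrow> x \<in> G \<and> y \<in> G"
  by (induction rule: tranclp.induct) (auto dest: step_in)

lemma less_inv_num: "step\<^sup>+\<^sup>+ y x \<Longrightarrow> inv_num y < inv_num x"
  by (induction rule: tranclp.induct) (auto dest: step_inv_num)

text \<open>
  For \<open>a \<noteq> d\<close> the root \<open>r\<^sub>d a\<close> is positive and \<open>x r\<^sub>d\<close> sends it to \<open>x a\<close>, so the sign condition is
  inherited.
\<close>

lemma step_comp_simple:
  assumes "step y x" "d \<in> D" "x \<noteq> y \<circ> refl d"
  shows "step (y \<circ> refl d) (x \<circ> refl d)"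
proof -
  obtain a where a: "x \<in> G" "a \<in> P" "y = x \<circ> refl a" "act x a \<notin> P"
    using assms by (auto simp: step_def)
  have dP: "d \<in> P" using assms simple_pos by blast
  have "a \<noteq> d" using a assms(3) comp_refl_refl by metis
  then have b: "act (refl d) a \<in> P" using act_simple assms a by blast
  have invd: "inv (refl d) = refl d" using refl_refl[OF dP] by (metis inv_unique_comp)
  have "refl (act (refl d) a) = refl d \<circ> refl a \<circ> refl d"
    using refl_conj[OF simple_refl_in[OF assms(2)] a(2)] invd by simp
  then have "(x \<circ> refl d) \<circ> refl (act (refl d) a) = (x \<circ> refl d \<circ> refl d) \<circ> refl a \<circ> refl d"
    by (simp add: comp_assoc)
  then have "y \<circ> refl d = (x \<circ> refl d) \<circ> refl (act (refl d) a)"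
    by (simp only: a(3) comp_refl_refl[OF dP])
  moreover have "act (x \<circ> refl d) (act (refl d) a) = act x a"
    using a assms by (simp add: act_comp simple_refl_in act_refl_refl dP)
  ultimately show ?thesis using a b assms comp_in simple_refl_in by (auto simp: step_def)
qed

lemma step_simple:
  assumes "g \<in> G" "d \<in> D"
  shows "act g d \<notin> P \<Longrightarrow> step (g \<circ> refl d) g"
    and "act g d \<in> P \<Longrightarrow> step g (g \<circ> refl d)"
proof -
  have dP: "d \<in> P" using assms simple_pos by blast
  show "act g d \<notin> P \<Longrightarrow> step (g \<circ> refl d) g" using assms dP by (auto simp: step_def)
  show "act g d \<in> P \<Longrightarrow> step g (g \<circ> refl d)"
    using assms dP act_comp_refl_self[OF assms(1) dP] comp_in simple_refl_in
    by (auto simp: step_def comp_refl_refl intro!: bexI[of _ d])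
qed

text \<open>
  Multiply a whole chain from \<open>a\<close> up to \<open>b\<close> by \<open>r\<^sub>d\<close>. Each step remains a step, except for one
  between some \<open>c\<close> and \<open>c r\<^sub>d\<close>, at which the multiplied chain meets the original one.
\<close>

lemma lifting:
  assumes "step\<^sup>*\<^sup>* a b" "d \<in> D"
  shows "step\<^sup>*\<^sup>* (a \<circ> refl d) b \<or> step\<^sup>*\<^sup>* (a \<circ> refl d) (b \<circ> refl d)"
  using assms(1)
proof (induction rule: converse_rtranclp_induct)
  case base
  then show ?case by blast
next
  case (step a a')
  show ?case
  proof (cases "a' = a \<circ> refl d")
    case True
    then show ?thesis using step by blast
  next
    case False
    then have "step (a \<circ> refl d) (a' \<circ> refl d)" using step_comp_simple step assms by blast
    then show ?thesis using step.IH by (meson converse_rtranclp_into_rtranclp)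
  qed
qed

lemma lifting_up:
  assumes "step\<^sup>*\<^sup>* a b" "d \<in> D" "b \<in> G" "act b d \<in> P"
  shows "step\<^sup>*\<^sup>* (a \<circ> refl d) (b \<circ> refl d)"
  using lifting[OF assms(1,2)] step_simple(2)[OF assms(3,2,4)] by (meson rtranclp.rtrancl_into_rtrancl)

lemma lifting_down:
  assumes "step\<^sup>*\<^sup>* a b" "d \<in> D" "b \<in> G" "act b d \<notin> P"
  shows "step\<^sup>*\<^sup>* (a \<circ> refl d) b"
  using lifting[OF assms(1,2)] step_simple(1)[OF assms(3,2,4)] by (meson rtranclp.rtrancl_into_rtrancl)

text \<open>
  The chain property. Let \<open>d\<close> be a descent of \<open>x\<close>. If \<open>d\<close> is not a descent of \<open>y\<close>, then
  \<open>y < y r\<^sub>d < x r\<^sub>d < x\<close>. Otherwise the induction hypothesis gives some \<open>v\<close> between \<open>y r\<^sub>d\<close> and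
  \<open>x r\<^sub>d\<close>, and by the lifting property either \<open>v r\<^sub>d\<close> or \<open>x r\<^sub>d\<close> is between \<open>y\<close> and \<open>x\<close>.
\<close>

lemma intermediate_exists:
  assumes "step y x" "inv_num x \<noteq> inv_num y + 1"
  shows "\<exists>v. step\<^sup>+\<^sup>+ y v \<and> step\<^sup>+\<^sup>+ v x"
  using assms
proof (induction "inv_num x" arbitrary: x y rule: less_induct)
  case less
  have xy: "x \<in> G" "y \<in> G" using step_in less.prems by auto
  have lt: "inv_num y + 1 < inv_num x" using less.prems step_inv_num by force
  then have "x \<noteq> id" using inv_num_id by auto
  then obtain d where d: "d \<in> D" "act x d \<notin> P" using xy descent_exists by blast
  have dP: "d \<in> P" using d simple_pos by blast
  let ?x = "x \<circ> refl d" and ?y = "y \<circ> refl d"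
  have x': "inv_num x = inv_num ?x + 1" "?x \<in> G" "?y \<in> G"
    using inv_num_comp_simple(2)[OF xy(1) d] d xy comp_in simple_refl_in by auto
  have xx: "step ?x x" using step_simple(1) d xy by blast
  have "x \<noteq> ?y" using lt inv_num_comp_simple[OF xy(2) d(1)] by (cases "act y d \<in> P") auto
  then have yx': "step ?y ?x" using step_comp_simple less.prems d by blast
  show ?case
  proof (cases "act y d \<in> P")
    case True
    then have "step y ?y" using step_simple(2) xy d by blast
    then show ?thesis using xx yx' by (meson tranclp.r_into_trancl tranclp.trancl_into_trancl)
  next
    case False
    then have "inv_num ?x \<noteq> inv_num ?y + 1"
      using inv_num_comp_simple(2)[OF xy(2) d(1)] x' lt by auto
    then obtain v where v: "step\<^sup>+\<^sup>+ ?y v" "step\<^sup>+\<^sup>+ v ?x" using less.hyps[of ?x ?y] x' yx' by auto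
    have vG: "v \<in> G" using v less_in by blast
    have yy: "?y \<circ> refl d = y" "?x \<circ> refl d = x" using comp_refl_refl dP by auto
    show ?thesis
    proof (cases "act v d \<in> P")
      case True
      have "act ?x d \<in> P" using act_comp_refl_self[OF xy(1) dP] d by blast
      then have "step\<^sup>*\<^sup>* (v \<circ> refl d) x"
        using lifting_up[OF tranclp_into_rtranclp[OF v(2)] d(1)] x' yy by simp
      moreover have "step\<^sup>*\<^sup>* y (v \<circ> refl d)"
        using lifting_up[OF tranclp_into_rtranclp[OF v(1)] d(1) vG True] yy by simp
      moreover have "v \<circ> refl d \<noteq> x"
        using v comp_refl_refl[OF dP, of v] less_inv_num[OF v(2)] by auto
      moreover have "v \<circ> refl d \<noteq> y"
        using v comp_refl_refl[OF dP, of v] less_inv_num[OF v(1)] by auto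
      ultimately show ?thesis by (metis rtranclpD)
    next
      case False
      then have "step\<^sup>*\<^sup>* y v"
        using lifting_down[OF tranclp_into_rtranclp[OF v(1)] d(1) vG] yy by simp
      then have "step\<^sup>+\<^sup>+ y ?x" using v by (meson rtranclp_tranclp_tranclp)
      then show ?thesis using xx by blast
    qed
  qed
qed

lemma cover_iff:
  assumes "x \<in> G" "a \<in> P"
  shows "bruhat_cover G (refl ` D) (x \<circ> refl a) x \<longleftrightarrow> inv_num x = inv_num (x \<circ> refl a) + 1"
proof
  assume c: "bruhat_cover G (refl ` D) (x \<circ> refl a) x"
  then have "step\<^sup>+\<^sup>+ (x \<circ> refl a) x" by (simp add: bruhat_cover_def bruhat_less_eq)
  then have "inv_num (x \<circ> refl a) < inv_num x" using less_inv_num by blast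
  then have "act x a \<notin> P" using inv_num_less_comp_refl[OF assms] by auto
  then have "step (x \<circ> refl a) x" using assms by (auto simp: step_def)
  then show "inv_num x = inv_num (x \<circ> refl a) + 1"
    using intermediate_exists c unfolding bruhat_cover_def bruhat_less_eq by blast
next
  assume n: "inv_num x = inv_num (x \<circ> refl a) + 1"
  then have "act x a \<notin> P" using inv_num_less_comp_refl[OF assms] by auto
  then have "step (x \<circ> refl a) x" using assms by (auto simp: step_def)
  moreover have False if "step\<^sup>+\<^sup>+ (x \<circ> refl a) v" "step\<^sup>+\<^sup>+ v x" for v
    using that[THEN less_inv_num] n by simp
  ultimately show "bruhat_cover G (refl ` D) (x \<circ> refl a) x"
    unfolding bruhat_cover_def bruhat_less_eq by blast
qed

end

section \<open>Reflections and words\<close>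

lemma linear_root_refl: "linear (root_refl \<alpha>)"
  by (rule linearI) (simp_all add: root_refl_def inner_add_left scaleR_left_distrib scaleR_right_diff_distrib)

lemma coroot_uminus: "coroot (- \<alpha>) = - coroot \<alpha>"
  by (simp add: coroot_def)

lemma root_refl_uminus: "root_refl (- \<alpha>) = root_refl \<alpha>"
  by (rule ext) (simp add: root_refl_def coroot_uminus)

lemma inner_coroot_self: "\<alpha> \<noteq> 0 \<Longrightarrow> \<alpha> \<bullet> coroot \<alpha> = 2"
  by (simp add: coroot_def)

lemma root_refl_self: "root_refl \<alpha> \<alpha> = - \<alpha>"
  by (cases "\<alpha> = 0") (simp_all add: root_refl_def inner_coroot_self scaleR_2)

lemma root_refl_root_refl: "root_refl \<alpha> (root_refl \<alpha> v) = v"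
proof (cases "\<alpha> = 0")
  case False
  then have "root_refl \<alpha> v \<bullet> coroot \<alpha> = - (v \<bullet> coroot \<alpha>)"
    by (simp add: root_refl_def inner_diff_left inner_coroot_self)
  then have "root_refl \<alpha> (root_refl \<alpha> v) = root_refl \<alpha> v + (v \<bullet> coroot \<alpha>) *\<^sub>R \<alpha>"
    by (subst root_refl_def) simp
  then show ?thesis by (simp add: root_refl_def)
qed (simp add: root_refl_def)

lemma root_refl_comp_self: "root_refl \<alpha> \<circ> root_refl \<alpha> = id"
  by (simp add: fun_eq_iff root_refl_root_refl)

lemma inner_root_refl: "root_refl \<alpha> v \<bullet> root_refl \<alpha> w = v \<bullet> w"
proof (cases "\<alpha> = 0")
  case False
  have c: "v \<bullet> coroot \<alpha> = 2 * (v \<bullet> \<alpha>) / (\<alpha> \<bullet> \<alpha>)" for v by (simp add: coroot_def)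
  have "root_refl \<alpha> v \<bullet> root_refl \<alpha> w = v \<bullet> w - (w \<bullet> coroot \<alpha>) * (v \<bullet> \<alpha>)
      - (v \<bullet> coroot \<alpha>) * (w \<bullet> \<alpha>) + (v \<bullet> coroot \<alpha>) * ((w \<bullet> coroot \<alpha>) * (\<alpha> \<bullet> \<alpha>))"
    by (simp add: root_refl_def inner_diff_left inner_diff_right inner_commute[of \<alpha> w] right_diff_distrib)
  also have "\<dots> = v \<bullet> w" using False by (simp add: c)
  finally show ?thesis .
qed (simp add: root_refl_def)

lemma orthogonal_root_refl: "orthogonal_transformation (root_refl \<alpha>)"
  by (simp add: orthogonal_transformation_def linear_root_refl inner_root_refl)

lemma orthogonal_inner:
  fixes g :: "'a::euclidean_space \<Rightarrow> 'a"
  shows "orthogonal_transformation g \<Longrightarrow> g v \<bullet> g w = v \<bullet> w"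
  by (simp add: orthogonal_transformation_def)

lemma coroot_orthogonal:
  fixes g :: "'a::euclidean_space \<Rightarrow> 'a"
  assumes "orthogonal_transformation g"
  shows "coroot (g \<alpha>) = g (coroot \<alpha>)"
  by (simp add: coroot_def orthogonal_inner[OF assms]
      linear_scale[OF orthogonal_transformation_linear[OF assms]])

lemma root_refl_orthogonal:
  fixes g :: "'a::euclidean_space \<Rightarrow> 'a"
  assumes "orthogonal_transformation g"
  shows "root_refl (g \<alpha>) (g v) = g (root_refl \<alpha> v)"
  by (simp add: root_refl_def coroot_orthogonal[OF assms] orthogonal_inner[OF assms]
      linear_diff[OF orthogonal_transformation_linear[OF assms]]
      linear_scale[OF orthogonal_transformation_linear[OF assms]])

lemma root_refl_conj:
  fixes g :: "'a::euclidean_space \<Rightarrow> 'a"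
  assumes "orthogonal_transformation g"
  shows "root_refl (g \<alpha>) = g \<circ> root_refl \<alpha> \<circ> inv g"
proof
  fix v
  have "g (inv g v) = v"
    using orthogonal_transformation_bij[OF assms] by (meson bij_inv_eq_iff)
  then show "root_refl (g \<alpha>) v = (g \<circ> root_refl \<alpha> \<circ> inv g) v"
    using root_refl_orthogonal[OF assms, of \<alpha> "inv g v"] by simp
qed

lemma scaleR_coroot_commute: "(v \<bullet> coroot \<alpha>) *\<^sub>R \<alpha> = (v \<bullet> \<alpha>) *\<^sub>R coroot \<alpha>"
  by (simp add: coroot_def)

lemma root_refl_coweight: "root_refl \<alpha> v = v - (v \<bullet> \<alpha>) *\<^sub>R coroot \<alpha>"
  by (simp add: root_refl_def scaleR_coroot_commute)

lemma id_in_words_group: "id \<in> words_group S"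
  unfolding words_group_def by (rule CollectI, rule exI[of _ "[]"]) (simp add: fun_eq_iff)

lemma words_group_comp_right:
  assumes "g \<in> words_group S" "s \<in> S" shows "g \<circ> s \<in> words_group S"
proof -
  obtain ss where ss: "g = foldr (\<circ>) ss id" "set ss \<subseteq> S" using assms by (auto simp: words_group_def)
  have "g \<circ> s = foldr (\<circ>) (ss @ [s]) id" by (simp only: foldr_comp_snoc ss)
  moreover have "set (ss @ [s]) \<subseteq> S" using ss assms by simp
  ultimately show ?thesis unfolding words_group_def by blast
qed

lemma words_group_induct [consumes 1, case_names id comp]:
  assumes "g \<in> words_group S" "Q id"
    and "\<And>g s. g \<in> words_group S \<Longrightarrow> s \<in> S \<Longrightarrow> Q g \<Longrightarrow> Q (g \<circ> s)"
  shows "Q g"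
proof -
  obtain ss where "g = foldr (\<circ>) ss id" "set ss \<subseteq> S" using assms(1) by (auto simp: words_group_def)
  then show ?thesis
  proof (induction ss arbitrary: g rule: rev_induct)
    case Nil
    then show ?case using assms(2) by (metis foldr.simps(1) id_apply)
  next
    case (snoc s ss)
    have "foldr (\<circ>) ss id \<in> words_group S" using snoc.prems(2) unfolding words_group_def by auto
    moreover have "Q (foldr (\<circ>) ss id)" using snoc.IH[OF refl] snoc.prems(2) by (metis Un_subset_iff set_append)
    moreover have "s \<in> S" using snoc.prems by simp
    ultimately show ?case unfolding snoc.prems(1) foldr_comp_snoc using assms(3) by blast
  qed
qed

lemma words_group_comp:
  assumes "g \<in> words_group S" "h \<in> words_group S" shows "g \<circ> h \<in> words_group S"
  using assms(2,1)
  by (induction h rule: words_group_induct) (simp_all add: words_group_comp_right flip: comp_assoc)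

lemma words_group_mono: "S \<subseteq> T \<Longrightarrow> words_group S \<subseteq> words_group T"
  unfolding words_group_def by blast

lemma id_in_weyl: "id \<in> weyl K"
  by (simp add: weyl_def id_in_words_group)

lemma weyl_comp: "g \<in> weyl K \<Longrightarrow> h \<in> weyl K \<Longrightarrow> g \<circ> h \<in> weyl K"
  by (simp add: weyl_def words_group_comp)

lemma root_refl_in_weyl_simple: "i \<in> K \<Longrightarrow> root_refl i \<in> weyl K"
  unfolding weyl_def using words_group_comp_right[OF id_in_words_group] by (metis id_comp imageI)

lemma weyl_mono: "K \<subseteq> L \<Longrightarrow> weyl K \<subseteq> weyl L"
  unfolding weyl_def by (intro words_group_mono image_mono)

lemma weyl_induct [consumes 1, case_names id comp]:
  assumes "g \<in> weyl K" "Q id"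
    and "\<And>g i. g \<in> weyl K \<Longrightarrow> i \<in> K \<Longrightarrow> Q g \<Longrightarrow> Q (g \<circ> root_refl i)"
  shows "Q g"
  using assms(1) unfolding weyl_def
proof (induction rule: words_group_induct)
  case (comp g s)
  then show ?case using assms(3) unfolding weyl_def by blast
qed (rule assms(2))

lemma orthogonal_weyl: "g \<in> weyl K \<Longrightarrow> orthogonal_transformation g"
proof (induction rule: weyl_induct)
  case id
  then show ?case unfolding id_def by (rule orthogonal_transformation_id)
next
  case (comp g i)
  then show ?case by (intro orthogonal_transformation_compose orthogonal_root_refl)
qed

lemma bij_weyl: "g \<in> weyl K \<Longrightarrow> bij g"
  by (simp add: orthogonal_weyl orthogonal_transformation_bij)

lemma linear_weyl: "g \<in> weyl K \<Longrightarrow> linear g"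
  by (simp add: orthogonal_weyl orthogonal_transformation_linear)

lemma inv_root_refl: "inv (root_refl \<alpha>) = root_refl \<alpha>"
  by (rule inv_unique_comp) (simp_all add: root_refl_comp_self)

lemma weyl_inv: "g \<in> weyl K \<Longrightarrow> inv g \<in> weyl K"
proof (induction rule: weyl_induct)
  case id
  then show ?case using id_in_weyl by (simp only: inv_id)
next
  case (comp g i)
  have "inv (g \<circ> root_refl i) = root_refl i \<circ> inv g"
    using comp bij_weyl root_refl_in_weyl_simple by (metis inv_root_refl o_inv_distrib)
  then show ?case using comp weyl_comp root_refl_in_weyl_simple by metis
qed

lemma weyl_inv_left: "g \<in> weyl K \<Longrightarrow> inv g (g v) = v"
  using bij_weyl by (metis bij_inv_eq_iff)

lemma weyl_inv_right: "g \<in> weyl K \<Longrightarrow> g (inv g v) = v"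
  using bij_weyl by (metis bij_inv_eq_iff)

lemma weyl_inner: "g \<in> weyl K \<Longrightarrow> g v \<bullet> g w = v \<bullet> w"
  by (simp add: orthogonal_weyl orthogonal_inner)

lemma weyl_inner_inv: "g \<in> weyl K \<Longrightarrow> inv g v \<bullet> w = v \<bullet> g w"
  by (metis weyl_inner weyl_inv_right)

lemma weyl_minus: "g \<in> weyl K \<Longrightarrow> g (- v) = - g v"
  by (rule linear_neg[OF linear_weyl])

section \<open>Positive roots and coefficients\<close>

locale finite_roots =
  fixes \<Phi> \<Delta> :: "'a::euclidean_space set"
  assumes root_system: "root_system \<Phi>" and simple: "simple_roots \<Phi> \<Delta>"
begin

abbreviation "\<omega> \<equiv> fund_coweight \<Delta>"
abbreviation "P \<equiv> pos_roots \<Phi> \<Delta>"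
abbreviation "PJ \<equiv> par_pos_roots \<Phi> \<Delta>"

lemma finite_root_set: "finite \<Phi>"
  and zero_notin_roots: "0 \<notin> \<Phi>"
  and span_roots: "span \<Phi> = UNIV"
  and refl_root: "\<alpha> \<in> \<Phi> \<Longrightarrow> \<beta> \<in> \<Phi> \<Longrightarrow> root_refl \<alpha> \<beta> \<in> \<Phi>"
  and coroot_root_int: "\<alpha> \<in> \<Phi> \<Longrightarrow> \<beta> \<in> \<Phi> \<Longrightarrow> coroot \<alpha> \<bullet> \<beta> \<in> \<int>"
  and reduced: "\<alpha> \<in> \<Phi> \<Longrightarrow> c *\<^sub>R \<alpha> \<in> \<Phi> \<Longrightarrow> c = 1 \<or> c = - 1"
proof -
  note rs = root_system[unfolded root_system_def]
  show "finite \<Phi>" using rs by (rule conjunct1)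
  note rs = rs[THEN conjunct2]
  show "0 \<notin> \<Phi>" using rs by (rule conjunct1)
  note rs = rs[THEN conjunct2]
  show "span \<Phi> = UNIV" using rs by (rule conjunct1)
  note rs = rs[THEN conjunct2]
  show "\<alpha> \<in> \<Phi> \<Longrightarrow> \<beta> \<in> \<Phi> \<Longrightarrow> root_refl \<alpha> \<beta> \<in> \<Phi>" using rs[THEN conjunct1] by blast
  note rs = rs[THEN conjunct2]
  show "\<alpha> \<in> \<Phi> \<Longrightarrow> \<beta> \<in> \<Phi> \<Longrightarrow> coroot \<alpha> \<bullet> \<beta> \<in> \<int>" using rs[THEN conjunct1] by blast
  show "\<alpha> \<in> \<Phi> \<Longrightarrow> c *\<^sub>R \<alpha> \<in> \<Phi> \<Longrightarrow> c = 1 \<or> c = - 1" using rs[THEN conjunct2] by blast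
qed

lemma simple_root: "i \<in> \<Delta> \<Longrightarrow> i \<in> \<Phi>" and simple_independent: "independent \<Delta>"
  using simple unfolding simple_roots_def by auto

lemma root_nat_span: "\<beta> \<in> \<Phi> \<Longrightarrow> \<beta> \<in> nat_span \<Delta> \<or> - \<beta> \<in> nat_span \<Delta>"
  using simple unfolding simple_roots_def by simp

lemma finite_simple: "finite \<Delta>"
  using finite_root_set simple_root by (meson finite_subset subsetI)

lemma uminus_root: "\<beta> \<in> \<Phi> \<Longrightarrow> - \<beta> \<in> \<Phi>"
  using refl_root[of \<beta> \<beta>] by (simp add: root_refl_self)

lemma span_simple: "span \<Delta> = UNIV"
proof -
  have "nat_span \<Delta> \<subseteq> span \<Delta>" unfolding nat_span_def 
    by clarify (intro span_sum span_scale span_base)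
  then have "\<Phi> \<subseteq> span \<Delta>" using root_nat_span by (metis minus_minus span_neg subsetD subsetI)
  then show ?thesis using span_roots by (metis span_mono span_span top.extremum_uniqueI)
qed

text \<open>
  The simple roots are a basis of the space, so the dual basis exists. Pairing with \<open>\<omega> i\<close> reads
  off the coefficient of \<open>i\<close>; since the span of a set \<open>K\<close> of simple roots is described by the
  vanishing of the other coefficients, parabolic subsystems can be treated inside \<open>\<Phi>\<close>.
\<close>

lemma fund_coweight_pairing:
  assumes "k \<in> \<Delta>" shows "\<omega> i \<bullet> k = (if k = i then 1 else 0)"
proof -
  obtain f where f: "linear f" "\<And>k. k \<in> \<Delta> \<Longrightarrow> f k = (if k = i then 1 else (0::real))"
    using linear_independent_extend[OF simple_independent, of "\<lambda>k. if k = i then 1 else (0::real)"] by auto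
  have 1: "\<forall>k\<in>\<Delta>. adjoint f 1 \<bullet> k = (if k = i then 1 else 0)"
    using adjoint_works[OF f(1), of _ 1] f(2) by (simp add: inner_commute)
  have 2: "v = w" if "\<forall>k\<in>\<Delta>. v \<bullet> k = (if k = i then 1 else 0)" "\<forall>k\<in>\<Delta>. w \<bullet> k = (if k = i then 1 else 0)" for v w
  proof -
    have "\<forall>k\<in>\<Delta>. orthogonal (v - w) k" using that by (simp add: orthogonal_def inner_diff_left)
    then have "orthogonal (v - w) (v - w)" using span_simple
      by (metis UNIV_I orthogonal_to_span)
    then show ?thesis by (simp add: orthogonal_def)
  qed
  have "\<forall>k\<in>\<Delta>. \<omega> i \<bullet> k = (if k = i then 1 else 0)"
    unfolding fund_coweight_def by (rule theI'[of "\<lambda>v. \<forall>k\<in>\<Delta>. v \<bullet> k = (if k = i then 1 else 0)"]) (use 1 2 in blast)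
  then show ?thesis using assms by blast
qed

lemma coeff_sum:
  assumes "K \<subseteq> \<Delta>" shows "\<omega> i \<bullet> (\<Sum>s\<in>K. c s *\<^sub>R s) = (if i \<in> K then c i else 0)"
proof -
  have "finite K" using assms finite_simple finite_subset by blast
  have "\<omega> i \<bullet> (\<Sum>s\<in>K. c s *\<^sub>R s) = (\<Sum>s\<in>K. if s = i then c s else 0)"
    unfolding inner_sum_right using assms by (intro sum.cong refl) (auto simp: fund_coweight_pairing)
  then show ?thesis using \<open>finite K\<close> by (simp add: sum.delta)
qed

lemma simple_expansion: "v = (\<Sum>i\<in>\<Delta>. (\<omega> i \<bullet> v) *\<^sub>R i)"
proof -
  obtain u where "v = (\<Sum>i\<in>\<Delta>. u i *\<^sub>R i)"
    using span_simple finite_simple span_finite[of \<Delta>] by (metis (no_types, lifting) UNIV_I imageE)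
  then show ?thesis using coeff_sum[of \<Delta>] by (metis (no_types, lifting) order_refl sum.cong)
qed

lemma simple_expansion_par:
  assumes "K \<subseteq> \<Delta>" "\<And>i. i \<in> \<Delta> - K \<Longrightarrow> \<omega> i \<bullet> v = 0"
  shows "v = (\<Sum>i\<in>K. (\<omega> i \<bullet> v) *\<^sub>R i)"
  using simple_expansion[of v] sum.mono_neutral_right[OF finite_simple assms(1), of "\<lambda>i. (\<omega> i \<bullet> v) *\<^sub>R i"] assms(2)
  by simp

lemma coweight_expansion: "v = (\<Sum>i\<in>\<Delta>. (v \<bullet> i) *\<^sub>R \<omega> i)"
proof -
  let ?w = "\<Sum>i\<in>\<Delta>. (v \<bullet> i) *\<^sub>R \<omega> i"
  have "?w \<bullet> k = v \<bullet> k" if "k \<in> \<Delta>" for k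
  proof -
    have "?w \<bullet> k = (\<Sum>i\<in>\<Delta>. if k = i then v \<bullet> i else 0)"
      unfolding inner_sum_left using that by (intro sum.cong refl) (auto simp: fund_coweight_pairing)
    then show ?thesis using that finite_simple by (simp add: sum.delta')
  qed
  then have "\<forall>k\<in>\<Delta>. orthogonal (v - ?w) k" by (simp add: orthogonal_def inner_diff_left)
  then have "orthogonal (v - ?w) (v - ?w)" using span_simple by (metis UNIV_I orthogonal_to_span)
  then show ?thesis by (simp add: orthogonal_def)
qed

lemma nat_span_iff:
  assumes "K \<subseteq> \<Delta>"
  shows "v \<in> nat_span K \<longleftrightarrow> (\<forall>i\<in>K. \<omega> i \<bullet> v \<in> \<nat>) \<and> (\<forall>i\<in>\<Delta>-K. \<omega> i \<bullet> v = 0)"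
proof
  assume "v \<in> nat_span K"
  then show "(\<forall>i\<in>K. \<omega> i \<bullet> v \<in> \<nat>) \<and> (\<forall>i\<in>\<Delta>-K. \<omega> i \<bullet> v = 0)"
    using coeff_sum[OF assms] by (auto simp: nat_span_def)
next
  assume r: "(\<forall>i\<in>K. \<omega> i \<bullet> v \<in> \<nat>) \<and> (\<forall>i\<in>\<Delta>-K. \<omega> i \<bullet> v = 0)"
  then have "\<forall>i\<in>K. \<exists>n. \<omega> i \<bullet> v = of_nat n" by (meson Nats_cases)
  then obtain c where "\<forall>i\<in>K. \<omega> i \<bullet> v = of_nat (c i)" by metis
  then have "v = (\<Sum>i\<in>K. of_nat (c i) *\<^sub>R i)"
    using simple_expansion_par[OF assms, of v] r by (metis (no_types, lifting) sum.cong)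
  then show "v \<in> nat_span K" by (auto simp: nat_span_def)
qed

lemma int_span_iff:
  assumes "K \<subseteq> \<Delta>"
  shows "v \<in> int_span K \<longleftrightarrow> (\<forall>i\<in>K. \<omega> i \<bullet> v \<in> \<int>) \<and> (\<forall>i\<in>\<Delta>-K. \<omega> i \<bullet> v = 0)"
proof
  assume "v \<in> int_span K"
  then show "(\<forall>i\<in>K. \<omega> i \<bullet> v \<in> \<int>) \<and> (\<forall>i\<in>\<Delta>-K. \<omega> i \<bullet> v = 0)"
    using coeff_sum[OF assms] by (auto simp: int_span_def)
next
  assume r: "(\<forall>i\<in>K. \<omega> i \<bullet> v \<in> \<int>) \<and> (\<forall>i\<in>\<Delta>-K. \<omega> i \<bullet> v = 0)"
  then have "\<forall>i\<in>K. \<exists>n. \<omega> i \<bullet> v = of_int n" by (meson Ints_cases)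
  then obtain c where "\<forall>i\<in>K. \<omega> i \<bullet> v = of_int (c i)" by metis
  then have "v = (\<Sum>i\<in>K. of_int (c i) *\<^sub>R i)"
    using simple_expansion_par[OF assms, of v] r by (metis (no_types, lifting) sum.cong)
  then show "v \<in> int_span K" by (auto simp: int_span_def)
qed

lemma coeff_root_int: "\<beta> \<in> \<Phi> \<Longrightarrow> i \<in> \<Delta> \<Longrightarrow> \<omega> i \<bullet> \<beta> \<in> \<int>"
  using root_nat_span[of \<beta>] nat_span_iff[OF order_refl]
  by (metis Ints_minus Nats_subset_Ints inner_minus_right minus_minus subsetD)

lemma root_coeff_sign:
  assumes "\<beta> \<in> \<Phi>" shows "(\<forall>i\<in>\<Delta>. 0 \<le> \<omega> i \<bullet> \<beta>) \<or> (\<forall>i\<in>\<Delta>. \<omega> i \<bullet> \<beta> \<le> 0)"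
proof -
  have nn: "\<forall>i\<in>\<Delta>. 0 \<le> \<omega> i \<bullet> v" if "v \<in> nat_span \<Delta>" for v
  proof
    fix i assume "i \<in> \<Delta>"
    then have "\<omega> i \<bullet> v \<in> \<nat>" using that unfolding nat_span_iff[OF order_refl] by blast
    then show "0 \<le> \<omega> i \<bullet> v" by (auto elim: Nats_cases)
  qed
  show ?thesis using root_nat_span[OF assms]
  proof
    assume "- \<beta> \<in> nat_span \<Delta>"
    then show ?thesis using nn[of "- \<beta>"] by simp
  qed (use nn in blast)
qed

lemma pos_root_iff: "\<beta> \<in> P \<longleftrightarrow> \<beta> \<in> \<Phi> \<and> (\<forall>i\<in>\<Delta>. 0 \<le> \<omega> i \<bullet> \<beta>)"
proof -
  have "\<beta> \<in> nat_span \<Delta> \<longleftrightarrow> (\<forall>i\<in>\<Delta>. 0 \<le> \<omega> i \<bullet> \<beta>)" if "\<beta> \<in> \<Phi>"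
    using that coeff_root_int[OF that] by (auto simp: nat_span_iff Nats_altdef2)
  then show ?thesis by (auto simp: pos_roots_def)
qed

lemma eq_if_coeffs_eq: "(\<And>i. i \<in> \<Delta> \<Longrightarrow> \<omega> i \<bullet> v = \<omega> i \<bullet> w) \<Longrightarrow> v = w"
  using simple_expansion[of v] simple_expansion[of w] by simp

lemma root_coeff_nonzero: "\<beta> \<in> \<Phi> \<Longrightarrow> \<exists>i\<in>\<Delta>. \<omega> i \<bullet> \<beta> \<noteq> 0"
  using eq_if_coeffs_eq[of \<beta> 0] zero_notin_roots by auto

lemma pos_root: "\<beta> \<in> P \<Longrightarrow> \<beta> \<in> \<Phi>"
  by (simp add: pos_root_iff)

lemma pos_or_neg: "\<beta> \<in> \<Phi> \<Longrightarrow> \<beta> \<in> P \<or> - \<beta> \<in> P"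
  using root_coeff_sign[of \<beta>] by (auto simp: pos_root_iff uminus_root)

lemma uminus_notin_pos: assumes "\<beta> \<in> P" shows "- \<beta> \<notin> P"
proof
  assume "- \<beta> \<in> P"
  then have "\<omega> i \<bullet> \<beta> = 0" if "i \<in> \<Delta>" for i
    using assms that by (auto simp: pos_root_iff intro: antisym)
  then show False using root_coeff_nonzero assms pos_root by blast
qed

lemma not_pos_iff: "\<beta> \<in> \<Phi> \<Longrightarrow> \<beta> \<notin> P \<longleftrightarrow> - \<beta> \<in> P"
  using pos_or_neg uminus_notin_pos by fastforce

lemma pos_if_coeff_pos: "\<beta> \<in> \<Phi> \<Longrightarrow> i \<in> \<Delta> \<Longrightarrow> 0 < \<omega> i \<bullet> \<beta> \<Longrightarrow> \<beta> \<in> P"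
  using root_coeff_sign[of \<beta>] by (fastforce simp: pos_root_iff)

lemma simple_pos_root: "i \<in> \<Delta> \<Longrightarrow> i \<in> P"
  by (simp add: pos_root_iff simple_root fund_coweight_pairing)

lemma finite_pos: "finite P"
  using finite_root_set pos_root by (meson finite_subset subsetI)

lemma par_root_iff: "K \<subseteq> \<Delta> \<Longrightarrow> \<beta> \<in> par_roots \<Phi> K \<longleftrightarrow> \<beta> \<in> \<Phi> \<and> (\<forall>i\<in>\<Delta>-K. \<omega> i \<bullet> \<beta> = 0)"
  using coeff_root_int by (auto simp: par_roots_def int_span_iff)

lemma par_pos_iff: "K \<subseteq> \<Delta> \<Longrightarrow> \<beta> \<in> PJ K \<longleftrightarrow> \<beta> \<in> P \<and> (\<forall>i\<in>\<Delta>-K. \<omega> i \<bullet> \<beta> = 0)"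
  using pos_root by (auto simp: par_pos_roots_def par_root_iff)

lemma simple_par_pos: "K \<subseteq> \<Delta> \<Longrightarrow> i \<in> K \<Longrightarrow> i \<in> PJ K"
  by (auto simp: par_pos_iff simple_pos_root fund_coweight_pairing)

lemma par_roots_simple: "par_roots \<Phi> \<Delta> = \<Phi>"
  using par_root_iff[OF order_refl] by blast

lemma par_pos_or_neg: "K \<subseteq> \<Delta> \<Longrightarrow> \<beta> \<in> par_roots \<Phi> K \<Longrightarrow> \<beta> \<in> PJ K \<or> - \<beta> \<in> PJ K"
  using pos_or_neg by (auto simp: par_root_iff par_pos_iff)

lemma pairing_expansion: "v \<bullet> \<beta> = (\<Sum>i\<in>\<Delta>. (\<omega> i \<bullet> \<beta>) * (v \<bullet> i))"
  by (subst simple_expansion[of \<beta>]) (simp add: inner_sum_right)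

lemma pairing_expansion_par:
  assumes "K \<subseteq> \<Delta>" "\<beta> \<in> par_roots \<Phi> K"
  shows "v \<bullet> \<beta> = (\<Sum>i\<in>K. (\<omega> i \<bullet> \<beta>) * (v \<bullet> i))"
  by (subst simple_expansion_par[OF assms(1), of \<beta>])
    (use assms in \<open>auto simp: inner_sum_right par_root_iff\<close>)

lemma coeff_root_refl: "i \<in> \<Delta> \<Longrightarrow> k \<noteq> i \<Longrightarrow> \<omega> k \<bullet> root_refl i v = \<omega> k \<bullet> v"
  by (simp add: root_refl_def inner_diff_right fund_coweight_pairing)

text \<open>
  A positive root other than \<open>i\<close> has a positive coefficient at some \<open>k \<noteq> i\<close>, which \<open>r\<^sub>i\<close> does not
  change; and a root with one positive coefficient is positive.
\<close>

lemma simple_refl_pos: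
  assumes "i \<in> \<Delta>" "\<beta> \<in> P" "\<beta> \<noteq> i" shows "root_refl i \<beta> \<in> P"
proof -
  have "\<exists>k\<in>\<Delta>. k \<noteq> i \<and> 0 < \<omega> k \<bullet> \<beta>"
  proof (rule ccontr)
    assume "\<not> ?thesis"
    then have "\<omega> k \<bullet> \<beta> = \<omega> k \<bullet> ((\<omega> i \<bullet> \<beta>) *\<^sub>R i)" if "k \<in> \<Delta>" for k
      using that assms by (cases "k = i") (force simp: pos_root_iff fund_coweight_pairing)+
    then have eq: "\<beta> = (\<omega> i \<bullet> \<beta>) *\<^sub>R i" by (rule eq_if_coeffs_eq)
    then have "\<omega> i \<bullet> \<beta> = 1 \<or> \<omega> i \<bullet> \<beta> = - 1"
      using reduced simple_root assms pos_root by metis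
    then show False using eq assms by (auto simp: pos_root_iff)
  qed
  then show ?thesis using assms coeff_root_refl pos_if_coeff_pos refl_root simple_root pos_root by metis
qed

section \<open>The Weyl group and its parabolic subgroups\<close>

lemma weyl_root: "g \<in> weyl K \<Longrightarrow> K \<subseteq> \<Delta> \<Longrightarrow> \<beta> \<in> \<Phi> \<Longrightarrow> g \<beta> \<in> \<Phi>"
  by (induction arbitrary: \<beta> rule: weyl_induct) (auto simp: refl_root simple_root subset_iff)

lemma coeff_weyl: "g \<in> weyl K \<Longrightarrow> K \<subseteq> \<Delta> \<Longrightarrow> k \<in> \<Delta> - K \<Longrightarrow> \<omega> k \<bullet> g v = \<omega> k \<bullet> v"
proof (induction arbitrary: v rule: weyl_induct)
  case (comp g i)
  then show ?case by (metis DiffE coeff_root_refl comp_apply subsetD)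
qed simp

lemma weyl_par_root: "g \<in> weyl K \<Longrightarrow> K \<subseteq> \<Delta> \<Longrightarrow> \<beta> \<in> par_roots \<Phi> K \<Longrightarrow> g \<beta> \<in> par_roots \<Phi> K"
  by (auto simp: par_root_iff weyl_root coeff_weyl)

text \<open>
  A root outside \<open>\<Phi>\<^sub>K\<close> has a nonzero coefficient at some \<open>k \<notin> K\<close>, which \<open>W\<^sub>K\<close> leaves unchanged and
  which decides the sign.
\<close>

lemma weyl_pos_outside:
  assumes "g \<in> weyl K" "K \<subseteq> \<Delta>" "\<beta> \<in> P - PJ K" shows "g \<beta> \<in> P - PJ K"
proof -
  obtain k where k: "k \<in> \<Delta> - K" "\<omega> k \<bullet> \<beta> \<noteq> 0" using assms by (auto simp: par_pos_iff)
  then have "0 < \<omega> k \<bullet> \<beta>" using assms by (force simp: pos_root_iff)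
  then have k': "0 < \<omega> k \<bullet> g \<beta>" using k coeff_weyl assms by simp
  then have "g \<beta> \<in> P" using k assms weyl_root pos_root pos_if_coeff_pos by blast
  then show ?thesis using k k' assms by (force simp: par_pos_iff)
qed

lemma weyl_bij_outside:
  assumes "g \<in> weyl K" "K \<subseteq> \<Delta>" shows "bij_betw g (P - PJ K) (P - PJ K)"
proof (rule bij_betwI[where g="inv g"])
  show "g \<in> (P - PJ K) \<rightarrow> P - PJ K" "inv g \<in> (P - PJ K) \<rightarrow> P - PJ K"
    using weyl_pos_outside assms weyl_inv by blast+
qed (use assms weyl_inv_left weyl_inv_right in auto)

text \<open>
  Induction on the height: \<open>\<langle>\<beta>, \<beta>\<rangle> > 0\<close> gives some \<open>i \<in> K\<close> with \<open>\<langle>\<beta>, i\<rangle> > 0\<close>, and then \<open>r\<^sub>i\<beta>\<close>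
  has smaller height than \<open>\<beta>\<close>.
\<close>

lemma pos_root_induct [consumes 2, case_names simple refl]:
  assumes "K \<subseteq> \<Delta>" "\<beta> \<in> PJ K"
    and s: "\<And>i. i \<in> K \<Longrightarrow> Q i"
    and r: "\<And>\<beta> i. \<beta> \<in> PJ K \<Longrightarrow> i \<in> K \<Longrightarrow> root_refl i \<beta> \<in> PJ K \<Longrightarrow> Q (root_refl i \<beta>) \<Longrightarrow> Q \<beta>"
  shows "Q \<beta>"
  using assms(2)
proof (induction "nat \<lfloor>(\<Sum>i\<in>\<Delta>. \<omega> i) \<bullet> \<beta>\<rfloor>" arbitrary: \<beta> rule: less_induct)
  case less
  let ?h = "\<Sum>i\<in>\<Delta>. \<omega> i"
  have b: "\<beta> \<in> P" "\<beta> \<in> \<Phi>" "\<beta> \<in> par_roots \<Phi> K" "\<beta> \<noteq> 0"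
    using less.prems pos_root zero_notin_roots by (auto simp: par_pos_roots_def)
  have "0 < \<beta> \<bullet> \<beta>" using b by simp
  also have "\<beta> \<bullet> \<beta> = (\<Sum>i\<in>K. (\<omega> i \<bullet> \<beta>) * (\<beta> \<bullet> i))" by (rule pairing_expansion_par[OF assms(1) b(3)])
  finally obtain i where i: "i \<in> K" "0 < (\<omega> i \<bullet> \<beta>) * (\<beta> \<bullet> i)" by (meson not_le sum_nonpos)
  have iD: "i \<in> \<Delta>" using i assms by blast
  have "0 \<le> \<omega> i \<bullet> \<beta>" using b iD by (simp add: pos_root_iff)
  then have "0 < \<beta> \<bullet> i" using i(2) by (simp add: zero_less_mult_iff)
  moreover have "0 < i \<bullet> i" using iD simple_root zero_notin_roots by force
  ultimately have ipos: "0 < coroot i \<bullet> \<beta>" by (simp add: coroot_def inner_commute)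
  have hgt: "0 \<le> ?h \<bullet> \<gamma>" if "\<gamma> \<in> P" for \<gamma> using that by (auto simp: inner_sum_left pos_root_iff intro: sum_nonneg)
  have hint: "?h \<bullet> \<gamma> \<in> \<int>" if "\<gamma> \<in> \<Phi>" for \<gamma> using coeff_root_int that by (auto simp: inner_sum_left)
  have hi: "?h \<bullet> i = 1"
    using iD finite_simple by (simp add: inner_sum_left fund_coweight_pairing sum.delta')
  show ?case
  proof (cases "\<beta> = i")
    case True
    then show ?thesis using s i by blast
  next
    case False
    have p: "root_refl i \<beta> \<in> P" using simple_refl_pos iD b False by blast
    have rp: "root_refl i \<beta> \<in> PJ K"
      unfolding par_pos_iff[OF assms(1)]
    proof (intro conjI ballI)
      fix k assume k: "k \<in> \<Delta> - K"
      then have "k \<noteq> i" using i(1) by blast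
      then show "\<omega> k \<bullet> root_refl i \<beta> = 0"
        using coeff_root_refl[OF iD, of k \<beta>] less.prems k by (simp add: par_pos_iff[OF assms(1)])
    qed (rule p)
    have "?h \<bullet> root_refl i \<beta> < ?h \<bullet> \<beta>"
      using ipos hi by (simp add: root_refl_def inner_diff_right inner_commute)
    then have "\<lfloor>?h \<bullet> root_refl i \<beta>\<rfloor> < \<lfloor>?h \<bullet> \<beta>\<rfloor>"
      using hint[OF b(2)] hint[OF pos_root[OF p]] by (auto elim!: Ints_cases)
    then have "nat \<lfloor>?h \<bullet> root_refl i \<beta>\<rfloor> < nat \<lfloor>?h \<bullet> \<beta>\<rfloor>" using hgt[OF p] by linarith
    then show ?thesis using less.hyps rp r less.prems i(1) by blast
  qed
qed

lemma par_root_conj_simple: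
  assumes "K \<subseteq> \<Delta>" "\<beta> \<in> par_roots \<Phi> K"
  shows "\<exists>g\<in>weyl K. \<exists>i\<in>K. \<beta> = g i"
proof -
  have pos: "\<exists>g\<in>weyl K. \<exists>i\<in>K. \<beta> = g i" if "\<beta> \<in> PJ K" for \<beta>
    using assms(1) that
  proof (induction rule: pos_root_induct)
    case (simple i)
    then show ?case using id_in_weyl by (metis id_apply)
  next
    case (refl \<beta> i)
    then obtain g k where "g \<in> weyl K" "k \<in> K" "root_refl i \<beta> = g k" by blast
    then have "root_refl i \<circ> g \<in> weyl K" "\<beta> = (root_refl i \<circ> g) k"
      using weyl_comp[OF root_refl_in_weyl_simple[OF refl(2)]] root_refl_root_refl[of i \<beta>] by auto
    then show ?case using \<open>k \<in> K\<close> by blast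
  qed
  show ?thesis
  proof (cases "\<beta> \<in> PJ K")
    case False
    then obtain g i where g: "g \<in> weyl K" "i \<in> K" "- \<beta> = g i" using par_pos_or_neg assms pos by blast
    then have "\<beta> = (g \<circ> root_refl i) i"
      by (simp add: root_refl_self weyl_minus) (metis minus_minus)
    then show ?thesis using g weyl_comp root_refl_in_weyl_simple by blast
  qed (use pos in blast)
qed

lemma root_refl_in_weyl:
  assumes "K \<subseteq> \<Delta>" "\<beta> \<in> par_roots \<Phi> K" shows "root_refl \<beta> \<in> weyl K"
proof -
  obtain g i where g: "g \<in> weyl K" "i \<in> K" "\<beta> = g i" using par_root_conj_simple assms by blast
  then show ?thesis
    by (simp add: root_refl_conj orthogonal_weyl weyl_comp weyl_inv root_refl_in_weyl_simple)
qed

lemma root_refl_in_weyl_full: "\<beta> \<in> \<Phi> \<Longrightarrow> root_refl \<beta> \<in> weyl \<Delta>"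
  using root_refl_in_weyl[of \<Delta>] par_roots_simple by simp

text \<open>
  The exchange condition: reading the word from the right, the letter at which the image of \<open>d\<close>
  turns negative is the reflection in that image, so it can be dropped at the cost of \<open>r\<^sub>d\<close>.
\<close>

lemma word_deletion:
  assumes "set ss \<subseteq> root_refl ` \<Delta>" "d \<in> \<Delta>" "foldr (\<circ>) ss id d \<notin> P"
  shows "\<exists>ts. set ts \<subseteq> root_refl ` \<Delta> \<and> length ts < length ss \<and>
              foldr (\<circ>) ts id = foldr (\<circ>) ss id \<circ> root_refl d"
  using assms
proof (induction ss)
  case Nil
  then show ?case using simple_pos_root by simp
next
  case (Cons s ss)
  obtain i where i: "i \<in> \<Delta>" "s = root_refl i" using Cons.prems by auto
  let ?h = "foldr (\<circ>) ss id"
  have h: "?h \<in> weyl \<Delta>" using Cons.prems unfolding weyl_def words_group_def by auto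
  show ?case
  proof (cases "?h d \<in> P")
    case False
    then obtain ts where "set ts \<subseteq> root_refl ` \<Delta>" "length ts < length ss"
      "foldr (\<circ>) ts id = ?h \<circ> root_refl d"
      using Cons.IH[OF _ Cons.prems(2)] Cons.prems(1) by (meson order_trans set_subset_Cons)
    moreover from this have "foldr (\<circ>) (s # ts) id = foldr (\<circ>) (s # ss) id \<circ> root_refl d"
      by (simp only: foldr.simps comp_apply comp_assoc)
    moreover have "set (s # ts) \<subseteq> root_refl ` \<Delta>" "length (s # ts) < length (s # ss)"
      using calculation(1,2) i by auto
    ultimately show ?thesis by blast
  next
    case True
    have "foldr (\<circ>) (s # ss) id d = root_refl i (?h d)" by (simp only: foldr.simps comp_apply i)
    then have "?h d = i" using simple_refl_pos[OF i(1) True] Cons.prems(3) by metis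
    then have "s = ?h \<circ> root_refl d \<circ> inv ?h" using root_refl_conj[OF orthogonal_weyl[OF h], of d] i by simp
    then have "s \<circ> ?h \<circ> root_refl d = ?h"
      using weyl_inv_left[OF h] by (auto simp: fun_eq_iff root_refl_root_refl)
    then have "foldr (\<circ>) ss id = foldr (\<circ>) (s # ss) id \<circ> root_refl d" by simp
    moreover have "set ss \<subseteq> root_refl ` \<Delta>" "length ss < length (s # ss)" using Cons.prems(1) by auto
    ultimately show ?thesis by blast
  qed
qed

text \<open>
  If a shortest word for \<open>g\<close> ended in \<open>r\<^sub>d\<close>, then the rest of the word would send \<open>d\<close> to the
  negative root \<open>-g d\<close>, and the exchange condition would give a shorter word for \<open>g\<close>.
\<close>

lemma weyl_trivial:
  assumes "g \<in> weyl \<Delta>" "\<And>i. i \<in> \<Delta> \<Longrightarrow> g i \<in> P" shows "g = id"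
proof -
  let ?W = "\<lambda>ss. set ss \<subseteq> root_refl ` \<Delta> \<and> foldr (\<circ>) ss id = g"
  obtain ss where ss: "?W ss" using assms(1) unfolding weyl_def words_group_def by auto
  obtain ts where ts: "?W ts" "\<And>us. ?W us \<Longrightarrow> length ts \<le> length us"
    using ex_has_least_nat[of ?W ss length] ss by auto
  show ?thesis
  proof (cases ts rule: rev_cases)
    case Nil
    then show ?thesis using ts(1) by auto
  next
    case (snoc us s)
    obtain d where d: "d \<in> \<Delta>" "s = root_refl d" using ts(1) snoc by auto
    let ?h = "foldr (\<circ>) us id"
    have g: "g = ?h \<circ> root_refl d" using ts(1) d unfolding snoc foldr_comp_snoc by simp
    have us: "set us \<subseteq> root_refl ` \<Delta>" using ts(1) snoc by simp
    then have h: "?h \<in> weyl \<Delta>" unfolding weyl_def words_group_def by blast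
    have "?h d = - g d" using g h by (simp add: root_refl_self weyl_minus)
    then have "?h d \<notin> P" using assms(2)[OF d(1)] uminus_notin_pos by simp
    then obtain vs where vs: "set vs \<subseteq> root_refl ` \<Delta>" "length vs < length us"
      "foldr (\<circ>) vs id = ?h \<circ> root_refl d"
      using word_deletion us d(1) by blast
    then show ?thesis using ts(2)[of vs] g snoc by simp
  qed
qed

lemma weyl_nonneg_comb_pos:
  assumes "g \<in> weyl \<Delta>" "K \<subseteq> \<Delta>" "\<And>i. i \<in> K \<Longrightarrow> g i \<in> P" "\<beta> \<in> PJ K" shows "g \<beta> \<in> P"
proof -
  have b: "\<beta> \<in> P" "\<beta> \<in> par_roots \<Phi> K" using assms by (auto simp: par_pos_roots_def)
  have "0 \<le> \<omega> k \<bullet> g \<beta>" if k: "k \<in> \<Delta>" for k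
  proof -
    have "\<omega> k \<bullet> g \<beta> = inv g (\<omega> k) \<bullet> \<beta>" by (rule weyl_inner_inv[OF assms(1), symmetric])
    also have "\<dots> = (\<Sum>i\<in>K. (\<omega> i \<bullet> \<beta>) * (inv g (\<omega> k) \<bullet> i))"
      by (rule pairing_expansion_par[OF assms(2) b(2)])
    also have "\<dots> = (\<Sum>i\<in>K. (\<omega> i \<bullet> \<beta>) * (\<omega> k \<bullet> g i))"
      by (simp only: weyl_inner_inv[OF assms(1)])
    also have "\<dots> \<ge> 0" using b assms k by (intro sum_nonneg mult_nonneg_nonneg) (auto simp: pos_root_iff)
    finally show ?thesis .
  qed
  then show ?thesis using b assms weyl_root pos_root by (auto simp: pos_root_iff[of "g \<beta>"])
qed

lemma weyl_trivial_par:
  assumes "g \<in> weyl K" "K \<subseteq> \<Delta>" "\<And>i. i \<in> K \<Longrightarrow> g i \<in> P" shows "g = id"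
proof (rule weyl_trivial)
  show "g \<in> weyl \<Delta>" using assms weyl_mono by blast
  fix i assume i: "i \<in> \<Delta>"
  show "g i \<in> P"
  proof (cases "i \<in> K")
    case False
    then have "i \<in> P - PJ K" using i assms by (auto simp: par_pos_iff simple_pos_root fund_coweight_pairing)
    then show ?thesis using weyl_pos_outside assms by blast
  qed (use assms in auto)
qed

sublocale finite: reflection_group "weyl \<Delta>" "\<lambda>g. g" P \<Delta> uminus root_refl
proof
  fix g a assume g: "g \<in> weyl \<Delta>" and a: "a \<in> P"
  show "g a \<in> P \<or> - g a \<in> P" using g a weyl_root pos_root pos_or_neg by blast
  show "root_refl (g a) = g \<circ> root_refl a \<circ> inv g" by (rule root_refl_conj[OF orthogonal_weyl[OF g]])
next
  fix g assume "g \<in> weyl \<Delta>" "\<And>d. d \<in> \<Delta> \<Longrightarrow> g d \<in> P"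
  then show "g = id" by (rule weyl_trivial)
qed (auto simp: id_in_weyl weyl_comp weyl_minus uminus_notin_pos root_refl_uminus
    root_refl_comp_self root_refl_self simple_pos_root simple_refl_pos finite_pos
    intro: root_refl_in_weyl_full pos_root)

lemma wlength_eq: "g \<in> weyl \<Delta> \<Longrightarrow> wlength \<Delta> g = card {\<beta> \<in> P. g \<beta> \<notin> P}"
  by (simp add: wlength_def finite.cox_length_eq_inv_num finite.inv_num_def finite.inversions_def)

lemma wlength_inv_num: "g \<in> weyl \<Delta> \<Longrightarrow> wlength \<Delta> g = finite.inv_num g"
  by (simp add: wlength_def finite.cox_length_eq_inv_num)

section \<open>Minimal coset representatives\<close>

text \<open>
  Right multiplication by \<open>W\<^sub>J\<close> permutes the positive roots outside \<open>\<Phi>\<^sub>J\<close>, so it moves the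
  inversions outside \<open>\<Phi>\<^sub>J\<close> around without changing their number.
\<close>

lemma card_inversions_outside:
  assumes "w \<in> weyl \<Delta>" "u \<in> weyl J" "J \<subseteq> \<Delta>"
  shows "card {\<beta> \<in> P - PJ J. (w \<circ> u) \<beta> \<notin> P} = card {\<beta> \<in> P - PJ J. w \<beta> \<notin> P}"
proof -
  have b: "bij_betw u (P - PJ J) (P - PJ J)" using weyl_bij_outside assms by blast
  have "bij_betw u {\<beta> \<in> P - PJ J. (w \<circ> u) \<beta> \<notin> P} {\<beta> \<in> P - PJ J. w \<beta> \<notin> P}"
    unfolding bij_betw_def
  proof
    show "inj_on u {\<beta> \<in> P - PJ J. (w \<circ> u) \<beta> \<notin> P}"
      using b by (auto simp: bij_betw_def intro: inj_on_subset)
    show "u ` {\<beta> \<in> P - PJ J. (w \<circ> u) \<beta> \<notin> P} = {\<beta> \<in> P - PJ J. w \<beta> \<notin> P}"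
      using bij_betw_imp_surj_on[OF b] by auto
  qed
  then show ?thesis by (rule bij_betw_same_card)
qed

text \<open>
  A minimal representative has no descent in \<open>J\<close>. Conversely, if no root of \<open>\<Phi>\<^sub>J\<^sup>+\<close> is an inversion
  of \<open>w\<close>, then all inversions of \<open>w\<close> lie outside \<open>\<Phi>\<^sub>J\<close> and are kept by \<open>w u\<close> for \<open>u \<in> W\<^sub>J\<close>.
\<close>

lemma min_reps_iff:
  assumes "J \<subseteq> \<Delta>"
  shows "w \<in> min_reps \<Delta> J \<longleftrightarrow> w \<in> weyl \<Delta> \<and> (\<forall>\<beta>\<in>PJ J. w \<beta> \<in> P)"
proof
  assume w: "w \<in> min_reps \<Delta> J"
  then have wW: "w \<in> weyl \<Delta>" by (simp add: min_reps_def)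
  have "w i \<in> P" if "i \<in> J" for i
  proof (rule ccontr)
    assume neg: "w i \<notin> P"
    have iD: "i \<in> \<Delta>" using that assms by blast
    have "wlength \<Delta> w \<le> wlength \<Delta> (w \<circ> root_refl i)"
      using w that root_refl_in_weyl_simple by (auto simp: min_reps_def)
    moreover have "w \<circ> root_refl i \<in> weyl \<Delta>" using wW iD by (simp add: weyl_comp root_refl_in_weyl_simple)
    ultimately show False using finite.inv_num_comp_simple(2)[OF wW iD neg] wW by (simp add: wlength_inv_num)
  qed
  then show "w \<in> weyl \<Delta> \<and> (\<forall>\<beta>\<in>PJ J. w \<beta> \<in> P)" using wW weyl_nonneg_comb_pos assms by blast
next
  assume w: "w \<in> weyl \<Delta> \<and> (\<forall>\<beta>\<in>PJ J. w \<beta> \<in> P)"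
  have "wlength \<Delta> w \<le> wlength \<Delta> (w \<circ> u)" if u: "u \<in> weyl J" for u
  proof -
    have wu: "w \<circ> u \<in> weyl \<Delta>" using w u weyl_mono[OF assms] by (auto simp: weyl_comp)
    have "{\<beta> \<in> P. w \<beta> \<notin> P} = {\<beta> \<in> P - PJ J. w \<beta> \<notin> P}" using w by blast
    then have "wlength \<Delta> w = card {\<beta> \<in> P - PJ J. (w \<circ> u) \<beta> \<notin> P}"
      using card_inversions_outside[OF _ u assms] w by (simp add: wlength_eq)
    also have "\<dots> \<le> card {\<beta> \<in> P. (w \<circ> u) \<beta> \<notin> P}" by (rule card_mono) (use finite_pos in auto)
    finally show ?thesis using wu by (simp add: wlength_eq)
  qed
  then show "w \<in> min_reps \<Delta> J" using w by (simp add: min_reps_def)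
qed

lemma min_reps_weyl: "w \<in> min_reps \<Delta> J \<Longrightarrow> w \<in> weyl \<Delta>"
  by (simp add: min_reps_def)

lemma min_rep_unique:
  assumes "J \<subseteq> \<Delta>" "v \<in> min_reps \<Delta> J" "u \<in> weyl J" "v \<circ> u \<in> min_reps \<Delta> J" shows "u = id"
proof (rule weyl_trivial_par[OF assms(3,1)])
  fix i assume i: "i \<in> J"
  have "i \<in> par_roots \<Phi> J" using simple_par_pos[OF assms(1) i] by (simp add: par_pos_roots_def)
  then have ui: "u i \<in> par_roots \<Phi> J" using weyl_par_root assms by blast
  have vW: "v \<in> weyl \<Delta>" using assms by (simp add: min_reps_def)
  have vui: "v (u i) \<in> P" using assms(4) simple_par_pos[OF assms(1) i] by (auto simp: min_reps_iff[OF assms(1)])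
  show "u i \<in> P"
  proof (rule ccontr)
    assume "u i \<notin> P"
    then have "- u i \<in> PJ J" using par_pos_or_neg[OF assms(1) ui] by (auto simp: par_pos_roots_def)
    then have "- v (u i) \<in> P" using assms(2) weyl_minus[OF vW] by (force simp: min_reps_iff[OF assms(1)])
    then show False using vui uminus_notin_pos by blast
  qed
qed

lemma min_rep_eqI:
  assumes "J \<subseteq> \<Delta>" "v \<in> min_reps \<Delta> J" "u \<in> weyl J"
  shows "min_rep \<Delta> J (v \<circ> u) = v"
  unfolding min_rep_def
proof (rule the_equality)
  have "v = v \<circ> u \<circ> inv u" by (simp add: fun_eq_iff weyl_inv_right[OF assms(3)])
  then show "v \<in> min_reps \<Delta> J \<and> (\<exists>u'\<in>weyl J. v = v \<circ> u \<circ> u')" using assms weyl_inv by blast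
  fix v' assume "v' \<in> min_reps \<Delta> J \<and> (\<exists>u'\<in>weyl J. v' = v \<circ> u \<circ> u')"
  then obtain u' where u': "v' \<in> min_reps \<Delta> J" "u' \<in> weyl J" "v' = v \<circ> (u \<circ> u')"
    by (metis comp_assoc)
  then have "u \<circ> u' = id" using min_rep_unique[OF assms(1,2), of "u \<circ> u'"] assms weyl_comp by blast
  then show "v' = v" using u' by simp
qed

lemma min_rep_exists:
  assumes "J \<subseteq> \<Delta>" "w \<in> weyl \<Delta>"
  shows "\<exists>v\<in>min_reps \<Delta> J. \<exists>u\<in>weyl J. w = v \<circ> u"
proof -
  obtain u where u: "u \<in> weyl J" "\<And>u'. u' \<in> weyl J \<Longrightarrow> wlength \<Delta> (w \<circ> u) \<le> wlength \<Delta> (w \<circ> u')"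
    using ex_has_least_nat[of "\<lambda>u. u \<in> weyl J" id "\<lambda>u. wlength \<Delta> (w \<circ> u)"] id_in_weyl by blast
  have "w \<circ> u \<in> weyl \<Delta>" using assms u weyl_mono by (blast intro: weyl_comp)
  moreover have "wlength \<Delta> (w \<circ> u) \<le> wlength \<Delta> (w \<circ> u \<circ> u')" if "u' \<in> weyl J" for u'
    using u(2)[of "u \<circ> u'"] that u(1) by (simp add: weyl_comp comp_assoc)
  ultimately have "w \<circ> u \<in> min_reps \<Delta> J" by (auto simp: min_reps_def)
  moreover have "w = (w \<circ> u) \<circ> inv u" by (simp add: fun_eq_iff weyl_inv_right[OF u(1)])
  ultimately show ?thesis using u(1) weyl_inv by blast
qed

lemma min_rep:
  assumes "J \<subseteq> \<Delta>" "w \<in> weyl \<Delta>"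
  shows "min_rep \<Delta> J w \<in> min_reps \<Delta> J" "\<exists>u\<in>weyl J. w = min_rep \<Delta> J w \<circ> u"
  using min_rep_exists[OF assms] min_rep_eqI[OF assms(1)] by auto

text \<open>
  The inversions of \<open>\<lfloor>w\<rfloor>\<close> all lie outside \<open>\<Phi>\<^sub>J\<close>, where \<open>w\<close> has equally many.
\<close>

lemma wlength_min_rep:
  assumes "J \<subseteq> \<Delta>" "w \<in> weyl \<Delta>"
  shows "wlength \<Delta> (min_rep \<Delta> J w) = card {\<beta> \<in> P - PJ J. w \<beta> \<notin> P}"
proof -
  obtain u where u: "u \<in> weyl J" "w = min_rep \<Delta> J w \<circ> u" using min_rep assms by blast
  let ?v = "min_rep \<Delta> J w"
  have v: "?v \<in> weyl \<Delta>" "\<forall>\<beta>\<in>PJ J. ?v \<beta> \<in> P" using min_rep(1)[OF assms] min_reps_iff assms by auto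
  then have "{\<beta> \<in> P. ?v \<beta> \<notin> P} = {\<beta> \<in> P - PJ J. ?v \<beta> \<notin> P}" by blast
  then show ?thesis using card_inversions_outside[OF v(1) u(1) assms(1)] u(2) v by (simp add: wlength_eq)
qed

text \<open>
  A Bruhat cover \<open>w \<lessdot> w r\<^sub>\<alpha>\<close> of a minimal representative by a root outside \<open>\<Phi>\<^sub>J\<close> ends in a
  minimal representative: a descent \<open>i \<in> J\<close> of \<open>w r\<^sub>\<alpha>\<close> would give
  \<open>\<ell>(w) < \<ell>(w r\<^sub>i) < \<ell>(w r\<^sub>\<alpha> r\<^sub>i) < \<ell>(w r\<^sub>\<alpha>) = \<ell>(w) + 1\<close>.
\<close>

lemma bruhat_cover_min_rep:
  assumes "J \<subseteq> \<Delta>" "w \<in> min_reps \<Delta> J" "\<alpha> \<in> P - PJ J"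
    and len: "wlength \<Delta> (w \<circ> root_refl \<alpha>) = wlength \<Delta> w + 1"
  shows "w \<circ> root_refl \<alpha> \<in> min_reps \<Delta> J" "w \<alpha> \<in> P"
proof -
  have wW: "w \<in> weyl \<Delta>" using assms by (simp add: min_reps_def)
  have aP: "\<alpha> \<in> P" using assms by blast
  have wr: "w \<circ> root_refl \<alpha> \<in> weyl \<Delta>" using wW weyl_comp finite.refl_in aP by blast
  have L: "finite.inv_num (w \<circ> root_refl \<alpha>) = finite.inv_num w + 1"
    using len wW wr by (simp add: wlength_inv_num)
  show wa: "w \<alpha> \<in> P" using finite.inv_num_comp_refl_less[OF wW aP] L by force
  have "(w \<circ> root_refl \<alpha>) i \<in> P" if i: "i \<in> J" for i
  proof (rule ccontr)
    assume neg: "(w \<circ> root_refl \<alpha>) i \<notin> P"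
    have iD: "i \<in> \<Delta>" using i assms by blast
    have wi: "w i \<in> P" using assms simple_par_pos[OF assms(1) i] by (auto simp: min_reps_iff[OF assms(1)])
    have ne: "\<alpha> \<noteq> i" using simple_par_pos[OF assms(1) i] assms by blast
    let ?b = "root_refl i \<alpha>"
    have b: "?b \<in> P" using simple_refl_pos iD aP ne by blast
    have wri: "w \<circ> root_refl i \<in> weyl \<Delta>" using wW iD by (simp add: weyl_comp root_refl_in_weyl_simple)
    have "(w \<circ> root_refl i) ?b \<in> P" using wa by (simp add: root_refl_root_refl)
    then have "finite.inv_num (w \<circ> root_refl i) < finite.inv_num (w \<circ> root_refl i \<circ> root_refl ?b)"
      using finite.inv_num_less_comp_refl[OF wri b] by simp
    moreover have "w \<circ> root_refl i \<circ> root_refl ?b = w \<circ> root_refl \<alpha> \<circ> root_refl i"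
      by (simp add: root_refl_conj[OF orthogonal_root_refl] inv_root_refl fun_eq_iff root_refl_root_refl)
    ultimately show False
      using finite.inv_num_comp_simple(1)[OF wW iD wi] finite.inv_num_comp_simple(2)[OF wr iD neg] L by simp
  qed
  then show "w \<circ> root_refl \<alpha> \<in> min_reps \<Delta> J"
    using wr weyl_nonneg_comb_pos[OF wr assms(1)] by (auto simp: min_reps_iff[OF assms(1)])
qed

end

section \<open>The coroot lattice\<close>

lemma int_span_zero: "0 \<in> int_span S"
  unfolding int_span_def by (rule CollectI, rule exI[of _ "\<lambda>_. 0"]) simp

lemma int_span_add: "v \<in> int_span S \<Longrightarrow> w \<in> int_span S \<Longrightarrow> v + w \<in> int_span S"
  unfolding int_span_def
  by (clarify, rule_tac x="\<lambda>s. c s + ca s" in exI) (simp add: scaleR_left_distrib sum.distrib)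

lemma int_span_scale:
  assumes "v \<in> int_span S" shows "of_int k *\<^sub>R v \<in> int_span S"
proof -
  obtain c where "v = (\<Sum>s\<in>S. of_int (c s) *\<^sub>R s)" using assms unfolding int_span_def by blast
  then have "of_int k *\<^sub>R v = (\<Sum>s\<in>S. of_int (k * c s) *\<^sub>R s)" by (simp add: scaleR_sum_right)
  then show ?thesis unfolding int_span_def by (intro CollectI exI conjI TrueI)
qed

lemma int_span_scale_Ints: "v \<in> int_span S \<Longrightarrow> k \<in> \<int> \<Longrightarrow> k *\<^sub>R v \<in> int_span S"
  by (auto elim!: Ints_cases intro: int_span_scale)

lemma int_span_uminus: "v \<in> int_span S \<Longrightarrow> - v \<in> int_span S"
  using int_span_scale[of v S "- 1"] by simp

lemma int_span_diff: "v \<in> int_span S \<Longrightarrow> w \<in> int_span S \<Longrightarrow> v - w \<in> int_span S"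
  using int_span_add[OF _ int_span_uminus] by (metis uminus_add_conv_diff add.commute)

lemma int_span_base:
  assumes "finite S" "s \<in> S" shows "s \<in> int_span S"
proof -
  have "(\<Sum>x\<in>S. of_int (if x = s then 1 else 0) *\<^sub>R x) = (\<Sum>x\<in>S. if x = s then x else 0)"
    by (intro sum.cong) auto
  also have "\<dots> = s" using assms by simp
  finally show ?thesis unfolding int_span_def by (intro CollectI exI[of _ "\<lambda>x. if x = s then 1 else 0"]) simp
qed

lemma int_span_induct [consumes 2, case_names zero add diff]:
  assumes "finite S" "v \<in> int_span S" "Q 0"
    and add: "\<And>v s. Q v \<Longrightarrow> s \<in> S \<Longrightarrow> Q (v + s)"
    and diff: "\<And>v s. Q v \<Longrightarrow> s \<in> S \<Longrightarrow> Q (v - s)"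
  shows "Q v"
proof -
  obtain c where v: "v = (\<Sum>s\<in>S. of_int (c s) *\<^sub>R s)" using assms(2) unfolding int_span_def by blast
  have mult: "Q (w + of_int k *\<^sub>R s)" if "Q w" "s \<in> S" for w s and k :: int
  proof (induction k rule: int_induct[where k=0])
    case base
    then show ?case using that by simp
  next
    case (step1 k)
    have "w + of_int (k + 1) *\<^sub>R s = (w + of_int k *\<^sub>R s) + s" by (simp add: scaleR_left_distrib)
    then show ?case using add[OF step1(2) that(2)] by (simp add: add.assoc)
  next
    case (step2 k)
    have "w + of_int (k - 1) *\<^sub>R s = (w + of_int k *\<^sub>R s) - s" by (simp add: scaleR_left_diff_distrib)
    then show ?case using diff[OF step2(2) that(2)] by metis
  qed
  have "Q (\<Sum>s\<in>T. of_int (c s) *\<^sub>R s)" if "T \<subseteq> S" for T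
    using finite_subset[OF that assms(1)] that
  proof (induction T rule: finite_induct)
    case (insert s T)
    then have "Q ((\<Sum>s\<in>T. of_int (c s) *\<^sub>R s) + of_int (c s) *\<^sub>R s)" by (intro mult) auto
    then show ?case using insert by (simp add: add.commute)
  qed (use assms(3) in simp)
  then show ?thesis using v by blast
qed

lemma int_span_subset:
  assumes "finite S" "finite T" "S \<subseteq> T" shows "int_span S \<subseteq> int_span T"
proof
  fix v assume "v \<in> int_span S"
  with assms(1) show "v \<in> int_span T"
    by (induction rule: int_span_induct)
      (use assms int_span_zero int_span_add[OF _ int_span_base] int_span_diff[OF _ int_span_base] in blast)+
qed

context finite_roots
begin

lemma finite_sub: "K \<subseteq> \<Delta> \<Longrightarrow> finite K"
  using finite_simple finite_subset by blast

lemma coroot_lattice_mono: "K \<subseteq> L \<Longrightarrow> L \<subseteq> \<Delta> \<Longrightarrow> coroot_lattice K \<subseteq> coroot_lattice L"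
  unfolding coroot_lattice_def by (intro int_span_subset finite_imageI finite_sub image_mono) auto

lemma simple_coroot_in_lattice: "K \<subseteq> \<Delta> \<Longrightarrow> i \<in> K \<Longrightarrow> coroot i \<in> coroot_lattice K"
  unfolding coroot_lattice_def by (intro int_span_base finite_imageI finite_sub imageI)

lemma coroot_lattice_induct [consumes 2, case_names zero add diff]:
  assumes "K \<subseteq> \<Delta>" "v \<in> coroot_lattice K" "Q 0"
    and "\<And>v i. Q v \<Longrightarrow> i \<in> K \<Longrightarrow> Q (v + coroot i)"
    and "\<And>v i. Q v \<Longrightarrow> i \<in> K \<Longrightarrow> Q (v - coroot i)"
  shows "Q v"
  using finite_imageI[OF finite_sub[OF assms(1)], of coroot] assms(2)[unfolded coroot_lattice_def]
  by (induction rule: int_span_induct) (use assms(3-) in auto)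

lemma coroot_lattice_pairing:
  assumes "v \<in> coroot_lattice \<Delta>" "\<beta> \<in> \<Phi>" shows "v \<bullet> \<beta> \<in> \<int>"
  using order_refl assms(1)
  by (induction rule: coroot_lattice_induct)
    (use coroot_root_int[OF simple_root assms(2)] in \<open>auto simp: inner_add_left inner_diff_left\<close>)

lemma root_refl_coroot_lattice:
  assumes "v \<in> coroot_lattice \<Delta>" "i \<in> \<Delta>"
  shows "root_refl i v \<in> coroot_lattice \<Delta>"
proof -
  have "(v \<bullet> i) *\<^sub>R coroot i \<in> coroot_lattice \<Delta>"
    using int_span_scale_Ints simple_coroot_in_lattice[OF order_refl assms(2)]
      coroot_lattice_pairing[OF assms(1) simple_root[OF assms(2)]] unfolding coroot_lattice_def by blast
  then show ?thesis unfolding root_refl_coweight using assms(1) int_span_diff unfolding coroot_lattice_def by blast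
qed

text \<open>
  Each reflection \<open>r\<^sub>i\<close> with \<open>i \<in> K\<close> changes an element of \<open>Q\<^sup>\<or>\<close> by a multiple of \<open>i\<^sup>\<or>\<close>.
\<close>

lemma weyl_diff_coroot_lattice:
  assumes "g \<in> weyl K" "K \<subseteq> \<Delta>" "v \<in> coroot_lattice \<Delta>"
  shows "g v - v \<in> coroot_lattice K"
  using assms(1,3)
proof (induction arbitrary: v rule: weyl_induct)
  case id
  then show ?case by (simp add: coroot_lattice_def int_span_zero)
next
  case (comp g i)
  have i: "i \<in> \<Delta>" using comp assms by blast
  have 1: "g (root_refl i v) - root_refl i v \<in> coroot_lattice K"
    using comp.IH root_refl_coroot_lattice[OF comp.prems i] by blast
  have "(v \<bullet> i) *\<^sub>R coroot i \<in> coroot_lattice K"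
    using int_span_scale_Ints simple_coroot_in_lattice[OF assms(2) comp(2)]
      coroot_lattice_pairing[OF comp.prems simple_root[OF i]] unfolding coroot_lattice_def by blast
  then have "(g (root_refl i v) - root_refl i v) - (v \<bullet> i) *\<^sub>R coroot i \<in> coroot_lattice K"
    using 1 int_span_diff unfolding coroot_lattice_def by blast
  moreover have "(g (root_refl i v) - root_refl i v) - (v \<bullet> i) *\<^sub>R coroot i = (g \<circ> root_refl i) v - v"
    by (simp add: root_refl_coweight)
  ultimately show ?case by simp
qed

lemma weyl_coroot_lattice:
  assumes "g \<in> weyl \<Delta>" "v \<in> coroot_lattice \<Delta>" shows "g v \<in> coroot_lattice \<Delta>"
  using weyl_diff_coroot_lattice[OF assms(1) order_refl assms(2)] assms(2) int_span_add
  unfolding coroot_lattice_def by (metis diff_add_cancel)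

lemma coroot_in_lattice:
  assumes "K \<subseteq> \<Delta>" "\<beta> \<in> par_roots \<Phi> K" shows "coroot \<beta> \<in> coroot_lattice K"
proof -
  obtain g i where g: "g \<in> weyl K" "i \<in> K" "\<beta> = g i" using par_root_conj_simple assms by blast
  have i: "coroot i \<in> coroot_lattice K" using simple_coroot_in_lattice assms g by blast
  then have "g (coroot i) - coroot i \<in> coroot_lattice K"
    using weyl_diff_coroot_lattice[OF g(1) assms(1)] coroot_lattice_mono[OF assms(1) order_refl] by blast
  then have "g (coroot i) \<in> coroot_lattice K"
    using i int_span_add unfolding coroot_lattice_def by (metis diff_add_cancel)
  then show ?thesis using g(3) coroot_orthogonal[OF orthogonal_weyl[OF g(1)]] by simp
qed

section \<open>Sums of roots\<close>

text \<open>
  Both numbers are negative integers; if both were at most \<open>-2\<close>, then \<open>2\<langle>\<alpha>, \<beta>\<rangle>\<close> would be at most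
  \<open>-2\<langle>\<alpha>, \<alpha>\<rangle>\<close> and at most \<open>-2\<langle>\<beta>, \<beta>\<rangle>\<close>, and \<open>\<alpha> + \<beta>\<close> would have norm at most \<open>0\<close>.
\<close>

lemma cartan_integer_minus_one:
  assumes "\<alpha> \<in> \<Phi>" "\<beta> \<in> \<Phi>" "\<alpha> \<bullet> \<beta> < 0" "\<alpha> \<noteq> - \<beta>"
  shows "coroot \<alpha> \<bullet> \<beta> = - 1 \<or> coroot \<beta> \<bullet> \<alpha> = - 1"
proof (rule ccontr)
  assume no: "\<not> ?thesis"
  have nz: "\<alpha> \<noteq> 0" "\<beta> \<noteq> 0" using assms zero_notin_roots by auto
  have sq: "0 < \<alpha> \<bullet> \<alpha>" "0 < \<beta> \<bullet> \<beta>" using nz by simp_all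
  have a: "coroot \<alpha> \<bullet> \<beta> = 2 * (\<alpha> \<bullet> \<beta>) / (\<alpha> \<bullet> \<alpha>)" "coroot \<beta> \<bullet> \<alpha> = 2 * (\<alpha> \<bullet> \<beta>) / (\<beta> \<bullet> \<beta>)"
    by (simp_all add: coroot_def inner_commute)
  have le: "x \<le> - 2" if h: "x \<in> \<int>" "x < 0" "x \<noteq> - 1" for x :: real
  proof -
    obtain k where k: "x = of_int k" using Ints_cases[OF h(1)] by metis
    then have "k < 0" "k \<noteq> - 1" using h by auto
    then have "k \<le> - 2" by linarith
    then show ?thesis using k by simp
  qed
  have "coroot \<alpha> \<bullet> \<beta> < 0" "coroot \<beta> \<bullet> \<alpha> < 0" using a sq assms(3) by (simp_all add: divide_neg_pos)
  then have "coroot \<alpha> \<bullet> \<beta> \<le> - 2" "coroot \<beta> \<bullet> \<alpha> \<le> - 2"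
    using no le coroot_root_int assms by blast+
  then have "2 * (\<alpha> \<bullet> \<beta>) \<le> - 2 * (\<alpha> \<bullet> \<alpha>)" "2 * (\<alpha> \<bullet> \<beta>) \<le> - 2 * (\<beta> \<bullet> \<beta>)"
    unfolding a using sq by (simp_all add: divide_le_eq)
  then have "(\<alpha> + \<beta>) \<bullet> (\<alpha> + \<beta>) \<le> 0"
    by (simp add: inner_add_left inner_add_right inner_commute)
  then have "\<alpha> + \<beta> = 0" by (metis inner_gt_zero_iff not_le)
  then show False using assms(4) by (simp add: eq_neg_iff_add_eq_0)
qed

lemma root_diff_root:
  assumes "\<alpha> \<in> \<Phi>" "\<beta> \<in> \<Phi>" "0 < \<alpha> \<bullet> \<beta>" "\<alpha> \<noteq> \<beta>" shows "\<alpha> - \<beta> \<in> \<Phi>"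
proof -
  have "coroot \<alpha> \<bullet> - \<beta> = - 1 \<or> coroot (- \<beta>) \<bullet> \<alpha> = - 1"
    using cartan_integer_minus_one[of \<alpha> "- \<beta>"] assms uminus_root by simp
  then show ?thesis
  proof
    assume "coroot \<alpha> \<bullet> - \<beta> = - 1"
    then have "root_refl \<alpha> \<beta> = \<beta> - \<alpha>" by (simp add: root_refl_def inner_commute)
    then have "\<beta> - \<alpha> \<in> \<Phi>" using refl_root[OF assms(1,2)] by simp
    then show ?thesis using uminus_root by fastforce
  next
    assume "coroot (- \<beta>) \<bullet> \<alpha> = - 1"
    then have "root_refl \<beta> \<alpha> = \<alpha> - \<beta>" by (simp add: root_refl_def inner_commute coroot_uminus)
    then show ?thesis using refl_root[OF assms(2,1)] by simp
  qed
qed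

lemma coroot_add_coroot:
  assumes "K \<subseteq> \<Delta>" "\<alpha> \<in> par_roots \<Phi> K" "\<beta> \<in> par_roots \<Phi> K" "\<alpha> \<bullet> \<beta> < 0" "\<alpha> \<noteq> - \<beta>"
  shows "\<exists>\<gamma>\<in>par_roots \<Phi> K. coroot \<alpha> + coroot \<beta> = coroot \<gamma>"
proof -
  have key: "\<exists>\<gamma>\<in>par_roots \<Phi> K. coroot \<alpha> + coroot \<beta> = coroot \<gamma>"
    if "\<alpha> \<in> par_roots \<Phi> K" "\<beta> \<in> par_roots \<Phi> K" "coroot \<beta> \<bullet> \<alpha> = - 1" for \<alpha> \<beta>
  proof
    show "root_refl \<alpha> \<beta> \<in> par_roots \<Phi> K"
      using weyl_par_root[OF root_refl_in_weyl] assms(1) that by blast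
    show "coroot \<alpha> + coroot \<beta> = coroot (root_refl \<alpha> \<beta>)"
      unfolding coroot_orthogonal[OF orthogonal_root_refl] using that(3) by (simp add: root_refl_coweight)
  qed
  have "coroot \<alpha> \<bullet> \<beta> = - 1 \<or> coroot \<beta> \<bullet> \<alpha> = - 1"
    using cartan_integer_minus_one assms par_root_iff[OF assms(1)] by blast
  then show ?thesis using key[OF assms(2,3)] key[OF assms(3,2)] by (auto simp: add.commute)
qed

text \<open>
  Zero is the only element of \<open>Q\<^sub>J\<^sup>\<or>\<close> whose pairings with \<open>\<Phi>\<^sub>J\<close> are at most \<open>1\<close>. In a shortest
  expression as a sum of coroots any two summands have nonnegative inner product, since
  otherwise they could be merged; so the pairing with the first summand's root is at least \<open>2\<close>.
\<close>

lemma small_pairing_zero: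
  assumes "J \<subseteq> \<Delta>" "v \<in> coroot_lattice J" "\<And>\<beta>. \<beta> \<in> par_roots \<Phi> J \<Longrightarrow> v \<bullet> \<beta> \<le> 1"
  shows "v = 0"
proof -
  let ?S = "\<lambda>xs. set xs \<subseteq> par_roots \<Phi> J \<and> v = sum_list (map coroot xs)"
  have J: "i \<in> par_roots \<Phi> J" "- i \<in> par_roots \<Phi> J" if "i \<in> J" for i
    using simple_par_pos[OF assms(1) that] uminus_root by (auto simp: par_pos_roots_def par_root_iff[OF assms(1)])
  have "\<exists>xs. set xs \<subseteq> par_roots \<Phi> J \<and> v = sum_list (map coroot xs)"
    using assms(1,2)
  proof (induction rule: coroot_lattice_induct)
    case zero
    show ?case by (rule exI[of _ "[]"]) simp
  next
    case (add v i)
    then obtain xs where "set xs \<subseteq> par_roots \<Phi> J" "v = sum_list (map coroot xs)" by blast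
    then show ?case using J[OF add(2)] by (intro exI[of _ "i # xs"]) (auto simp: add.commute)
  next
    case (diff v i)
    then obtain xs where "set xs \<subseteq> par_roots \<Phi> J" "v = sum_list (map coroot xs)" by blast
    then show ?case using J[OF diff(2)] by (intro exI[of _ "(- i) # xs"]) (auto simp: coroot_uminus)
  qed
  then obtain xs where xs: "?S xs" and min: "\<And>ys. ?S ys \<Longrightarrow> length xs \<le> length ys"
    using ex_has_least_nat[of ?S _ length] by blast
  show ?thesis
  proof (cases xs)
    case Nil
    then show ?thesis using xs by simp
  next
    case (Cons \<alpha> ys)
    have a: "\<alpha> \<in> par_roots \<Phi> J" "set ys \<subseteq> par_roots \<Phi> J" using xs Cons by auto
    have nonneg: "0 \<le> coroot \<beta> \<bullet> \<alpha>" if b: "\<beta> \<in> set ys" for \<beta>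
    proof (rule ccontr)
      assume neg: "\<not> ?thesis"
      have bJ: "\<beta> \<in> par_roots \<Phi> J" using a b by blast
      have neg': "\<alpha> \<bullet> \<beta> < 0"
      proof (rule ccontr)
        assume "\<not> \<alpha> \<bullet> \<beta> < 0"
        then have "0 \<le> coroot \<beta> \<bullet> \<alpha>" by (simp add: coroot_def inner_commute)
        then show False using neg by simp
      qed
      have sum: "v = coroot \<alpha> + coroot \<beta> + sum_list (map coroot (remove1 \<beta> ys))"
        using xs Cons b sum_list_map_remove1[OF b, of coroot] by (simp add: add.assoc)
      have sub: "set (remove1 \<beta> ys) \<subseteq> par_roots \<Phi> J" using a set_remove1_subset by fast
      have len: "length (remove1 \<beta> ys) < length ys" using b length_pos_if_in_set[OF b] by (simp add: length_remove1)
      show False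
      proof (cases "\<alpha> = - \<beta>")
        case True
        then have "?S (remove1 \<beta> ys)" using sum sub by (simp add: coroot_uminus)
        from min[OF this] len Cons show False by simp
      next
        case False
        then obtain \<gamma> where "\<gamma> \<in> par_roots \<Phi> J" "coroot \<alpha> + coroot \<beta> = coroot \<gamma>"
          using coroot_add_coroot[OF assms(1) a(1) bJ neg'] by blast
        then have "?S (\<gamma> # remove1 \<beta> ys)" using sum sub by simp
        from min[OF this] len Cons show False by simp
      qed
    qed
    have nz: "\<alpha> \<noteq> 0" using a zero_notin_roots by (auto simp: par_root_iff[OF assms(1)])
    have ge: "0 \<le> sum_list (map coroot zs) \<bullet> \<alpha>" if "set zs \<subseteq> set ys" for zs
      using that nonneg by (induction zs) (auto simp: inner_add_left)
    have "v \<bullet> \<alpha> = coroot \<alpha> \<bullet> \<alpha> + sum_list (map coroot ys) \<bullet> \<alpha>"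
      using xs Cons by (simp add: inner_add_left)
    moreover have "coroot \<alpha> \<bullet> \<alpha> = 2" using inner_coroot_self[OF nz] by (simp add: inner_commute)
    ultimately have "2 \<le> v \<bullet> \<alpha>" using ge[OF order_refl] by simp
    then show ?thesis using assms(3)[OF a(1)] by simp
  qed
qed

section \<open>Highest roots\<close>

lemma simple_inner_nonpos: assumes "i \<in> \<Delta>" "k \<in> \<Delta>" "i \<noteq> k" shows "i \<bullet> k \<le> 0"
proof -
  have "root_refl i k \<in> P" using simple_refl_pos assms simple_pos_root by metis
  then have "0 \<le> \<omega> i \<bullet> root_refl i k" using assms by (simp add: pos_root_iff)
  also have "\<omega> i \<bullet> root_refl i k = - (k \<bullet> coroot i)"
    using assms by (simp add: root_refl_def inner_diff_right fund_coweight_pairing)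
  finally have "k \<bullet> coroot i \<le> 0" by simp
  moreover have "0 < i \<bullet> i" using assms simple_root zero_notin_roots by force
  ultimately show ?thesis by (auto simp: coroot_def inner_commute mult_le_0_iff divide_le_0_iff)
qed

lemma Nats_nonneg: "x \<in> \<nat> \<Longrightarrow> 0 \<le> (x :: real)"
  by (auto elim: Nats_cases)

lemma nat_span_add: "K \<subseteq> \<Delta> \<Longrightarrow> v \<in> nat_span K \<Longrightarrow> w \<in> nat_span K \<Longrightarrow> v + w \<in> nat_span K"
  by (auto simp: nat_span_iff inner_add_right)

lemma nat_span_antisym: assumes "K \<subseteq> \<Delta>" "v \<in> nat_span K" "- v \<in> nat_span K" shows "v = 0"
proof (rule eq_if_coeffs_eq)
  fix i assume "i \<in> \<Delta>"
  then show "\<omega> i \<bullet> v = \<omega> i \<bullet> 0"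
    using assms Nats_nonneg[of "\<omega> i \<bullet> v"] Nats_nonneg[of "- (\<omega> i \<bullet> v)"]
    by (cases "i \<in> K") (auto simp: nat_span_iff)
qed

lemma par_pos_nat_span: assumes "K \<subseteq> \<Delta>" "\<beta> \<in> PJ K" shows "\<beta> \<in> nat_span K"
  unfolding nat_span_iff[OF assms(1)]
proof (intro conjI ballI)
  fix i assume "i \<in> K"
  then have "i \<in> \<Delta>" using assms by blast
  then show "\<omega> i \<bullet> \<beta> \<in> \<nat>"
    using assms coeff_root_int[of \<beta> i] by (auto simp: par_pos_iff pos_root_iff Nats_altdef2)
qed (use assms par_pos_iff in blast)

text \<open>
  The Dynkin diagram of \<open>K\<close> is nonempty and connected.
\<close>

definition indecomposable :: "'a set \<Rightarrow> bool" where
  "indecomposable K \<longleftrightarrow> K \<noteq> {} \<and> (\<forall>A\<subseteq>K. A \<noteq> {} \<longrightarrow> A \<noteq> K \<longrightarrow> (\<exists>a\<in>A. \<exists>b\<in>K-A. a \<bullet> b \<noteq> 0))"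

definition maximal_root :: "'a set \<Rightarrow> 'a \<Rightarrow> bool" where
  "maximal_root K \<gamma> \<longleftrightarrow> \<gamma> \<in> par_roots \<Phi> K \<and>
     (\<forall>\<delta>\<in>par_roots \<Phi> K. \<delta> - \<gamma> \<in> nat_span K \<longrightarrow> \<delta> = \<gamma>)"

lemma maximal_root_above:
  assumes K: "K \<subseteq> \<Delta>" and b: "\<beta> \<in> par_roots \<Phi> K"
  shows "\<exists>\<gamma>. maximal_root K \<gamma> \<and> \<gamma> - \<beta> \<in> nat_span K"
proof -
  let ?A = "{\<gamma> \<in> par_roots \<Phi> K. \<gamma> - \<beta> \<in> nat_span K}" and ?h = "\<Sum>i\<in>K. \<omega> i"
  have fin: "finite ((\<bullet>) ?h ` ?A)" using finite_root_set by (simp add: par_roots_def)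
  have "\<beta> \<in> ?A" using b by (simp add: nat_span_iff[OF K])
  then have "(\<bullet>) ?h ` ?A \<noteq> {}" by blast
  then have "Max ((\<bullet>) ?h ` ?A) \<in> (\<bullet>) ?h ` ?A" by (rule Max_in[OF fin])
  then obtain \<gamma> where g: "\<gamma> \<in> ?A" and max: "Max ((\<bullet>) ?h ` ?A) = ?h \<bullet> \<gamma>" by blast
  have ge: "?h \<bullet> \<delta> \<le> ?h \<bullet> \<gamma>" if "\<delta> \<in> ?A" for \<delta>
    using Max_ge[OF fin imageI[OF that]] max by metis
  have "\<delta> = \<gamma>" if d: "\<delta> \<in> par_roots \<Phi> K" "\<delta> - \<gamma> \<in> nat_span K" for \<delta>
  proof -
    have "(\<delta> - \<gamma>) + (\<gamma> - \<beta>) \<in> nat_span K" using g d nat_span_add[OF K] by blast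
    then have "?h \<bullet> \<delta> \<le> ?h \<bullet> \<gamma>" using ge d by simp
    then have le: "(\<Sum>i\<in>K. \<omega> i \<bullet> (\<delta> - \<gamma>)) \<le> 0"
      by (simp add: inner_sum_left inner_diff_right sum_subtractf)
    have nn: "\<forall>i\<in>K. 0 \<le> \<omega> i \<bullet> (\<delta> - \<gamma>)" "\<forall>i\<in>\<Delta>-K. \<omega> i \<bullet> (\<delta> - \<gamma>) = 0"
      using d(2) by (auto simp: nat_span_iff[OF K] elim!: Nats_cases ballE)
    then have "(\<Sum>i\<in>K. \<omega> i \<bullet> (\<delta> - \<gamma>)) = 0" using le by (intro antisym sum_nonneg) auto
    then have "\<forall>i\<in>K. \<omega> i \<bullet> (\<delta> - \<gamma>) = 0"
      using nn(1) sum_nonneg_eq_0_iff[OF finite_sub[OF K], of "\<lambda>i. \<omega> i \<bullet> (\<delta> - \<gamma>)"] by blast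
    then have "\<omega> i \<bullet> (\<delta> - \<gamma>) = \<omega> i \<bullet> 0" if "i \<in> \<Delta>" for i using that nn(2) by (cases "i \<in> K") simp_all
    then have "\<delta> - \<gamma> = 0" by (rule eq_if_coeffs_eq)
    then show ?thesis by simp
  qed
  then show ?thesis using g unfolding maximal_root_def by blast
qed

lemma maximal_root_pos:
  assumes K: "K \<subseteq> \<Delta>" and g: "maximal_root K \<gamma>"
  shows "\<gamma> \<in> PJ K"
proof (rule ccontr)
  assume n: "\<gamma> \<notin> PJ K"
  have gK: "\<gamma> \<in> par_roots \<Phi> K" using g by (simp add: maximal_root_def)
  then have neg: "- \<gamma> \<in> PJ K" using n par_pos_or_neg[OF K] by blast
  then have "- \<gamma> + - \<gamma> \<in> nat_span K" using par_pos_nat_span[OF K] nat_span_add[OF K] by blast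
  moreover have "- \<gamma> \<in> par_roots \<Phi> K" using neg by (simp add: par_pos_roots_def)
  ultimately have "- \<gamma> = \<gamma>" using g unfolding maximal_root_def by (metis diff_conv_add_uminus)
  then have "\<gamma> \<bullet> \<gamma> = - (\<gamma> \<bullet> \<gamma>)" by (metis inner_minus_left)
  then show False using gK zero_notin_roots by (auto simp: par_root_iff[OF K])
qed

lemma maximal_root_dominant:
  assumes K: "K \<subseteq> \<Delta>" and g: "maximal_root K \<gamma>" and i: "i \<in> K"
  shows "0 \<le> \<gamma> \<bullet> i"
proof (rule ccontr)
  assume n: "\<not> 0 \<le> \<gamma> \<bullet> i"
  have gK: "\<gamma> \<in> par_roots \<Phi> K" and gP: "\<gamma> \<in> \<Phi>"
    using g by (auto simp: maximal_root_def par_root_iff[OF K])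
  have iD: "i \<in> \<Delta>" using i K by blast
  have ii: "0 < i \<bullet> i" using iD simple_root zero_notin_roots by force
  then have neg: "coroot i \<bullet> \<gamma> < 0" using n by (simp add: coroot_def inner_commute mult_less_0_iff divide_less_0_iff)
  have d: "root_refl i \<gamma> - \<gamma> = (- (coroot i \<bullet> \<gamma>)) *\<^sub>R i" by (simp add: root_refl_def inner_commute)
  have "- (coroot i \<bullet> \<gamma>) \<in> \<nat>" using coroot_root_int[OF simple_root[OF iD] gP] neg by (simp add: Nats_altdef2)
  then have "root_refl i \<gamma> - \<gamma> \<in> nat_span K"
    unfolding d nat_span_iff[OF K] using i K by (auto simp: fund_coweight_pairing)
  moreover have "root_refl i \<gamma> \<in> par_roots \<Phi> K"
    using weyl_par_root[OF root_refl_in_weyl_simple[OF i] K gK] .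
  ultimately have "root_refl i \<gamma> = \<gamma>" using g by (simp add: maximal_root_def)
  then have "(- (coroot i \<bullet> \<gamma>)) *\<^sub>R i = 0" using d by simp
  then show False using neg ii by auto
qed

text \<open>
  If the support of \<open>\<gamma>\<close> were a proper subset of \<open>K\<close>, connectedness would give a root of \<open>K\<close> outside
  the support that is adjacent to it; this root would pair negatively with \<open>\<gamma>\<close>, which is dominant.
\<close>

lemma maximal_root_support:
  assumes K: "K \<subseteq> \<Delta>" "indecomposable K" and g: "maximal_root K \<gamma>" and i: "i \<in> K"
  shows "0 < \<omega> i \<bullet> \<gamma>"
proof (rule ccontr)
  assume n: "\<not> 0 < \<omega> i \<bullet> \<gamma>"
  let ?A = "{i \<in> K. 0 < \<omega> i \<bullet> \<gamma>}"
  have gP: "\<gamma> \<in> PJ K" using maximal_root_pos K g by blast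
  then have gK: "\<gamma> \<in> par_roots \<Phi> K" "\<gamma> \<in> P" by (auto simp: par_pos_roots_def)
  have "?A \<noteq> {}"
  proof -
    obtain k where k: "k \<in> \<Delta>" "\<omega> k \<bullet> \<gamma> \<noteq> 0" using root_coeff_nonzero gK pos_root by blast
    then have "k \<in> K" using gK by (auto simp: par_root_iff[OF K(1)])
    moreover have "0 < \<omega> k \<bullet> \<gamma>" using k gK(2) by (force simp: pos_root_iff)
    ultimately show ?thesis by blast
  qed
  moreover have "?A \<noteq> K" using i n by blast
  ultimately obtain a b where ab: "a \<in> ?A" "b \<in> K - ?A" "a \<bullet> b \<noteq> 0"
    using K(2) unfolding indecomposable_def by (metis (no_types, lifting) mem_Collect_eq subsetI)
  have nn: "0 \<le> \<omega> k \<bullet> \<gamma>" if "k \<in> K" for k using that K gK(2) by (auto simp: pos_root_iff)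
  have np: "k \<bullet> b \<le> 0" if "k \<in> K" "k \<noteq> b" for k using that simple_inner_nonpos ab K by blast
  have "b \<bullet> \<gamma> = (\<Sum>k\<in>K. (\<omega> k \<bullet> \<gamma>) * (b \<bullet> k))" by (rule pairing_expansion_par[OF K(1) gK(1)])
  also have "\<dots> = (\<omega> a \<bullet> \<gamma>) * (b \<bullet> a) + (\<Sum>k\<in>K - {a}. (\<omega> k \<bullet> \<gamma>) * (b \<bullet> k))"
    using ab by (intro sum.remove finite_sub K) auto
  also have "(\<Sum>k\<in>K - {a}. (\<omega> k \<bullet> \<gamma>) * (b \<bullet> k)) \<le> 0"
  proof (rule sum_nonpos)
    fix k assume k: "k \<in> K - {a}"
    show "(\<omega> k \<bullet> \<gamma>) * (b \<bullet> k) \<le> 0"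
    proof (cases "k = b")
      case True
      then have "\<omega> k \<bullet> \<gamma> = 0" using ab nn[of b] by force
      then show ?thesis by simp
    next
      case False
      then show ?thesis using k nn[of k] np[of k] by (simp add: inner_commute mult_nonneg_nonpos)
    qed
  qed
  also have "(\<omega> a \<bullet> \<gamma>) * (b \<bullet> a) < 0"
  proof -
    have "a \<bullet> b < 0" using ab np[of a] by force
    then show ?thesis using ab by (simp add: inner_commute mult_pos_neg)
  qed
  finally have "b \<bullet> \<gamma> < 0" by simp
  then show False using maximal_root_dominant[OF K(1) g, of b] ab by (simp add: inner_commute)
qed

text \<open>
  One maximal root has positive coefficients and the other is dominant, so their inner product is
  positive. If they were different, their difference would be a root, hence positive or negative,
  and one of them would not be maximal.
\<close>

lemma maximal_root_unique:
  assumes K: "K \<subseteq> \<Delta>" "indecomposable K" and g: "maximal_root K \<gamma>" "maximal_root K \<gamma>'"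
  shows "\<gamma> = \<gamma>'"
proof (rule ccontr)
  assume ne: "\<gamma> \<noteq> \<gamma>'"
  have gK: "\<gamma> \<in> par_roots \<Phi> K" "\<gamma>' \<in> par_roots \<Phi> K" using g by (auto simp: maximal_root_def)
  then have gP: "\<gamma> \<in> \<Phi>" "\<gamma>' \<in> \<Phi>" by (auto simp: par_root_iff[OF K(1)])
  have eq: "\<gamma> \<bullet> \<gamma>' = (\<Sum>k\<in>K. (\<omega> k \<bullet> \<gamma>') * (\<gamma> \<bullet> k))" by (rule pairing_expansion_par[OF K(1) gK(2)])
  have nn: "0 \<le> (\<omega> k \<bullet> \<gamma>') * (\<gamma> \<bullet> k)" if "k \<in> K" for k
    using maximal_root_support[OF K g(2) that] maximal_root_dominant[OF K(1) g(1) that] by simp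
  have "\<gamma> \<bullet> \<gamma>' \<noteq> 0"
  proof
    assume "\<gamma> \<bullet> \<gamma>' = 0"
    then have "\<forall>k\<in>K. (\<omega> k \<bullet> \<gamma>') * (\<gamma> \<bullet> k) = 0"
      using eq sum_nonneg_eq_0_iff[OF finite_sub[OF K(1)], of "\<lambda>k. (\<omega> k \<bullet> \<gamma>') * (\<gamma> \<bullet> k)"] nn by metis
    then have "\<forall>k\<in>K. \<gamma> \<bullet> k = 0" using maximal_root_support[OF K g(2)] by force
    moreover have "\<gamma> \<bullet> \<gamma> = (\<Sum>k\<in>K. (\<omega> k \<bullet> \<gamma>) * (\<gamma> \<bullet> k))" by (rule pairing_expansion_par[OF K(1) gK(1)])
    ultimately have "\<gamma> \<bullet> \<gamma> = 0" by simp
    then show False using gP zero_notin_roots by auto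
  qed
  moreover have "0 \<le> \<gamma> \<bullet> \<gamma>'" unfolding eq using nn by (rule sum_nonneg)
  ultimately have "\<gamma> - \<gamma>' \<in> \<Phi>" using root_diff_root gP ne by simp
  then have "\<gamma> - \<gamma>' \<in> par_roots \<Phi> K" using gK by (simp add: par_root_iff[OF K(1)] inner_diff_right)
  then have "\<gamma> - \<gamma>' \<in> PJ K \<or> \<gamma>' - \<gamma> \<in> PJ K" using par_pos_or_neg[OF K(1)] by fastforce
  then have "\<gamma> - \<gamma>' \<in> nat_span K \<or> \<gamma>' - \<gamma> \<in> nat_span K" using par_pos_nat_span[OF K(1)] by blast
  then show False using g ne gK unfolding maximal_root_def by metis
qed

lemma highest_root:
  assumes K: "K \<subseteq> \<Delta>" "indecomposable K"
  shows "highest_root \<Phi> K \<in> PJ K"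
    and "\<And>\<beta>. \<beta> \<in> par_roots \<Phi> K \<Longrightarrow> highest_root \<Phi> K - \<beta> \<in> nat_span K"
    and "\<And>i. i \<in> K \<Longrightarrow> 0 < \<omega> i \<bullet> highest_root \<Phi> K"
proof -
  obtain i where "i \<in> K" using K(2) by (auto simp: indecomposable_def)
  then have "i \<in> par_roots \<Phi> K" using simple_par_pos K(1) by (auto simp: par_pos_roots_def)
  then obtain \<theta> where t: "maximal_root K \<theta>" using maximal_root_above K(1) by blast
  have top: "\<theta> - \<beta> \<in> nat_span K" if b: "\<beta> \<in> par_roots \<Phi> K" for \<beta>
    using maximal_root_above[OF K(1) b] maximal_root_unique[OF K t] by blast
  have tK: "\<theta> \<in> par_roots \<Phi> K" using t by (simp add: maximal_root_def)
  have "highest_root \<Phi> K = \<theta>"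
    unfolding highest_root_def
  proof (rule the_equality)
    show "\<theta> \<in> par_roots \<Phi> K \<and> (\<forall>\<beta>\<in>par_roots \<Phi> K. \<theta> - \<beta> \<in> nat_span K)" using tK top by blast
    fix \<theta>' assume t': "\<theta>' \<in> par_roots \<Phi> K \<and> (\<forall>\<beta>\<in>par_roots \<Phi> K. \<theta>' - \<beta> \<in> nat_span K)"
    have "\<theta> - \<theta>' \<in> nat_span K" using t' top by blast
    moreover have "- (\<theta> - \<theta>') \<in> nat_span K" using t' tK by simp
    ultimately show "\<theta>' = \<theta>" using nat_span_antisym[OF K(1)] by fastforce
  qed
  then show "highest_root \<Phi> K \<in> PJ K" "\<And>\<beta>. \<beta> \<in> par_roots \<Phi> K \<Longrightarrow> highest_root \<Phi> K - \<beta> \<in> nat_span K"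
    "\<And>i. i \<in> K \<Longrightarrow> 0 < \<omega> i \<bullet> highest_root \<Phi> K"
    using top maximal_root_pos[OF K(1) t] maximal_root_support[OF K t] by auto
qed

section \<open>Components of a set of simple roots\<close>

lemma equiv_adjacency:
  "equiv J ({(a, b). a \<in> J \<and> b \<in> J \<and> a \<bullet> b \<noteq> 0}\<^sup>+)" if "J \<subseteq> \<Delta>" for J
proof (rule equivI)
  let ?E = "{(a, b). a \<in> J \<and> b \<in> J \<and> a \<bullet> b \<noteq> 0}"
  have "?E\<^sup>+ \<subseteq> J \<times> J" by (rule trancl_subset_Sigma) auto
  then show "?E\<^sup>+ \<subseteq> J \<times> J" .
  show "refl_on J (?E\<^sup>+)"
  proof (rule refl_onI)
    fix a assume "a \<in> J"
    moreover have "a \<bullet> a \<noteq> 0" using \<open>a \<in> J\<close> that simple_root zero_notin_roots by force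
    ultimately show "(a, a) \<in> ?E\<^sup>+" by blast
  qed
  have "sym ?E" by (rule symI) (auto simp: inner_commute)
  then show "sym (?E\<^sup>+)" by (rule sym_trancl)
qed (rule trans_trancl)

context
  fixes J assumes J: "J \<subseteq> \<Delta>"
begin

lemma component_subset: "K \<in> components J \<Longrightarrow> K \<subseteq> J"
  unfolding components_def using equiv_adjacency[OF J] in_quotient_imp_subset by blast

lemma component_nonempty: "K \<in> components J \<Longrightarrow> K \<noteq> {}"
  unfolding components_def using equiv_adjacency[OF J] in_quotient_imp_non_empty by blast

lemma Union_components: "\<Union>(components J) = J"
  unfolding components_def using equiv_adjacency[OF J] by (rule Union_quotient)

lemma component_disjoint: "K \<in> components J \<Longrightarrow> L \<in> components J \<Longrightarrow> K \<noteq> L \<Longrightarrow> K \<inter> L = {}"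
  unfolding components_def using quotient_disj[OF equiv_adjacency[OF J]] by blast

lemma finite_components: "finite (components J)"
  using Union_components finite_sub[OF J] by (metis finite_UnionD)

lemma component_closed:
  assumes "K \<in> components J" "a \<in> K" "b \<in> J" "a \<bullet> b \<noteq> 0" shows "b \<in> K"
proof -
  have "a \<in> J" using assms component_subset by blast
  then have "(a, b) \<in> {(a, b). a \<in> J \<and> b \<in> J \<and> a \<bullet> b \<noteq> 0}\<^sup>+" using assms by blast
  then show ?thesis
    using in_quotient_imp_closed[OF equiv_adjacency[OF J]] assms unfolding components_def by blast
qed

lemma component_orthogonal:
  assumes "K \<in> components J" "L \<in> components J" "K \<noteq> L" "a \<in> K" "b \<in> L" shows "a \<bullet> b = 0"
proof (rule ccontr)
  assume "a \<bullet> b \<noteq> 0"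
  moreover have "b \<in> J" using assms component_subset by blast
  ultimately have "b \<in> K" using component_closed[OF assms(1,4)] by blast
  then show False using component_disjoint assms by blast
qed

lemma component_indecomposable:
  assumes "K \<in> components J" shows "indecomposable K"
  unfolding indecomposable_def
proof (intro conjI allI impI)
  show "K \<noteq> {}" using component_nonempty assms by blast
  fix A assume A: "A \<subseteq> K" "A \<noteq> {}" "A \<noteq> K"
  obtain a b where ab: "a \<in> A" "b \<in> K" "b \<notin> A" using A by blast
  show "\<exists>a\<in>A. \<exists>b\<in>K - A. a \<bullet> b \<noteq> 0"
  proof (rule ccontr)
    assume n: "\<not> ?thesis"
    let ?E = "{(a, b). a \<in> J \<and> b \<in> J \<and> a \<bullet> b \<noteq> 0}"
    have closed: "y \<in> A" if "x \<in> A" "(x, y) \<in> ?E" for x y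
      using that n component_closed[OF assms, of x y] A by blast
    have "(a, b) \<in> ?E\<^sup>+"
      using in_quotient_imp_in_rel[OF equiv_adjacency[OF J], of K a b] assms ab A
      unfolding components_def by blast
    then have "b \<in> A" by (induction rule: trancl_induct) (use ab closed in blast)+
    then show False using ab by blast
  qed
qed

lemma inner_component_zero:
  assumes "K \<in> components J" "L \<in> components J" "K \<noteq> L" "i \<in> L" "\<beta> \<in> par_roots \<Phi> K"
  shows "\<beta> \<bullet> i = 0"
proof -
  have K: "K \<subseteq> \<Delta>" using assms component_subset J by blast
  have "i \<bullet> \<beta> = (\<Sum>k\<in>K. (\<omega> k \<bullet> \<beta>) * (i \<bullet> k))" by (rule pairing_expansion_par[OF K assms(5)])
  also have "\<dots> = 0"
    by (rule sum.neutral) (use component_orthogonal[OF assms(2,1)] assms in auto)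
  finally show ?thesis by (simp add: inner_commute)
qed

lemma weyl_component_fixes:
  assumes "K \<in> components J" "L \<in> components J" "K \<noteq> L" "\<beta> \<in> par_roots \<Phi> K" "g \<in> weyl L"
  shows "g \<beta> = \<beta>"
  using assms(5)
proof (induction rule: weyl_induct)
  case (comp g i)
  have "root_refl i \<beta> = \<beta>"
    using inner_component_zero[OF assms(1-3) comp(2) assms(4)] by (simp add: root_refl_coweight)
  then show ?case using comp by simp
qed simp

text \<open>
  By induction on the height: a simple reflection preserves the subsystem of a component if it
  belongs to that component, and fixes its roots otherwise.
\<close>

lemma root_in_component:
  assumes "\<beta> \<in> PJ J" shows "\<exists>K\<in>components J. \<beta> \<in> PJ K"
  using J assms
proof (induction rule: pos_root_induct)
  case (simple i)
  then obtain K where "K \<in> components J" "i \<in> K" using Union_components by blast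
  then show ?case using simple_par_pos component_subset J by (meson order_trans)
next
  case (refl \<beta> i)
  then obtain K where K: "K \<in> components J" "root_refl i \<beta> \<in> PJ K" by blast
  have KD: "K \<subseteq> \<Delta>" using K component_subset J by blast
  have bP: "\<beta> \<in> P" using refl by (simp add: par_pos_roots_def)
  have rK: "root_refl i \<beta> \<in> par_roots \<Phi> K" using K by (simp add: par_pos_roots_def)
  have "\<beta> \<in> par_roots \<Phi> K"
  proof (cases "i \<in> K")
    case True
    then show ?thesis
      using weyl_par_root[OF root_refl_in_weyl_simple[OF True] KD rK] by (simp add: root_refl_root_refl)
  next
    case False
    obtain L where L: "L \<in> components J" "i \<in> L" using refl Union_components by blast
    then have "K \<noteq> L" using False by blast
    then have "root_refl i (root_refl i \<beta>) = root_refl i \<beta>"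
      using weyl_component_fixes[OF K(1) L(1) _ rK root_refl_in_weyl_simple[OF L(2)]] by blast
    then show ?thesis using rK by (simp add: root_refl_root_refl)
  qed
  then show ?case using bP K(1) by (auto simp: par_pos_roots_def)
qed

end

end

context finite_roots
begin

section \<open>Longest elements\<close>

text \<open>
  An element of maximal length in \<open>W\<^sub>K\<close> has every \<open>i \<in> K\<close> as a descent, so it sends \<open>\<Phi>\<^sub>K\<^sup>+\<close> to
  \<open>\<Phi>\<^sub>K\<^sup>-\<close>. Two such elements differ by one that preserves \<open>\<Phi>\<^sub>K\<^sup>+\<close>, which is trivial.
\<close>

lemma longest:
  assumes K: "K \<subseteq> \<Delta>"
  shows "longest \<Delta> K \<in> weyl K" and "\<And>\<beta>. \<beta> \<in> PJ K \<Longrightarrow> - longest \<Delta> K \<beta> \<in> PJ K"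
proof -
  let ?max = "\<lambda>w. w \<in> weyl K \<and> (\<forall>u\<in>weyl K. wlength \<Delta> u \<le> wlength \<Delta> w)"
  have KW: "w \<in> weyl \<Delta>" if "w \<in> weyl K" for w using that weyl_mono[OF K] by blast
  have bound: "wlength \<Delta> w < card P + 1" if "w \<in> weyl K" for w
    using card_mono[OF finite_pos, of "{\<beta> \<in> P. w \<beta> \<notin> P}"] by (simp add: wlength_eq[OF KW[OF that]] less_Suc_eq_le)
  obtain w where w: "?max w"
    using ex_has_greatest_nat[of "\<lambda>w. w \<in> weyl K" id "wlength \<Delta>" "card P + 1", OF id_in_weyl] bound
    by (meson less_imp_le)
  have simple_neg: "g i \<notin> P" if g: "?max g" and i: "i \<in> K" for g i
  proof
    assume pos: "g i \<in> P"
    have iD: "i \<in> \<Delta>" and gW: "g \<in> weyl \<Delta>" using i K g KW by auto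
    have gi: "g \<circ> root_refl i \<in> weyl K" using g i weyl_comp root_refl_in_weyl_simple by blast
    then have "wlength \<Delta> (g \<circ> root_refl i) \<le> wlength \<Delta> g" using g by blast
    then show False
      using finite.inv_num_comp_simple(1)[OF gW iD pos]
      unfolding wlength_inv_num[OF gW] wlength_inv_num[OF KW[OF gi]] by linarith
  qed
  have neg: "- g \<beta> \<in> PJ K" if g: "?max g" and b: "\<beta> \<in> PJ K" for g \<beta>
  proof -
    have gK: "g \<in> weyl K" using g by blast
    have bK: "\<beta> \<in> par_roots \<Phi> K" "\<beta> \<in> P" using b by (auto simp: par_pos_roots_def)
    then have gb: "g \<beta> \<in> par_roots \<Phi> K" using weyl_par_root gK K by blast
    have "0 \<le> \<omega> k \<bullet> - g \<beta>" if k: "k \<in> \<Delta>" for k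
    proof -
      have "\<omega> k \<bullet> g \<beta> = inv g (\<omega> k) \<bullet> \<beta>" by (rule weyl_inner_inv[OF gK, symmetric])
      also have "\<dots> = (\<Sum>i\<in>K. (\<omega> i \<bullet> \<beta>) * (inv g (\<omega> k) \<bullet> i))"
        by (rule pairing_expansion_par[OF K bK(1)])
      also have "\<dots> = (\<Sum>i\<in>K. (\<omega> i \<bullet> \<beta>) * (\<omega> k \<bullet> g i))" by (simp only: weyl_inner_inv[OF gK])
      also have "\<dots> \<le> 0"
      proof (rule sum_nonpos)
        fix i assume i: "i \<in> K"
        then have "i \<in> \<Delta>" using K by blast
        then have "g i \<in> \<Phi>" using weyl_root[OF gK K] simple_root by blast
        then have "- g i \<in> P" using simple_neg[OF g i] not_pos_iff by blast
        then have "\<omega> k \<bullet> g i \<le> 0" using k by (auto simp: pos_root_iff)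
        moreover have "0 \<le> \<omega> i \<bullet> \<beta>" using bK(2) \<open>i \<in> \<Delta>\<close> by (simp add: pos_root_iff)
        ultimately show "(\<omega> i \<bullet> \<beta>) * (\<omega> k \<bullet> g i) \<le> 0" by (rule mult_nonneg_nonpos[rotated])
      qed
      finally show ?thesis by simp
    qed
    then have "- g \<beta> \<in> P" using gb uminus_root by (auto simp: pos_root_iff par_root_iff[OF K])
    then show ?thesis using gb by (auto simp: par_pos_iff[OF K] par_root_iff[OF K])
  qed
  have uniq: "g = w" if g: "?max g" for g
  proof -
    have "inv w \<circ> g = id"
    proof (rule weyl_trivial_par[OF _ K])
      show "inv w \<circ> g \<in> weyl K" using w g weyl_comp weyl_inv by blast
      fix i assume i: "i \<in> K"
      have n: "- g i \<in> PJ K" using neg[OF g simple_par_pos[OF K i]] .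
      let ?\<beta> = "inv w (- g i)"
      have "- g i \<in> par_roots \<Phi> K" using n by (simp add: par_pos_roots_def)
      then have b: "?\<beta> \<in> par_roots \<Phi> K" using weyl_par_root[OF weyl_inv K] w by blast
      have "?\<beta> \<notin> PJ K"
      proof
        assume "?\<beta> \<in> PJ K"
        then have "- w ?\<beta> \<in> PJ K" using neg[OF w] by blast
        then have "- (- g i) \<in> PJ K" using w weyl_inv_right[of w K "- g i"] by simp
        then show False using n uminus_notin_pos[of "- g i"] by (auto simp: par_pos_roots_def)
      qed
      then have "- ?\<beta> \<in> PJ K" using par_pos_or_neg[OF K b] by blast
      moreover have "- ?\<beta> = inv w (g i)" using weyl_minus[OF weyl_inv, of w K] w by simp
      ultimately show "(inv w \<circ> g) i \<in> P" by (simp add: par_pos_roots_def)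
    qed
    then have "w (inv w (g v)) = w v" for v by (metis comp_apply id_apply)
    then show ?thesis using w by (auto simp: weyl_inv_right fun_eq_iff)
  qed
  have eq: "longest \<Delta> K = w" unfolding longest_def by (rule the_equality[where P="?max", OF w uniq])
  show "longest \<Delta> K \<in> weyl K" using w unfolding eq by (rule conjunct1)
  show "- longest \<Delta> K \<beta> \<in> PJ K" if "\<beta> \<in> PJ K" for \<beta> using neg[OF w that] unfolding eq .
qed

text \<open>Equivalently, \<open>g \<in> W\<^sub>K\<close> reverses the order on \<open>\<Phi>\<^sub>K\<close>.\<close>

definition flips :: "'a set \<Rightarrow> ('a \<Rightarrow> 'a) \<Rightarrow> bool" where
  "flips K g \<longleftrightarrow> g \<in> weyl K \<and> (\<forall>\<beta>\<in>PJ K. - g \<beta> \<in> PJ K)"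

lemma flips_longest: "K \<subseteq> \<Delta> \<Longrightarrow> flips K (longest \<Delta> K)"
  using longest by (simp add: flips_def)

lemma flips_inv:
  assumes K: "K \<subseteq> \<Delta>" and g: "flips K g" shows "flips K (inv g)"
  unfolding flips_def
proof (intro conjI ballI)
  have gW: "g \<in> weyl K" using g by (simp add: flips_def)
  then show "inv g \<in> weyl K" by (rule weyl_inv)
  fix \<beta> assume b: "\<beta> \<in> PJ K"
  then have "inv g \<beta> \<in> par_roots \<Phi> K" using weyl_par_root[OF weyl_inv[OF gW] K] by (auto simp: par_pos_roots_def)
  moreover have "inv g \<beta> \<notin> PJ K"
  proof
    assume "inv g \<beta> \<in> PJ K"
    then have "- g (inv g \<beta>) \<in> PJ K" using g by (simp add: flips_def)
    then show False using b uminus_notin_pos by (auto simp: weyl_inv_right[OF gW] par_pos_roots_def)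
  qed
  ultimately show "- inv g \<beta> \<in> PJ K" using par_pos_or_neg[OF K] by blast
qed

text \<open>
  Apply \<open>-g\<^sup>-\<^sup>1\<close> to the expansion \<open>-g i = \<Sum>\<^sub>k c\<^sub>k k\<close>: this writes \<open>i\<close> as a sum of the positive roots
  \<open>-g\<^sup>-\<^sup>1 k\<close> with coefficients \<open>c\<^sub>k \<ge> 0\<close>. Since \<open>i\<close> is simple, a root \<open>-g\<^sup>-\<^sup>1 k\<close> that occurs in
  it is a multiple of \<open>i\<close>, hence equal to \<open>i\<close>.
\<close>

lemma flips_simple:
  assumes K: "K \<subseteq> \<Delta>" and g: "flips K g" and i: "i \<in> K"
  shows "- g i \<in> K"
proof -
  have gW: "g \<in> weyl K" using g by (simp add: flips_def)
  have iD: "i \<in> \<Delta>" using i K by blast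
  have gi: "- g i \<in> PJ K" using g simple_par_pos[OF K i] by (simp add: flips_def)
  then have giK: "- g i \<in> par_roots \<Phi> K" "- g i \<in> P" by (auto simp: par_pos_roots_def)
  let ?c = "\<lambda>k. \<omega> k \<bullet> (- g i)"
  let ?f = "\<lambda>k. - inv g k"
  have f: "?f k \<in> PJ K" if "k \<in> K" for k
    using flips_inv[OF K g] simple_par_pos[OF K that] by (simp add: flips_def)
  have c: "0 \<le> ?c k" if "k \<in> K" for k using giK(2) that K by (auto simp: pos_root_iff)
  have expand: "v \<bullet> i = (\<Sum>k\<in>K. ?c k * (v \<bullet> ?f k))" for v
  proof -
    have "v \<bullet> i = - g v \<bullet> (- g i)" using weyl_inner[OF gW] by simp
    also have "\<dots> = (\<Sum>k\<in>K. ?c k * (- g v \<bullet> k))" by (rule pairing_expansion_par[OF K giK(1)])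
    also have "\<dots> = (\<Sum>k\<in>K. ?c k * (v \<bullet> ?f k))"
      using weyl_inner_inv[OF gW] by (intro sum.cong refl) (simp add: inner_commute)
    finally show ?thesis .
  qed
  have "(\<Sum>k\<in>K. ?c k * (\<omega> i \<bullet> ?f k)) \<noteq> 0" using expand[of "\<omega> i"] iD by (simp add: fund_coweight_pairing)
  then obtain k where k: "k \<in> K" "?c k * (\<omega> i \<bullet> ?f k) \<noteq> 0"
    by (rule sum.not_neutral_contains_not_neutral)
  have ck: "0 < ?c k" using c[OF k(1)] k(2) by (cases "?c k = 0") auto
  have fP: "0 \<le> \<omega> m \<bullet> ?f l" if "m \<in> \<Delta>" "l \<in> K" for m l using f[OF that(2)] that(1) by (auto simp: par_pos_roots_def pos_root_iff)
  have zero: "\<omega> m \<bullet> ?f k = 0" if m: "m \<in> \<Delta>" "m \<noteq> i" for m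
  proof -
    have "(\<Sum>l\<in>K. ?c l * (\<omega> m \<bullet> ?f l)) = 0" using expand[of "\<omega> m"] iD m by (simp add: fund_coweight_pairing)
    then have "\<forall>l\<in>K. ?c l * (\<omega> m \<bullet> ?f l) = 0"
      using sum_nonneg_eq_0_iff[OF finite_sub[OF K], of "\<lambda>l. ?c l * (\<omega> m \<bullet> ?f l)"]
        mult_nonneg_nonneg[OF c fP[OF m(1)]] by blast
    then have "?c k * (\<omega> m \<bullet> ?f k) = 0" using k(1) by blast
    then show ?thesis using ck by (metis less_irrefl mult_eq_0_iff)
  qed
  have "?f k = (\<omega> i \<bullet> ?f k) *\<^sub>R i"
  proof (rule eq_if_coeffs_eq)
    fix m assume "m \<in> \<Delta>"
    then show "\<omega> m \<bullet> ?f k = \<omega> m \<bullet> ((\<omega> i \<bullet> ?f k) *\<^sub>R i)"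
      using zero[of m] iD by (cases "m = i") (simp_all add: fund_coweight_pairing)
  qed
  moreover have "?f k \<in> \<Phi>" using f[OF k(1)] by (simp add: par_pos_roots_def pos_root_iff)
  ultimately have "\<omega> i \<bullet> ?f k = 1 \<or> \<omega> i \<bullet> ?f k = - 1" using reduced[OF simple_root[OF iD]] by metis
  then have "\<omega> i \<bullet> ?f k = 1" using fP[OF iD k(1)] by linarith
  then have "?f k = i" using \<open>?f k = (\<omega> i \<bullet> ?f k) *\<^sub>R i\<close> by simp
  then have "g (inv g k) = g (- i)" by (metis minus_minus)
  then have "- g i = k" using weyl_inv_right[OF gW] weyl_minus[OF gW] by simp
  then show ?thesis using k by blast
qed

lemma sum_in_Nats: "(\<And>i. i \<in> K \<Longrightarrow> f i \<in> \<nat>) \<Longrightarrow> sum f K \<in> (\<nat> :: real set)"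
  by (induction K rule: infinite_finite_induct) auto

lemma flips_nat_span:
  assumes K: "K \<subseteq> \<Delta>" and g: "flips K g" and v: "v \<in> nat_span K"
  shows "- g v \<in> nat_span K"
proof -
  have gW: "g \<in> weyl K" using g by (simp add: flips_def)
  obtain c where c: "v = (\<Sum>i\<in>K. of_nat (c i) *\<^sub>R i)" using v unfolding nat_span_def by blast
  have e: "- g v = (\<Sum>i\<in>K. of_nat (c i) *\<^sub>R (- g i))"
    unfolding c linear_sum[OF linear_weyl[OF gW]]
    by (simp add: linear_scale[OF linear_weyl[OF gW]] sum_negf)
  have "\<omega> k \<bullet> - g i \<in> \<nat>" "k \<notin> K \<Longrightarrow> \<omega> k \<bullet> - g i = 0" if i: "i \<in> K" and k: "k \<in> \<Delta>" for i k
  proof -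
    obtain m where m: "m = - g i" "m \<in> K" using flips_simple[OF K g i] by blast
    have "\<omega> k \<bullet> m = (if m = k then 1 else 0)" using fund_coweight_pairing m(2) K by blast
    then show "\<omega> k \<bullet> - g i \<in> \<nat>" "k \<notin> K \<Longrightarrow> \<omega> k \<bullet> - g i = 0" unfolding m(1)[symmetric] using m(2) by auto
  qed
  then have "\<forall>k\<in>K. \<omega> k \<bullet> - g v \<in> \<nat>" "\<forall>k\<in>\<Delta>-K. \<omega> k \<bullet> - g v = 0"
    unfolding e inner_sum_right inner_scaleR_right using K
    by (auto intro!: sum_in_Nats Nats_mult sum.neutral simp del: inner_minus_right)
  then show ?thesis using nat_span_iff[OF K] by blast
qed

text \<open>
  Both \<open>-g\<close> and its inverse map \<open>\<Phi>\<^sub>K\<close> to itself and preserve the order, so they fix the largest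
  element.
\<close>

lemma flips_highest_root:
  assumes K: "K \<subseteq> \<Delta>" "indecomposable K" and g: "flips K g"
  shows "g (highest_root \<Phi> K) = - highest_root \<Phi> K"
proof -
  let ?\<theta> = "highest_root \<Phi> K"
  note t = highest_root[OF K]
  have gW: "g \<in> weyl K" using g by (simp add: flips_def)
  have ig: "inv g \<in> weyl K" by (rule weyl_inv[OF gW])
  have tK: "?\<theta> \<in> par_roots \<Phi> K" using t(1) by (simp add: par_pos_roots_def)
  have neg: "- v \<in> par_roots \<Phi> K" if "v \<in> par_roots \<Phi> K" for v
    using that uminus_root by (simp add: par_root_iff[OF K(1)])
  have 1: "?\<theta> - (- g ?\<theta>) \<in> nat_span K" using t(2) neg weyl_par_root[OF gW K(1) tK] by blast
  have "?\<theta> - (- inv g ?\<theta>) \<in> nat_span K" using t(2) neg weyl_par_root[OF ig K(1) tK] by blast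
  then have "- g (?\<theta> - (- inv g ?\<theta>)) \<in> nat_span K" using flips_nat_span[OF K(1) g] by blast
  moreover have "- g (?\<theta> - (- inv g ?\<theta>)) = - (?\<theta> - (- g ?\<theta>))"
    by (simp add: linear_add[OF linear_weyl[OF gW]] weyl_inv_right[OF gW])
  ultimately have "?\<theta> - (- g ?\<theta>) = 0" using nat_span_antisym[OF K(1) 1] by metis
  then show ?thesis by (simp add: add_eq_0_iff)
qed

text \<open>
  Among the roots of \<open>\<Phi>\<^sub>K\<close> with coefficient \<open>1\<close> at \<open>j\<close>, the highest root is the largest and \<open>j\<close>
  the smallest. The element \<open>g\<close> keeps this set and reverses its order.
\<close>

lemma flips_highest_root_cominuscule:
  assumes K: "K \<subseteq> \<Delta>" "indecomposable K" and j: "j \<in> K" "\<omega> j \<bullet> highest_root \<Phi> K = 1"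
    and g: "flips (K - {j}) g"
  shows "g (highest_root \<Phi> K) = j"
proof -
  let ?\<theta> = "highest_root \<Phi> K" and ?L = "K - {j}"
  note t = highest_root[OF K]
  have L: "?L \<subseteq> \<Delta>" and LK: "?L \<subseteq> K" using K by auto
  have gL: "g \<in> weyl ?L" using g by (simp add: flips_def)
  have gW: "g \<in> weyl K" using gL weyl_mono[OF LK] by blast
  have ig: "inv g \<in> weyl K" by (rule weyl_inv[OF gW])
  have jD: "j \<in> \<Delta> - ?L" using j K by blast
  have tK: "?\<theta> \<in> par_roots \<Phi> K" using t(1) by (simp add: par_pos_roots_def)
  have gt: "g ?\<theta> \<in> par_roots \<Phi> K" using weyl_par_root[OF gW K(1) tK] .
  have gj: "\<omega> j \<bullet> g ?\<theta> = 1" using coeff_weyl[OF gL L jD] j by simp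
  have gP: "g ?\<theta> \<in> P" using pos_if_coeff_pos[of "g ?\<theta>" j] gt gj jD by (auto simp: par_root_iff[OF K(1)])
  then have "g ?\<theta> \<in> PJ K" using gt by (simp add: par_pos_roots_def)
  then have n: "g ?\<theta> \<in> nat_span K" by (rule par_pos_nat_span[OF K(1)])
  have 1: "g ?\<theta> - j \<in> nat_span ?L"
    unfolding nat_span_iff[OF L]
  proof (intro conjI ballI)
    fix i assume i: "i \<in> ?L"
    then show "\<omega> i \<bullet> (g ?\<theta> - j) \<in> \<nat>" using n jD by (auto simp: nat_span_iff[OF K(1)] inner_diff_right fund_coweight_pairing)
  next
    fix i assume i: "i \<in> \<Delta> - ?L"
    then show "\<omega> i \<bullet> (g ?\<theta> - j) = 0"
      using n jD gj by (cases "i = j") (auto simp: nat_span_iff[OF K(1)] inner_diff_right fund_coweight_pairing)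
  qed
  have jK: "j \<in> par_roots \<Phi> K" using simple_par_pos[OF K(1) j(1)] by (simp add: par_pos_roots_def)
  then have ij: "inv g j \<in> par_roots \<Phi> K" using weyl_par_root[OF ig K(1)] by blast
  then have 2: "?\<theta> - inv g j \<in> nat_span K" using t(2) by blast
  have "\<omega> j \<bullet> inv g j = 1" using coeff_weyl[OF weyl_inv[OF gL] L jD] jD by (simp add: fund_coweight_pairing)
  then have "?\<theta> - inv g j \<in> nat_span ?L"
    using 2 j(2) by (auto simp: nat_span_iff[OF K(1)] nat_span_iff[OF L] inner_diff_right)
  then have "- g (?\<theta> - inv g j) \<in> nat_span ?L" by (rule flips_nat_span[OF L g])
  moreover have "- g (?\<theta> - inv g j) = - (g ?\<theta> - j)"
    by (simp add: linear_diff[OF linear_weyl[OF gW]] weyl_inv_right[OF gW])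
  ultimately have "g ?\<theta> - j = 0" using nat_span_antisym[OF L 1] by metis
  then show ?thesis by simp
qed

section \<open>Cominuscule nodes\<close>

lemma v_elem_in_weyl: assumes "K \<subseteq> \<Delta>" shows "v_elem \<Delta> K j \<in> weyl K"
proof (cases "j \<in> K")
  case True
  have "longest \<Delta> (K - {j}) \<in> weyl (K - {j})" using longest(1) assms by blast
  then have "inv (longest \<Delta> (K - {j})) \<in> weyl K" using weyl_inv weyl_mono by blast
  then show ?thesis using True weyl_comp[OF longest(1)[OF assms]] by (simp only: v_elem_def if_True)
qed (simp only: v_elem_def if_False id_in_weyl)

text \<open>
  The first factor that acts, the inverse of the longest element of \<open>W\<^bsub>K - {j}\<^esub>\<close>, makes a positive
  root negative exactly when it lies in \<open>\<Phi>\<^bsub>K - {j}\<^esub>\<close>; the other factor changes all signs in \<open>\<Phi>\<^sub>K\<close>.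
\<close>

lemma v_elem_pos_iff:
  assumes K: "K \<subseteq> \<Delta>" and b: "\<beta> \<in> PJ K" and j: "j \<in> K"
  shows "v_elem \<Delta> K j \<beta> \<in> P \<longleftrightarrow> \<omega> j \<bullet> \<beta> = 0"
proof -
  let ?L = "K - {j}"
  have L: "?L \<subseteq> \<Delta>" and LK: "?L \<subseteq> K" using K by auto
  let ?g = "inv (longest \<Delta> ?L)"
  have g: "flips ?L ?g" using flips_inv[OF L flips_longest[OF L]] .
  then have gL: "?g \<in> weyl ?L" by (simp add: flips_def)
  have gW: "?g \<in> weyl K" using gL weyl_mono[OF LK] by blast
  have v: "v_elem \<Delta> K j \<beta> = longest \<Delta> K (?g \<beta>)" using j by (simp add: v_elem_def)
  have neg: "- longest \<Delta> K \<gamma> \<in> P" if "\<gamma> \<in> PJ K" for \<gamma> using longest(2)[OF K that] by (simp add: par_pos_roots_def)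
  have lW: "longest \<Delta> K \<in> weyl K" using longest(1) K by blast
  show ?thesis
  proof (cases "\<omega> j \<bullet> \<beta> = 0")
    case True
    then have "\<beta> \<in> PJ ?L" using b by (auto simp: par_pos_iff[OF K] par_pos_iff[OF L])
    then have "- ?g \<beta> \<in> PJ ?L" using g by (simp add: flips_def)
    then have "- ?g \<beta> \<in> PJ K" by (auto simp: par_pos_iff[OF K] par_pos_iff[OF L])
    then have "- longest \<Delta> K (- ?g \<beta>) \<in> P" by (rule neg)
    then show ?thesis using True v weyl_minus[OF lW] by simp
  next
    case False
    then have "\<beta> \<in> P - PJ ?L" using b j K by (auto simp: par_pos_iff[OF K] par_pos_iff[OF L])
    then have "?g \<beta> \<in> P" using weyl_pos_outside[OF gL L] by blast
    moreover have "?g \<beta> \<in> par_roots \<Phi> K" using weyl_par_root[OF gW K] b by (simp add: par_pos_roots_def)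
    ultimately have "- longest \<Delta> K (?g \<beta>) \<in> P" using neg by (simp add: par_pos_roots_def)
    then show ?thesis using False v uminus_notin_pos by fastforce
  qed
qed

lemma affine_node_notin:
  assumes K: "K \<subseteq> \<Delta>" "indecomposable K" shows "affine_node \<Phi> K \<notin> \<Delta>"
proof
  assume "affine_node \<Phi> K \<in> \<Delta>"
  then have "- highest_root \<Phi> K \<in> P" by (simp add: affine_node_def simple_pos_root)
  then show False using highest_root(1)[OF K] uminus_notin_pos by (simp add: par_pos_roots_def)
qed

text \<open>
  A diagram automorphism permutes the marks, the coefficients of the linear relation between
  the nodes: the relation is unique up to a factor, which is \<open>1\<close> since the sum of the marks is
  preserved. The mark of the affine node is \<open>1\<close>.
\<close>

lemma cominuscule_imp:
  assumes K: "K \<subseteq> \<Delta>" "indecomposable K" and c: "cominuscule \<Phi> K j"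
  shows "j = affine_node \<Phi> K \<or> j \<in> K \<and> \<omega> j \<bullet> highest_root \<Phi> K = 1"
proof -
  let ?\<theta> = "highest_root \<Phi> K" and ?o = "affine_node \<Phi> K" and ?N = "affine_nodes \<Phi> K"
  obtain \<sigma> where s: "bij_betw \<sigma> ?N ?N"
    "\<And>i k. i \<in> ?N \<Longrightarrow> k \<in> ?N \<Longrightarrow> coroot (\<sigma> i) \<bullet> \<sigma> k = coroot i \<bullet> k" "j = \<sigma> ?o"
    using c unfolding cominuscule_def diagram_automorphism_def by blast
  have fin: "finite K" using finite_sub K by blast
  have oK: "?o \<notin> K" using affine_node_notin[OF K] K by blast
  have N: "?N = insert ?o K" by (simp add: affine_nodes_def)
  \<comment> \<open>the coefficients of the linear relation between the nodes\<close>
  define a where "a = (\<lambda>n. if n = ?o then 1 else \<omega> n \<bullet> ?\<theta>)"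
  have aK: "a i = \<omega> i \<bullet> ?\<theta>" if "i \<in> K" for i using that oK by (auto simp: a_def)
  have ao: "a ?o = 1" by (simp add: a_def)
  have tP: "?\<theta> \<in> PJ K" using highest_root(1)[OF K] .
  have "?\<theta> = (\<Sum>i\<in>K. (\<omega> i \<bullet> ?\<theta>) *\<^sub>R i)"
    by (rule simple_expansion_par[OF K(1)]) (use tP in \<open>auto simp: par_pos_iff[OF K(1)]\<close>)
  then have tsum: "?\<theta> = (\<Sum>i\<in>K. a i *\<^sub>R i)" using aK by simp
  have rel: "(\<Sum>n\<in>?N. a n *\<^sub>R n) = 0"
    unfolding N sum.insert[OF fin oK] ao using tsum by (simp add: affine_node_def)
  define \<tau> where "\<tau> = inv_into ?N \<sigma>"
  have t: "bij_betw \<tau> ?N ?N" unfolding \<tau>_def by (rule bij_betw_inv_into[OF s(1)])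
  have ts: "\<tau> (\<sigma> n) = n" if "n \<in> ?N" for n
    unfolding \<tau>_def using s(1) that by (simp add: bij_betw_inv_into_left)
  \<comment> \<open>the relation between the nodes, transported along \<open>\<sigma>\<close>; it is orthogonal to all nodes\<close>
  define v where "v = (\<Sum>n\<in>?N. a n *\<^sub>R \<sigma> n)"
  have "(\<Sum>n\<in>?N. a (\<tau> n) *\<^sub>R n) = (\<Sum>n\<in>?N. a (\<tau> (\<sigma> n)) *\<^sub>R \<sigma> n)"
    by (rule sum.reindex_bij_betw[OF s(1), symmetric])
  also have "\<dots> = v" unfolding v_def using ts by (intro sum.cong) auto
  finally have v: "v = a (\<tau> ?o) *\<^sub>R ?o + (\<Sum>i\<in>K. a (\<tau> i) *\<^sub>R i)"
    unfolding N sum.insert[OF fin oK] by simp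
  also have "\<dots> = (\<Sum>i\<in>K. (a (\<tau> i) - a (\<tau> ?o) * a i) *\<^sub>R i)"
    by (subst affine_node_def, subst tsum)
      (simp add: scaleR_sum_right sum_subtractf scaleR_left_diff_distrib)
  finally have v2: "v = (\<Sum>i\<in>K. (a (\<tau> i) - a (\<tau> ?o) * a i) *\<^sub>R i)" .
  have orth: "coroot (\<sigma> k) \<bullet> v = 0" if k: "k \<in> ?N" for k
  proof -
    have "coroot (\<sigma> k) \<bullet> v = (\<Sum>n\<in>?N. a n * (coroot k \<bullet> n))"
      unfolding v_def inner_sum_right using s(2)[OF k] by (intro sum.cong) auto
    also have "\<dots> = coroot k \<bullet> (\<Sum>n\<in>?N. a n *\<^sub>R n)" by (simp add: inner_sum_right)
    finally show ?thesis using rel by simp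
  qed
  have "k \<bullet> v = 0" if k: "k \<in> K" for k
  proof -
    have "k \<in> \<sigma> ` ?N" using s(1) k N by (simp add: bij_betw_def)
    then have "coroot k \<bullet> v = 0" using orth by blast
    moreover have "k \<noteq> 0" using k K simple_root zero_notin_roots by blast
    ultimately show ?thesis by (simp add: coroot_def)
  qed
  then have "v \<bullet> v = 0" by (subst (1) v2) (simp add: inner_sum_left)
  then have v0: "v = 0" by simp
  have tau: "a (\<tau> i) = a (\<tau> ?o) * a i" if i: "i \<in> K" for i
  proof -
    have "\<omega> i \<bullet> v = a (\<tau> i) - a (\<tau> ?o) * a i" by (subst v2, subst coeff_sum[OF K(1)]) (use i in simp)
    then show ?thesis using v0 by simp
  qed
  then have tau': "a (\<tau> n) = a (\<tau> ?o) * a n" if "n \<in> ?N" for n using that N ao by auto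
  have pos: "0 < a n" if "n \<in> ?N" for n using that N ao aK highest_root(3)[OF K] by auto
  have "(\<Sum>n\<in>?N. a n) = (\<Sum>n\<in>?N. a (\<tau> n))" by (rule sum.reindex_bij_betw[OF t, symmetric])
  also have "\<dots> = a (\<tau> ?o) * (\<Sum>n\<in>?N. a n)" unfolding sum_distrib_left using tau' by (intro sum.cong) auto
  finally have "a (\<tau> ?o) = 1"
    using sum_pos[of ?N a] pos fin N by (metis finite_insert insert_not_empty less_irrefl mult_cancel_right1 mult.commute)
  moreover have jN: "j \<in> ?N" using s N by (metis bij_betwE insertI1)
  ultimately have "a j = a (\<tau> j)" using tau' by simp
  also have "\<dots> = 1" using s(3) ts[of ?o] ao N by simp
  finally show ?thesis using jN N aK by auto
qed

text \<open>
  The automorphism is the inverse of \<open>v\<^sub>j\<close>: the element \<open>v\<^sub>j\<close> maps \<open>K - {j}\<close> into \<open>K\<close>, the affine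
  node \<open>-\<theta>\<^sub>K\<close> into \<open>K\<close>, and \<open>j\<close> to \<open>-\<theta>\<^sub>K\<close>.
\<close>

lemma cominusculeI:
  assumes K: "K \<subseteq> \<Delta>" "indecomposable K" and j: "j \<in> K" "\<omega> j \<bullet> highest_root \<Phi> K = 1"
  shows "cominuscule \<Phi> K j"
proof -
  let ?\<theta> = "highest_root \<Phi> K" and ?o = "affine_node \<Phi> K" and ?N = "affine_nodes \<Phi> K" and ?L = "K - {j}"
  have L: "?L \<subseteq> \<Delta>" and LK: "?L \<subseteq> K" using K by auto
  \<comment> \<open>\<open>v\<close> is the product of the longest element of \<open>W\<^sub>K\<close> and the inverse of \<open>h\<close>\<close>
  define h where "h = longest \<Delta> ?L"
  define v where "v = v_elem \<Delta> K j"
  have h: "flips ?L h" unfolding h_def by (rule flips_longest[OF L])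
  have hW: "h \<in> weyl K" using h weyl_mono[OF LK] by (auto simp: flips_def)
  have g: "flips ?L (inv h)" by (rule flips_inv[OF L h])
  have l: "flips K (longest \<Delta> K)" by (rule flips_longest[OF K(1)])
  then have lW: "longest \<Delta> K \<in> weyl K" by (simp add: flips_def)
  have vdef: "v x = longest \<Delta> K (inv h x)" for x using j by (simp add: v_def v_elem_def h_def)
  have vW: "v \<in> weyl K" unfolding v_def by (rule v_elem_in_weyl[OF K(1)])
  have fin: "finite ?N" using finite_sub[OF K(1)] by (simp add: affine_nodes_def)
  have vj: "v j = ?o"
  proof -
    have "inv h j = ?\<theta>" using flips_highest_root_cominuscule[OF K j h] weyl_inv_left[OF hW] by metis
    then show ?thesis using vdef flips_highest_root[OF K l] by (simp add: affine_node_def)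
  qed
  have vo: "v ?o \<in> K"
  proof -
    have "v ?o = - longest \<Delta> K j"
      using vdef flips_highest_root_cominuscule[OF K j g] weyl_minus[OF weyl_inv[OF hW]] weyl_minus[OF lW]
      by (simp add: affine_node_def)
    then show ?thesis using flips_simple[OF K(1) l j(1)] by simp
  qed
  have vi: "v i \<in> K" if i: "i \<in> ?L" for i
  proof -
    have "- inv h i \<in> K" using flips_simple[OF L g i] by blast
    then have "- longest \<Delta> K (- inv h i) \<in> K" by (rule flips_simple[OF K(1) l])
    then show ?thesis using vdef weyl_minus[OF lW] by simp
  qed
  have "v n \<in> ?N" if "n \<in> ?N" for n
    using that vj vo vi by (cases "n = j") (auto simp: affine_nodes_def)
  moreover have "inj v" using bij_weyl[OF vW] by (simp add: bij_is_inj)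
  ultimately have vN: "v ` ?N = ?N"
    using endo_inj_surj[OF fin, of v] by (meson image_subsetI inj_on_subset top_greatest)
  have iW: "inv v \<in> weyl K" by (rule weyl_inv[OF vW])
  have "inv v ` ?N = ?N" using vN weyl_inv_left[OF vW] by (metis (no_types, lifting) image_comp image_cong comp_apply image_ident)
  then have "bij_betw (inv v) ?N ?N"
    unfolding bij_betw_def using bij_is_inj[OF bij_weyl[OF iW]] inj_on_subset by blast
  moreover have "coroot (inv v i) \<bullet> inv v k = coroot i \<bullet> k" for i k
    unfolding coroot_orthogonal[OF orthogonal_weyl[OF iW]] by (rule weyl_inner[OF iW])
  moreover have "j = inv v ?o" using vj weyl_inv_left[OF vW] by metis
  ultimately show ?thesis unfolding cominuscule_def diagram_automorphism_def by blast
qed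

lemma cominuscule_affine_node: "cominuscule \<Phi> K (affine_node \<Phi> K)"
  unfolding cominuscule_def diagram_automorphism_def by (rule exI[of _ id]) simp

end

section \<open>The decomposition of a coroot lattice element along \<open>J\<close>\<close>

context finite_roots
begin

text \<open>
  For elements of \<open>Q\<^sup>\<or>\<close> this is equivalent to being \<open>J\<close>-adjusted (\<open>J_adjusted_iff\<close>).
\<close>

definition minuscule_on :: "'a set \<Rightarrow> 'a \<Rightarrow> bool" where
  "minuscule_on J \<tau> \<longleftrightarrow> (\<forall>\<beta>\<in>PJ J. \<tau> \<bullet> \<beta> = 0 \<or> \<tau> \<bullet> \<beta> = - 1)"

text \<open>
  For \<open>\<tau>\<close> with pairings \<open>0\<close> and \<open>-1\<close> with \<open>\<Phi>\<^sub>J\<^sup>+\<close>, the product \<open>z t\<^sub>\<tau>\<close> then sends \<open>\<Phi>\<^sub>J\<^sup>+\<close> to positive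
  affine roots.
\<close>

definition straightens :: "'a set \<Rightarrow> ('a \<Rightarrow> 'a) \<Rightarrow> 'a \<Rightarrow> bool" where
  "straightens J z \<tau> \<longleftrightarrow> z \<in> weyl J \<and> (\<forall>\<beta>\<in>PJ J. z \<beta> \<in> P \<longleftrightarrow> \<tau> \<bullet> \<beta> = 0)"

context
  fixes J assumes J: "J \<subseteq> \<Delta>"
begin

text \<open>
  Where \<open>z\<^sup>-\<^sup>1\<beta>\<close> is negative, its negative is an inversion of \<open>z\<close>, hence also made negative by \<open>g\<close>:
  the two sign changes cancel.
\<close>

lemma straightens_comp_inv:
  assumes z: "straightens J z \<tau>" and g: "\<And>\<beta>. \<beta> \<in> PJ J \<Longrightarrow> g \<beta> \<in> P \<longleftrightarrow> \<tau> \<bullet> \<beta> = 0"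
    and gW: "g \<in> weyl \<Delta>" and b: "\<beta> \<in> PJ J"
  shows "g (inv z \<beta>) \<in> P"
proof -
  have zW: "z \<in> weyl J" using z by (simp add: straightens_def)
  have "\<beta> \<in> par_roots \<Phi> J" using b by (simp add: par_pos_roots_def)
  then have r: "inv z \<beta> \<in> par_roots \<Phi> J" by (rule weyl_par_root[OF weyl_inv[OF zW] J])
  have bP: "\<beta> \<in> P" using b by (simp add: par_pos_roots_def)
  from par_pos_or_neg[OF J r] show ?thesis
  proof
    assume p: "inv z \<beta> \<in> PJ J"
    have "z (inv z \<beta>) \<in> P" using bP by (simp add: weyl_inv_right[OF zW])
    then have "\<tau> \<bullet> inv z \<beta> = 0" using z p by (simp add: straightens_def)
    then show ?thesis using g[OF p] by blast
  next
    assume n: "- inv z \<beta> \<in> PJ J"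
    have "z (- inv z \<beta>) \<notin> P"
      using bP uminus_notin_pos by (simp add: weyl_minus[OF zW] weyl_inv_right[OF zW])
    then have "\<tau> \<bullet> (- inv z \<beta>) \<noteq> 0" using z n unfolding straightens_def by blast
    then have "g (- inv z \<beta>) \<notin> P" using g[OF n] by blast
    then have "- g (inv z \<beta>) \<notin> P" by (simp add: weyl_minus[OF gW])
    moreover have "g (inv z \<beta>) \<in> \<Phi>" using r weyl_root[OF gW order_refl] by (simp add: par_root_iff[OF J])
    ultimately show ?thesis using pos_or_neg by blast
  qed
qed

lemma straightens_unique:
  assumes "straightens J z \<tau>" "straightens J z' \<tau>" shows "z = z'"
proof -
  have zW: "z \<in> weyl J" "z' \<in> weyl J" using assms by (auto simp: straightens_def)
  have zD: "z' \<in> weyl \<Delta>" using zW weyl_mono[OF J] by blast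
  have "z' \<circ> inv z = id"
  proof (rule weyl_trivial_par[OF _ J])
    show "z' \<circ> inv z \<in> weyl J" using zW weyl_comp weyl_inv by blast
    fix i assume "i \<in> J"
    then have "z' (inv z i) \<in> P"
      using straightens_comp_inv[OF assms(1) _ zD] assms(2) simple_par_pos[OF J] unfolding straightens_def by blast
    then show "(z' \<circ> inv z) i \<in> P" by simp
  qed
  then have "z' (inv z (z v)) = z v" for v by (metis comp_apply id_apply)
  then show ?thesis by (simp add: weyl_inv_left[OF zW(1)] fun_eq_iff)
qed

lemma component_sub_simple: "K \<in> components J \<Longrightarrow> K \<subseteq> \<Delta>"
  using component_subset[OF J] J by blast

lemma component_par_pos: "K \<in> components J \<Longrightarrow> \<beta> \<in> PJ K \<Longrightarrow> \<beta> \<in> PJ J"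
  using par_pos_iff[OF J] par_pos_iff[OF component_sub_simple] component_subset[OF J] by blast

lemma component_cominuscule:
  assumes "K \<in> components J" "cominuscule \<Phi> K n"
  shows "n = affine_node \<Phi> K \<and> n \<notin> \<Delta> \<or> n \<in> K \<and> \<omega> n \<bullet> highest_root \<Phi> K = 1"
  using cominuscule_imp[OF component_sub_simple[OF assms(1)] component_indecomposable[OF J assms(1)] assms(2)]
    affine_node_notin[OF component_sub_simple[OF assms(1)] component_indecomposable[OF J assms(1)]] by blast

text \<open>
  The coweights \<open>\<omega>\<^sub>i\<^sup>\<or>\<close> with \<open>i \<notin> J\<close> and those of the other components are orthogonal to \<open>\<Phi>\<^sub>K\<close>.
\<close>

lemma J_decomp_pairing:
  assumes d: "J_decomp \<Phi> \<Delta> J \<nu> \<phi> j" and K: "K \<in> components J" and b: "\<beta> \<in> par_roots \<Phi> K"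
  shows "(\<nu> + \<phi>) \<bullet> \<beta> = (if j K \<in> K then - (\<omega> (j K) \<bullet> \<beta>) else 0)"
proof -
  obtain c where c: "\<nu> = (\<Sum>i\<in>\<Delta> - J. of_int (c i) *\<^sub>R \<omega> i) - \<phi> - (\<Sum>K\<in>components J. node_coweight \<Delta> (j K))"
    and com: "\<And>K. K \<in> components J \<Longrightarrow> cominuscule \<Phi> K (j K)"
    using d unfolding J_decomp_def by blast
  have KD: "K \<subseteq> \<Delta>" "K \<subseteq> J" using K component_sub_simple component_subset[OF J] by auto
  have other: "node_coweight \<Delta> (j L) \<bullet> \<beta> = (if L = K then if j K \<in> K then \<omega> (j K) \<bullet> \<beta> else 0 else 0)"
    if L: "L \<in> components J" for L
    using component_cominuscule[OF L com[OF L]]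
  proof
    assume n: "j L = affine_node \<Phi> L \<and> j L \<notin> \<Delta>"
    then have "L = K \<Longrightarrow> j K \<notin> K" using KD by blast
    then show ?thesis using n by (auto simp: node_coweight_def)
  next
    assume n: "j L \<in> L \<and> \<omega> (j L) \<bullet> highest_root \<Phi> L = 1"
    then have jD: "j L \<in> \<Delta>" using L component_sub_simple by blast
    show ?thesis
    proof (cases "L = K")
      case True
      then show ?thesis using n jD by (simp add: node_coweight_def)
    next
      case False
      then have "j L \<in> \<Delta> - K" using n jD component_disjoint[OF J L K] by blast
      then have "\<omega> (j L) \<bullet> \<beta> = 0" using b by (simp add: par_root_iff[OF KD(1)])
      then show ?thesis using False jD by (simp add: node_coweight_def)
    qed
  qed
  have "(\<Sum>i\<in>\<Delta> - J. of_int (c i) *\<^sub>R \<omega> i) \<bullet> \<beta> = (\<Sum>i\<in>\<Delta> - J. of_int (c i) * (\<omega> i \<bullet> \<beta>))"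
    by (simp add: inner_sum_left)
  also have "\<dots> = 0" 
  proof (rule sum.neutral, rule ballI)
    fix i assume "i \<in> \<Delta> - J"
    then have "i \<in> \<Delta> - K" using KD by blast
    then show "of_int (c i) * (\<omega> i \<bullet> \<beta>) = 0" using b by (simp add: par_root_iff[OF KD(1)])
  qed
  finally have 1: "(\<Sum>i\<in>\<Delta> - J. of_int (c i) *\<^sub>R \<omega> i) \<bullet> \<beta> = 0" .
  have "(\<Sum>L\<in>components J. node_coweight \<Delta> (j L)) \<bullet> \<beta>
      = (\<Sum>L\<in>components J. if L = K then if j K \<in> K then \<omega> (j K) \<bullet> \<beta> else 0 else 0)"
    unfolding inner_sum_left using other by (intro sum.cong) auto
  also have "\<dots> = (if j K \<in> K then \<omega> (j K) \<bullet> \<beta> else 0)"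
    using K finite_components[OF J] by simp
  finally have 2: "(\<Sum>L\<in>components J. node_coweight \<Delta> (j L)) \<bullet> \<beta> = (if j K \<in> K then \<omega> (j K) \<bullet> \<beta> else 0)" .
  show ?thesis by (subst c) (simp add: inner_diff_left inner_add_left 1 2)
qed

text \<open>
  The coefficient is a nonnegative integer and bounded by the coefficient in the highest root.
\<close>

lemma cominuscule_coeff:
  assumes K: "K \<in> components J" and c: "cominuscule \<Phi> K n" "n \<in> K" and b: "\<beta> \<in> PJ K"
  shows "\<omega> n \<bullet> \<beta> = 0 \<or> \<omega> n \<bullet> \<beta> = 1"
proof -
  have KD: "K \<subseteq> \<Delta>" and ind: "indecomposable K"
    using K component_sub_simple component_indecomposable[OF J] by auto
  have nD: "n \<in> \<Delta>" using c KD by blast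
  have t: "\<omega> n \<bullet> highest_root \<Phi> K = 1" using component_cominuscule[OF K c(1)] c(2) KD by blast
  have "\<beta> \<in> par_roots \<Phi> K" "\<beta> \<in> P" "\<beta> \<in> \<Phi>" using b by (auto simp: par_pos_roots_def pos_root_iff)
  then have "highest_root \<Phi> K - \<beta> \<in> nat_span K" using highest_root(2)[OF KD ind] by blast
  then have "\<omega> n \<bullet> (highest_root \<Phi> K - \<beta>) \<in> \<nat>" using c(2) by (simp add: nat_span_iff[OF KD])
  then have le: "\<omega> n \<bullet> \<beta> \<le> 1" using t Nats_nonneg by (force simp: inner_diff_right)
  have ge: "0 \<le> \<omega> n \<bullet> \<beta>" using \<open>\<beta> \<in> P\<close> nD by (simp add: pos_root_iff)
  obtain k where k: "\<omega> n \<bullet> \<beta> = of_int k" using coeff_root_int[OF \<open>\<beta> \<in> \<Phi>\<close> nD] by (rule Ints_cases)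
  then have "k = 0 \<or> k = 1" using le ge by simp linarith
  then show ?thesis using k by auto
qed

lemma J_decomp_minuscule:
  assumes d: "J_decomp \<Phi> \<Delta> J \<nu> \<phi> j" shows "minuscule_on J (\<nu> + \<phi>)"
  unfolding minuscule_on_def
proof
  fix \<beta> assume "\<beta> \<in> PJ J"
  then obtain K where K: "K \<in> components J" "\<beta> \<in> PJ K" using root_in_component[OF J] by blast
  have "cominuscule \<Phi> K (j K)" using d K unfolding J_decomp_def by blast
  moreover have "\<beta> \<in> par_roots \<Phi> K" using K by (simp add: par_pos_roots_def)
  ultimately show "(\<nu> + \<phi>) \<bullet> \<beta> = 0 \<or> (\<nu> + \<phi>) \<bullet> \<beta> = - 1"
    using J_decomp_pairing[OF d K(1)] cominuscule_coeff[OF K(1) _ _ K(2)] by auto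
qed

lemma v_elem_commute:
  assumes "K \<in> components J" "L \<in> components J"
  shows "v_elem \<Delta> K (j K) (v_elem \<Delta> L (j L) v) = v_elem \<Delta> L (j L) (v_elem \<Delta> K (j K) v)"
proof (cases "K = L")
  case False
  have comm: "root_refl k (root_refl l v) = root_refl l (root_refl k v)" if "k \<in> K" "l \<in> L" for k l v
  proof -
    have "coroot k \<bullet> l = 0" "coroot l \<bullet> k = 0"
      using component_orthogonal[OF J assms False that] by (simp_all add: coroot_def inner_commute)
    then show ?thesis by (simp add: root_refl_coweight inner_diff_left)
  qed
  have 1: "g (root_refl l v) = root_refl l (g v)" if "g \<in> weyl K" "l \<in> L" for g l v
    using that(1)
  proof (induction arbitrary: v rule: weyl_induct)
    case (comp g i)
    have "g (root_refl i (root_refl l v)) = g (root_refl l (root_refl i v))"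
      using comm[OF comp(2) that(2)] by (rule arg_cong)
    also have "\<dots> = root_refl l (g (root_refl i v))" by (rule comp.IH)
    finally show ?case by simp
  qed simp
  have "g (h v) = h (g v)" if g: "g \<in> weyl K" and h: "h \<in> weyl L" for g h v
    using h by (induction arbitrary: v rule: weyl_induct) (simp_all add: 1[OF g])
  then show ?thesis using v_elem_in_weyl component_sub_simple assms by blast
qed simp

text \<open>
  The factors of the other components fix the roots of \<open>\<Phi>\<^sub>K\<close>.
\<close>

abbreviation z_prod :: "('a set \<Rightarrow> 'a) \<Rightarrow> 'a set set \<Rightarrow> 'a \<Rightarrow> 'a" where
  "z_prod j S \<equiv> Finite_Set.fold (\<lambda>K f. v_elem \<Delta> K (j K) \<circ> f) id S"

lemma z_prod:
  assumes "S \<subseteq> components J"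
  shows "z_prod j S \<in> weyl J \<and> (\<forall>K\<in>components J. \<forall>\<beta>\<in>par_roots \<Phi> K.
    z_prod j S \<beta> = (if K \<in> S then v_elem \<Delta> K (j K) \<beta> else \<beta>))"
proof -
  have "finite S" using finite_subset[OF assms finite_components[OF J]] .
  then show ?thesis using assms
  proof (induction S rule: finite_induct)
    case empty
    show ?case unfolding Finite_Set.fold_empty by (intro conjI ballI id_in_weyl) simp
  next
    case (insert L S)
    interpret comp_fun_commute_on "components J" "\<lambda>K f. v_elem \<Delta> K (j K) \<circ> f"
      by unfold_locales (auto simp: fun_eq_iff v_elem_commute)
    have eq: "z_prod j (insert L S) = v_elem \<Delta> L (j L) \<circ> z_prod j S"
      using insert by (intro fold_insert) auto
    have L: "L \<in> components J" using insert by blast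
    have vL: "v_elem \<Delta> L (j L) \<in> weyl L" using v_elem_in_weyl component_sub_simple[OF L] by blast
    then have vJ: "v_elem \<Delta> L (j L) \<in> weyl J" using weyl_mono[OF component_subset[OF J L]] by blast
    have IH: "z_prod j S \<in> weyl J"
      "\<And>K \<beta>. K \<in> components J \<Longrightarrow> \<beta> \<in> par_roots \<Phi> K \<Longrightarrow> z_prod j S \<beta> = (if K \<in> S then v_elem \<Delta> K (j K) \<beta> else \<beta>)"
      using insert.IH insert.prems by blast+
    show ?case unfolding eq
    proof (intro conjI ballI)
      show "v_elem \<Delta> L (j L) \<circ> z_prod j S \<in> weyl J" using weyl_comp[OF vJ IH(1)] .
      fix K \<beta> assume K: "K \<in> components J" and b: "\<beta> \<in> par_roots \<Phi> K"
      have vK: "v_elem \<Delta> K (j K) \<beta> \<in> par_roots \<Phi> K"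
        using weyl_par_root[OF v_elem_in_weyl] component_sub_simple[OF K] b by blast
      show "(v_elem \<Delta> L (j L) \<circ> z_prod j S) \<beta> = (if K \<in> insert L S then v_elem \<Delta> K (j K) \<beta> else \<beta>)"
      proof (cases "K = L")
        case True
        then show ?thesis using IH(2)[OF K b] insert.hyps by simp
      next
        case False
        then show ?thesis
          using IH(2)[OF K b] weyl_component_fixes[OF J K L False vK vL] weyl_component_fixes[OF J K L False b vL]
          by simp
      qed
    qed
  qed
qed

lemma z_prod_straightens:
  assumes d: "J_decomp \<Phi> \<Delta> J \<nu> \<phi> j" shows "straightens J (z_prod j (components J)) (\<nu> + \<phi>)"
  unfolding straightens_def
proof (intro conjI ballI)
  note z = z_prod[OF order_refl, of j]
  show "z_prod j (components J) \<in> weyl J" using z by blast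
  fix \<beta> assume "\<beta> \<in> PJ J"
  then obtain K where K: "K \<in> components J" "\<beta> \<in> PJ K" using root_in_component[OF J] by blast
  have KD: "K \<subseteq> \<Delta>" using component_sub_simple K by blast
  have b: "\<beta> \<in> par_roots \<Phi> K" "\<beta> \<in> P" using K by (auto simp: par_pos_roots_def)
  have zb: "z_prod j (components J) \<beta> = v_elem \<Delta> K (j K) \<beta>" using z K(1) b by auto
  have p: "(\<nu> + \<phi>) \<bullet> \<beta> = (if j K \<in> K then - (\<omega> (j K) \<bullet> \<beta>) else 0)" by (rule J_decomp_pairing[OF d K(1) b(1)])
  show "z_prod j (components J) \<beta> \<in> P \<longleftrightarrow> (\<nu> + \<phi>) \<bullet> \<beta> = 0"
  proof (cases "j K \<in> K")
    case True
    then show ?thesis unfolding zb p v_elem_pos_iff[OF KD K(2) True] by simp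
  next
    case False
    then show ?thesis unfolding zb p using b by (simp add: v_elem_def)
  qed
qed

text \<open>
  The difference of two numbers in \<open>{-1, 0}\<close> is at most \<open>1\<close>, so \<open>small_pairing_zero\<close> applies.
\<close>

lemma minuscule_shift_unique:
  assumes "minuscule_on J \<tau>" "minuscule_on J (\<tau> + \<eta>)" "\<eta> \<in> coroot_lattice J" shows "\<eta> = 0"
proof (rule small_pairing_zero[OF J assms(3)])
  fix \<beta> assume "\<beta> \<in> par_roots \<Phi> J"
  from par_pos_or_neg[OF J this] show "\<eta> \<bullet> \<beta> \<le> 1"
  proof
    assume "\<beta> \<in> PJ J"
    then have "\<tau> \<bullet> \<beta> = 0 \<or> \<tau> \<bullet> \<beta> = - 1" "(\<tau> + \<eta>) \<bullet> \<beta> = 0 \<or> (\<tau> + \<eta>) \<bullet> \<beta> = - 1"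
      using assms unfolding minuscule_on_def by blast+
    then show ?thesis unfolding inner_add_left by linarith
  next
    assume "- \<beta> \<in> PJ J"
    then have "\<tau> \<bullet> (- \<beta>) = 0 \<or> \<tau> \<bullet> (- \<beta>) = - 1" "(\<tau> + \<eta>) \<bullet> (- \<beta>) = 0 \<or> (\<tau> + \<eta>) \<bullet> (- \<beta>) = - 1"
      using assms unfolding minuscule_on_def by blast+
    then show ?thesis unfolding inner_add_left inner_minus_right by linarith
  qed
qed

lemma J_decomp_unique:
  assumes "J_decomp \<Phi> \<Delta> J \<nu> \<phi> j" "J_decomp \<Phi> \<Delta> J \<nu> \<phi>' j'" shows "\<phi> = \<phi>'"
proof -
  have "\<phi> \<in> coroot_lattice J" "\<phi>' \<in> coroot_lattice J" using assms by (auto simp: J_decomp_def)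
  then have "\<phi>' - \<phi> \<in> coroot_lattice J" using int_span_diff unfolding coroot_lattice_def by blast
  moreover have "minuscule_on J (\<nu> + \<phi>)" "minuscule_on J ((\<nu> + \<phi>) + (\<phi>' - \<phi>))"
    using assms[THEN J_decomp_minuscule] by simp_all
  ultimately have "\<phi>' - \<phi> = 0" using minuscule_shift_unique by blast
  then show ?thesis by simp
qed

text \<open>
  On a component \<open>K\<close> the pairings \<open>\<langle>\<tau>, i\<rangle>\<close> are \<open>0\<close> or \<open>-1\<close> and the marks are at least \<open>1\<close>, while
  \<open>\<langle>\<tau>, \<theta>\<^sub>K\<rangle> \<ge> -1\<close>. So at most one \<open>i \<in> K\<close> has pairing \<open>-1\<close>, and its mark is \<open>1\<close>: it is
  the cominuscule node of \<open>K\<close>. If there is none, the affine node is taken.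
\<close>

lemma J_decomp_minuscule_exists:
  assumes t: "\<tau> \<in> coroot_lattice \<Delta>" and m: "minuscule_on J \<tau>"
  shows "\<exists>j. J_decomp \<Phi> \<Delta> J \<tau> 0 j"
proof -
  have local: "\<exists>n. cominuscule \<Phi> K n \<and> (\<Sum>i\<in>K. (\<tau> \<bullet> i) *\<^sub>R \<omega> i) = - node_coweight \<Delta> n"
    if K: "K \<in> components J" for K
  proof (cases "\<forall>i\<in>K. \<tau> \<bullet> i = 0")
    case True
    have "affine_node \<Phi> K \<notin> \<Delta>"
      using affine_node_notin component_sub_simple[OF K] component_indecomposable[OF J K] by blast
    then show ?thesis using True cominuscule_affine_node
      by (intro exI[of _ "affine_node \<Phi> K"]) (simp add: node_coweight_def)
  next
    case False
    have KD: "K \<subseteq> \<Delta>" and ind: "indecomposable K"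
      using K component_sub_simple component_indecomposable[OF J] by auto
    let ?\<theta> = "highest_root \<Phi> K"
    note h = highest_root[OF KD ind]
    have val: "\<tau> \<bullet> i = 0 \<or> \<tau> \<bullet> i = - 1" if "i \<in> K" for i
      using m component_par_pos[OF K simple_par_pos[OF KD that]] by (simp add: minuscule_on_def)
    obtain i where i: "i \<in> K" "\<tau> \<bullet> i = - 1" using False val by blast
    have iD: "i \<in> \<Delta>" using i KD by blast
    have coeff1: "1 \<le> \<omega> k \<bullet> ?\<theta>" if k: "k \<in> K" for k
    proof -
      have "?\<theta> \<in> \<Phi>" using h(1) by (simp add: par_pos_roots_def pos_root_iff)
      then obtain n where "\<omega> k \<bullet> ?\<theta> = of_int n" using coeff_root_int k KD by (meson Ints_cases subsetD)
      then show ?thesis using h(3)[OF k] by simp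
    qed
    have th: "\<tau> \<bullet> ?\<theta> = 0 \<or> \<tau> \<bullet> ?\<theta> = - 1" using m component_par_pos[OF K h(1)] by (simp add: minuscule_on_def)
    have "?\<theta> \<in> par_roots \<Phi> K" using h(1) by (simp add: par_pos_roots_def)
    then have "\<tau> \<bullet> ?\<theta> = (\<Sum>k\<in>K. (\<omega> k \<bullet> ?\<theta>) * (\<tau> \<bullet> k))" by (rule pairing_expansion_par[OF KD])
    also have "\<dots> = (\<omega> i \<bullet> ?\<theta>) * (\<tau> \<bullet> i) + (\<Sum>k\<in>K - {i}. (\<omega> k \<bullet> ?\<theta>) * (\<tau> \<bullet> k))"
      by (rule sum.remove[OF finite_sub[OF KD] i(1)])
    finally have eq: "\<tau> \<bullet> ?\<theta> = - (\<omega> i \<bullet> ?\<theta>) + (\<Sum>k\<in>K - {i}. (\<omega> k \<bullet> ?\<theta>) * (\<tau> \<bullet> k))" using i by simp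
    have term_le: "(\<omega> k \<bullet> ?\<theta>) * (\<tau> \<bullet> k) \<le> 0" if "k \<in> K" for k
      using val[OF that] coeff1[OF that] by auto
    have le0: "(\<Sum>k\<in>K - {i}. (\<omega> k \<bullet> ?\<theta>) * (\<tau> \<bullet> k)) \<le> 0" by (rule sum_nonpos) (use term_le in blast)
    have one: "\<omega> i \<bullet> ?\<theta> = 1" and s0: "(\<Sum>k\<in>K - {i}. (\<omega> k \<bullet> ?\<theta>) * (\<tau> \<bullet> k)) = 0"
      using eq th le0 coeff1[OF i(1)] by linarith+
    have others: "\<tau> \<bullet> k = 0" if k: "k \<in> K" "k \<noteq> i" for k
    proof (rule ccontr)
      assume "\<tau> \<bullet> k \<noteq> 0"
      then have "(\<omega> k \<bullet> ?\<theta>) * (\<tau> \<bullet> k) < 0" using val[OF k(1)] coeff1[OF k(1)] by auto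
      moreover have "(\<Sum>k\<in>K - {i}. (\<omega> k \<bullet> ?\<theta>) * (\<tau> \<bullet> k)) =
          (\<omega> k \<bullet> ?\<theta>) * (\<tau> \<bullet> k) + (\<Sum>k\<in>K - {i} - {k}. (\<omega> k \<bullet> ?\<theta>) * (\<tau> \<bullet> k))"
        using k by (intro sum.remove finite_Diff finite_sub KD) auto
      moreover have "(\<Sum>k\<in>K - {i} - {k}. (\<omega> k \<bullet> ?\<theta>) * (\<tau> \<bullet> k)) \<le> 0" by (rule sum_nonpos) (use term_le in blast)
      ultimately show False using s0 by linarith
    qed
    have "(\<Sum>k\<in>K. (\<tau> \<bullet> k) *\<^sub>R \<omega> k) = (\<tau> \<bullet> i) *\<^sub>R \<omega> i + (\<Sum>k\<in>K - {i}. (\<tau> \<bullet> k) *\<^sub>R \<omega> k)"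
      by (rule sum.remove[OF finite_sub[OF KD] i(1)])
    also have "(\<Sum>k\<in>K - {i}. (\<tau> \<bullet> k) *\<^sub>R \<omega> k) = 0" using others by (intro sum.neutral) auto
    finally have "(\<Sum>k\<in>K. (\<tau> \<bullet> k) *\<^sub>R \<omega> k) = - node_coweight \<Delta> i" using i iD by (simp add: node_coweight_def)
    then show ?thesis using cominusculeI[OF KD ind i(1) one] by blast
  qed
  then obtain j where j: "\<And>K. K \<in> components J \<Longrightarrow> cominuscule \<Phi> K (j K)"
    "\<And>K. K \<in> components J \<Longrightarrow> (\<Sum>i\<in>K. (\<tau> \<bullet> i) *\<^sub>R \<omega> i) = - node_coweight \<Delta> (j K)" by metis
  have "\<forall>i\<in>\<Delta>. \<exists>n::int. \<tau> \<bullet> i = of_int n"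
    using coroot_lattice_pairing[OF t] simple_root by (meson Ints_cases)
  then obtain c :: "'a \<Rightarrow> int" where c: "\<And>i. i \<in> \<Delta> \<Longrightarrow> \<tau> \<bullet> i = of_int (c i)" by metis
  have "(\<Sum>i\<in>J. (\<tau> \<bullet> i) *\<^sub>R \<omega> i) = (\<Sum>i\<in>\<Union>(components J). (\<tau> \<bullet> i) *\<^sub>R \<omega> i)"
    by (simp add: Union_components[OF J])
  also have "\<dots> = (\<Sum>K\<in>components J. \<Sum>i\<in>K. (\<tau> \<bullet> i) *\<^sub>R \<omega> i)"
    using sum.Union_disjoint[of "components J"] component_disjoint[OF J] finite_sub component_sub_simple by force
  also have "\<dots> = - (\<Sum>K\<in>components J. node_coweight \<Delta> (j K))"
    unfolding sum_negf[symmetric] using j(2) by (intro sum.cong) auto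
  finally have sJ: "(\<Sum>i\<in>J. (\<tau> \<bullet> i) *\<^sub>R \<omega> i) = - (\<Sum>K\<in>components J. node_coweight \<Delta> (j K))" .
  have "\<tau> = (\<Sum>i\<in>\<Delta> - J. (\<tau> \<bullet> i) *\<^sub>R \<omega> i) + (\<Sum>i\<in>J. (\<tau> \<bullet> i) *\<^sub>R \<omega> i)"
    unfolding sum.subset_diff[OF J finite_simple, of "\<lambda>i. (\<tau> \<bullet> i) *\<^sub>R \<omega> i", symmetric] by (rule coweight_expansion)
  also have "(\<Sum>i\<in>\<Delta> - J. (\<tau> \<bullet> i) *\<^sub>R \<omega> i) = (\<Sum>i\<in>\<Delta> - J. of_int (c i) *\<^sub>R \<omega> i)"
    by (intro sum.cong) (auto simp: c)
  finally have "\<tau> = (\<Sum>i\<in>\<Delta> - J. of_int (c i) *\<^sub>R \<omega> i) - 0 - (\<Sum>K\<in>components J. node_coweight \<Delta> (j K))"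
    unfolding sJ by simp
  moreover have "(0::'a) \<in> coroot_lattice J" by (simp add: coroot_lattice_def int_span_zero)
  ultimately show ?thesis unfolding J_decomp_def using j(1) by blast
qed

lemma J_decomp_shift:
  assumes "J_decomp \<Phi> \<Delta> J (\<nu> + \<phi>) 0 j" "\<phi> \<in> coroot_lattice J" shows "J_decomp \<Phi> \<Delta> J \<nu> \<phi> j"
proof -
  obtain c :: "'a \<Rightarrow> int" where
    "\<nu> + \<phi> = (\<Sum>i\<in>\<Delta> - J. of_int (c i) *\<^sub>R \<omega> i) - 0 - (\<Sum>K\<in>components J. node_coweight \<Delta> (j K))"
    "\<forall>K\<in>components J. cominuscule \<Phi> K (j K)"
    using assms unfolding J_decomp_def by blast
  moreover from this(1) have "\<nu> = (\<Sum>i\<in>\<Delta> - J. of_int (c i) *\<^sub>R \<omega> i) - \<phi> - (\<Sum>K\<in>components J. node_coweight \<Delta> (j K))"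
    by (simp add: algebra_simps)
  ultimately show ?thesis using assms(2) unfolding J_decomp_def by blast
qed

text \<open>A form invariant under \<open>W\<close>, with integral values on \<open>Q\<^sup>\<or>\<close>, so that minima over cosets exist.\<close>

definition root_form :: "'a \<Rightarrow> 'a \<Rightarrow> real" where
  "root_form x y = (\<Sum>\<beta>\<in>\<Phi>. (x \<bullet> \<beta>) * (y \<bullet> \<beta>))"

lemma root_form_refl:
  assumes "\<gamma> \<in> \<Phi>" shows "root_form (root_refl \<gamma> x) (root_refl \<gamma> y) = root_form x y"
proof -
  have b: "bij_betw (root_refl \<gamma>) \<Phi> \<Phi>"
    by (rule bij_betwI[where g="root_refl \<gamma>"]) (auto simp: refl_root assms root_refl_root_refl)
  have "root_refl \<gamma> x \<bullet> root_refl \<gamma> \<beta> = x \<bullet> \<beta>" for x \<beta> by (rule inner_root_refl)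
  then show ?thesis
    unfolding root_form_def sum.reindex_bij_betw[OF b, of "\<lambda>\<beta>. (root_refl \<gamma> x \<bullet> \<beta>) * (root_refl \<gamma> y \<bullet> \<beta>)", symmetric]
    by simp
qed

lemma root_form_add_coroot:
  assumes g: "\<gamma> \<in> \<Phi>"
  shows "root_form (x + coroot \<gamma>) (x + coroot \<gamma>) =
    root_form x x + (x \<bullet> \<gamma> + 1) * root_form (coroot \<gamma>) (coroot \<gamma>)"
proof -
  let ?c = "coroot \<gamma>"
  have bil: "root_form (x + y) z = root_form x z + root_form y z" "root_form z (x + y) = root_form z x + root_form z y"
    "root_form (a *\<^sub>R x) z = a * root_form x z" "root_form z (a *\<^sub>R x) = a * root_form z x" for x y z a
    by (simp_all add: root_form_def inner_add_left algebra_simps sum.distrib sum_distrib_left)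
  have sym: "root_form x y = root_form y x" for x y by (simp add: root_form_def mult.commute)
  have nz: "\<gamma> \<noteq> 0" using g zero_notin_roots by blast
  have rc: "root_refl \<gamma> ?c = (- 1) *\<^sub>R ?c"
    using inner_coroot_self[OF nz] by (simp add: root_refl_coweight inner_commute scaleR_2)
  have rx: "root_refl \<gamma> x = x + (- (x \<bullet> \<gamma>)) *\<^sub>R ?c" by (simp add: root_refl_coweight)
  have "root_form x ?c = root_form (root_refl \<gamma> x) (root_refl \<gamma> ?c)" by (rule root_form_refl[OF g, symmetric])
  also have "\<dots> = - root_form x ?c + (x \<bullet> \<gamma>) * root_form ?c ?c"
    unfolding rx rc bil by (simp add: algebra_simps)
  finally have "2 * root_form x ?c = (x \<bullet> \<gamma>) * root_form ?c ?c" by simp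
  then show ?thesis unfolding bil sym[of ?c x] by (simp add: algebra_simps)
qed

lemma root_form_coroot_pos: assumes g: "\<gamma> \<in> \<Phi>" shows "0 < root_form (coroot \<gamma>) (coroot \<gamma>)"
  unfolding root_form_def
proof (rule sum_pos2[OF finite_root_set g])
  have "\<gamma> \<noteq> 0" using g zero_notin_roots by blast
  then show "0 < (coroot \<gamma> \<bullet> \<gamma>) * (coroot \<gamma> \<bullet> \<gamma>)" using inner_coroot_self[of \<gamma>] by (simp add: inner_commute)
qed simp

text \<open>
  Choose \<open>\<nu> + \<phi>\<close> minimal for the invariant form in its coset of \<open>Q\<^sub>J\<^sup>\<or>\<close>; by integrality a minimum
  exists. Adding \<open>\<gamma>\<^sup>\<or>\<close> changes the form by a positive multiple of \<open>\<langle>\<nu> + \<phi>, \<gamma>\<rangle> + 1\<close>, which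
  therefore cannot be negative.
\<close>

lemma minimal_coset_element:
  assumes n: "\<nu> \<in> coroot_lattice \<Delta>"
  shows "\<exists>\<phi>\<in>coroot_lattice J. \<forall>\<gamma>\<in>par_roots \<Phi> J. - 1 \<le> (\<nu> + \<phi>) \<bullet> \<gamma>"
proof -
  let ?q = "\<lambda>\<phi>. root_form (\<nu> + \<phi>) (\<nu> + \<phi>)"
  have lat: "\<nu> + \<phi> \<in> coroot_lattice \<Delta>" if "\<phi> \<in> coroot_lattice J" for \<phi>
    using that n coroot_lattice_mono[OF J order_refl] int_span_add unfolding coroot_lattice_def by blast
  have qint: "?q \<phi> \<in> \<int>" if "\<phi> \<in> coroot_lattice J" for \<phi>
    unfolding root_form_def using coroot_lattice_pairing[OF lat[OF that]] by (intro Ints_sum Ints_mult) auto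
  have q0: "0 \<le> ?q \<phi>" for \<phi> unfolding root_form_def by (rule sum_nonneg) simp
  have "0 \<in> coroot_lattice J" by (simp add: coroot_lattice_def int_span_zero)
  then obtain \<phi> where f: "\<phi> \<in> coroot_lattice J"
    "\<And>\<psi>. \<psi> \<in> coroot_lattice J \<Longrightarrow> nat \<lfloor>?q \<phi>\<rfloor> \<le> nat \<lfloor>?q \<psi>\<rfloor>"
    using ex_has_least_nat[of "\<lambda>\<phi>. \<phi> \<in> coroot_lattice J" 0 "\<lambda>\<phi>. nat \<lfloor>?q \<phi>\<rfloor>"] by blast
  have min: "?q \<phi> \<le> ?q \<psi>" if p: "\<psi> \<in> coroot_lattice J" for \<psi>
  proof -
    have "\<lfloor>?q \<phi>\<rfloor> \<le> \<lfloor>?q \<psi>\<rfloor>" using f(2)[OF p] q0[of \<psi>] q0[of \<phi>] by (simp add: nat_le_eq_zle)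
    then have "of_int \<lfloor>?q \<phi>\<rfloor> \<le> (of_int \<lfloor>?q \<psi>\<rfloor> :: real)" by simp
    then show ?thesis using qint[OF f(1)] qint[OF p] by (simp add: of_int_floor)
  qed
  have "- 1 \<le> (\<nu> + \<phi>) \<bullet> \<gamma>" if g: "\<gamma> \<in> par_roots \<Phi> J" for \<gamma>
  proof -
    have gP: "\<gamma> \<in> \<Phi>" using g by (simp add: par_root_iff[OF J])
    have "\<phi> + coroot \<gamma> \<in> coroot_lattice J"
      using f(1) coroot_in_lattice[OF J g] int_span_add unfolding coroot_lattice_def by blast
    from min[OF this] have "0 \<le> ((\<nu> + \<phi>) \<bullet> \<gamma> + 1) * root_form (coroot \<gamma>) (coroot \<gamma>)"
      using root_form_add_coroot[OF gP, of "\<nu> + \<phi>"] by (simp add: add.assoc)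
    then show ?thesis using root_form_coroot_pos[OF gP] by (simp add: zero_le_mult_iff)
  qed
  then show ?thesis using f(1) by blast
qed

text \<open>
  Choose \<open>g\<close> such that \<open>g \<tau>\<close> pairs positively with as few roots of \<open>\<Phi>\<^sub>J\<^sup>+\<close> as possible. If one of
  them were a simple root \<open>i\<close>, applying \<open>r\<^sub>i\<close> would remove it and permute the others.
\<close>

lemma antidominant_conjugate:
  "\<exists>g\<in>weyl J. \<forall>i\<in>J. g \<tau> \<bullet> i \<le> 0"
proof -
  let ?A = "\<lambda>g. {\<beta> \<in> PJ J. 0 < g \<tau> \<bullet> \<beta>}"
  have fin: "finite (?A g)" for g using finite_pos by (simp add: par_pos_roots_def)
  obtain g where g: "g \<in> weyl J" "\<And>h. h \<in> weyl J \<Longrightarrow> card (?A g) \<le> card (?A h)"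
    using ex_has_least_nat[of "\<lambda>g. g \<in> weyl J" id "\<lambda>g. card (?A g)"] id_in_weyl by blast
  have "g \<tau> \<bullet> i \<le> 0" if i: "i \<in> J" for i
  proof (rule ccontr)
    assume pos: "\<not> g \<tau> \<bullet> i \<le> 0"
    have iD: "i \<in> \<Delta>" using i J by blast
    let ?h = "root_refl i \<circ> g"
    have h: "?h \<in> weyl J" using weyl_comp[OF root_refl_in_weyl_simple[OF i] g(1)] .
    have pair: "?h \<tau> \<bullet> \<beta> = g \<tau> \<bullet> root_refl i \<beta>" for \<beta>
      using inner_root_refl[of i "g \<tau>" "root_refl i \<beta>"] by (simp add: root_refl_root_refl)
    have iA: "i \<in> ?A g" using pos simple_par_pos[OF J i] by simp
    have "root_refl i ` ?A ?h \<subseteq> ?A g - {i}"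
    proof clarify
      fix \<beta> assume b: "\<beta> \<in> PJ J" "0 < ?h \<tau> \<bullet> \<beta>"
      have ne: "\<beta> \<noteq> i" using b(2) pos pair[of i] by (auto simp: root_refl_self)
      have "\<beta> \<in> P" using b(1) by (simp add: par_pos_roots_def)
      then have "root_refl i \<beta> \<in> P" using simple_refl_pos[OF iD] ne by blast
      moreover have "root_refl i \<beta> \<in> par_roots \<Phi> J"
        using weyl_par_root[OF root_refl_in_weyl_simple[OF i] J] b(1) by (simp add: par_pos_roots_def)
      ultimately have r: "root_refl i \<beta> \<in> PJ J" by (simp add: par_pos_roots_def)
      have "root_refl i \<beta> \<noteq> i"
      proof
        assume "root_refl i \<beta> = i"
        then have "\<beta> = - i" by (metis root_refl_root_refl root_refl_self)
        then show False using \<open>\<beta> \<in> P\<close> simple_pos_root[OF iD] uminus_notin_pos by blast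
      qed
      then show "root_refl i \<beta> \<in> ?A g - {i}" using r b(2) pair by simp
    qed
    then have "card (root_refl i ` ?A ?h) \<le> card (?A g - {i})" by (rule card_mono[rotated]) (use fin in blast)
    moreover have "card (root_refl i ` ?A ?h) = card (?A ?h)"
      by (rule card_image) (metis (no_types, lifting) inj_onI root_refl_root_refl)
    moreover have "card (?A g - {i}) < card (?A g)" by (rule card_Diff1_less[OF fin[of g] iA])
    ultimately show False using g(2)[OF h] by linarith
  qed
  then show ?thesis using g(1) by blast
qed

text \<open>
  Minimality bounds the pairings with all of \<open>\<Phi>\<^sub>J\<close> by \<open>1\<close> in absolute value, and this survives the
  passage to the antidominant conjugate, which stays in the same coset of \<open>Q\<^sub>J\<^sup>\<or>\<close>.
\<close>

lemma minuscule_shift_exists: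
  assumes n: "\<nu> \<in> coroot_lattice \<Delta>"
  shows "\<exists>\<phi>\<in>coroot_lattice J. minuscule_on J (\<nu> + \<phi>)"
proof -
  obtain \<phi> where f: "\<phi> \<in> coroot_lattice J" "\<And>\<gamma>. \<gamma> \<in> par_roots \<Phi> J \<Longrightarrow> - 1 \<le> (\<nu> + \<phi>) \<bullet> \<gamma>"
    using minimal_coset_element[OF n] by blast
  let ?\<tau> = "\<nu> + \<phi>"
  have lat: "?\<tau> \<in> coroot_lattice \<Delta>"
    using f(1) n coroot_lattice_mono[OF J order_refl] int_span_add unfolding coroot_lattice_def by blast
  obtain g where g: "g \<in> weyl J" "\<And>i. i \<in> J \<Longrightarrow> g ?\<tau> \<bullet> i \<le> 0" using antidominant_conjugate by blast
  have "minuscule_on J (g ?\<tau>)"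
    unfolding minuscule_on_def
  proof
    fix \<beta> assume b: "\<beta> \<in> PJ J"
    then have bJ: "\<beta> \<in> par_roots \<Phi> J" "\<beta> \<in> P" by (auto simp: par_pos_roots_def)
    have "g ?\<tau> \<bullet> \<beta> = (\<Sum>i\<in>J. (\<omega> i \<bullet> \<beta>) * (g ?\<tau> \<bullet> i))" by (rule pairing_expansion_par[OF J bJ(1)])
    also have "\<dots> \<le> 0"
      using bJ(2) J g(2) by (intro sum_nonpos mult_nonneg_nonpos) (auto simp: pos_root_iff)
    finally have le: "g ?\<tau> \<bullet> \<beta> \<le> 0" .
    have eq: "g ?\<tau> \<bullet> \<beta> = ?\<tau> \<bullet> inv g \<beta>"
      using weyl_inner_inv[OF g(1), of \<beta> ?\<tau>] by (metis inner_commute)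
    have ig: "inv g \<beta> \<in> par_roots \<Phi> J" by (rule weyl_par_root[OF weyl_inv[OF g(1)] J bJ(1)])
    have ge: "- 1 \<le> g ?\<tau> \<bullet> \<beta>" unfolding eq by (rule f(2)[OF ig])
    have "g ?\<tau> \<bullet> \<beta> \<in> \<int>" unfolding eq
      by (rule coroot_lattice_pairing[OF lat]) (use ig in \<open>simp add: par_root_iff[OF J]\<close>)
    then obtain k where k: "g ?\<tau> \<bullet> \<beta> = of_int k" by (rule Ints_cases)
    then have "k = 0 \<or> k = - 1" using le ge by simp linarith
    then show "g ?\<tau> \<bullet> \<beta> = 0 \<or> g ?\<tau> \<bullet> \<beta> = - 1" using k by auto
  qed
  moreover have "g ?\<tau> = \<nu> + (\<phi> + (g ?\<tau> - ?\<tau>))" by simp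
  moreover have "\<phi> + (g ?\<tau> - ?\<tau>) \<in> coroot_lattice J"
    using weyl_diff_coroot_lattice[OF g(1) J lat] f(1) int_span_add unfolding coroot_lattice_def by blast
  ultimately show ?thesis by metis
qed

lemma J_decomp_exists:
  assumes n: "\<nu> \<in> coroot_lattice \<Delta>" shows "\<exists>\<phi> j. J_decomp \<Phi> \<Delta> J \<nu> \<phi> j"
proof -
  obtain \<phi> where f: "\<phi> \<in> coroot_lattice J" "minuscule_on J (\<nu> + \<phi>)" using minuscule_shift_exists[OF n] by blast
  have "\<nu> + \<phi> \<in> coroot_lattice \<Delta>"
    using f(1) n coroot_lattice_mono[OF J order_refl] int_span_add unfolding coroot_lattice_def by blast
  then show ?thesis using J_decomp_minuscule_exists f J_decomp_shift by blast
qed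

lemma phi_J_eq:
  assumes "J_decomp \<Phi> \<Delta> J \<nu> \<phi> j" shows "phi_J \<Phi> \<Delta> J \<nu> = \<phi>"
  unfolding phi_J_def using assms J_decomp_unique by (intro the_equality) blast+

text \<open>
  By existence and uniqueness of the decomposition, \<open>\<phi>\<^sub>J(\<mu>) = 0\<close> says that \<open>\<mu>\<close> itself is the
  minuscule element of its coset of \<open>Q\<^sub>J\<^sup>\<or>\<close>.
\<close>

lemma J_adjusted_iff:
  "J_adjusted \<Phi> \<Delta> J \<mu> \<longleftrightarrow> \<mu> \<in> coroot_lattice \<Delta> \<and> minuscule_on J \<mu>"
proof
  assume a: "J_adjusted \<Phi> \<Delta> J \<mu>"
  then have m: "\<mu> \<in> coroot_lattice \<Delta>" "phi_J \<Phi> \<Delta> J \<mu> = 0" by (auto simp: J_adjusted_def)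
  then obtain \<phi> j where d: "J_decomp \<Phi> \<Delta> J \<mu> \<phi> j" using J_decomp_exists by blast
  then have "\<phi> = 0" using phi_J_eq m by blast
  then show "\<mu> \<in> coroot_lattice \<Delta> \<and> minuscule_on J \<mu>" using J_decomp_minuscule[OF d] m by simp
next
  assume m: "\<mu> \<in> coroot_lattice \<Delta> \<and> minuscule_on J \<mu>"
  then obtain j where "J_decomp \<Phi> \<Delta> J \<mu> 0 j" using J_decomp_minuscule_exists by blast
  then show "J_adjusted \<Phi> \<Delta> J \<mu>" using m phi_J_eq by (simp add: J_adjusted_def)
qed

lemma z_elem_eq:
  assumes "J_decomp \<Phi> \<Delta> J \<nu> \<phi> j" "straightens J z (\<nu> + \<phi>)" shows "z_elem \<Phi> \<Delta> J \<nu> = z"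
  unfolding z_elem_def
proof (rule the_equality)
  show "\<exists>\<phi> j. J_decomp \<Phi> \<Delta> J \<nu> \<phi> j \<and> z = z_prod j (components J)"
    using assms straightens_unique z_prod_straightens by blast
  fix z' assume "\<exists>\<phi> j. J_decomp \<Phi> \<Delta> J \<nu> \<phi> j \<and> z' = z_prod j (components J)"
  then obtain \<phi>' j' where d: "J_decomp \<Phi> \<Delta> J \<nu> \<phi>' j'" "z' = z_prod j' (components J)" by blast
  then have "straightens J z' (\<nu> + \<phi>)" using z_prod_straightens[OF d(1)] J_decomp_unique[OF assms(1) d(1)] by simp
  then show "z' = z" using straightens_unique assms(2) by blast
qed

lemma z_elem_straightens:
  assumes "J_adjusted \<Phi> \<Delta> J \<mu>" shows "straightens J (z_elem \<Phi> \<Delta> J \<mu>) \<mu>"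
proof -
  obtain j where j: "J_decomp \<Phi> \<Delta> J \<mu> 0 j" using assms J_adjusted_iff J_decomp_minuscule_exists by blast
  have s: "straightens J (z_prod j (components J)) (\<mu> + 0)" by (rule z_prod_straightens[OF j])
  then show ?thesis using z_elem_eq[OF j s] by simp
qed

lemma z_elem_adjusted_eq:
  assumes "J_adjusted \<Phi> \<Delta> J \<mu>" "straightens J z \<mu>" shows "z_elem \<Phi> \<Delta> J \<mu> = z"
  using straightens_unique[OF z_elem_straightens[OF assms(1)] assms(2)] .

end

end

section \<open>The affine Weyl group\<close>

text \<open>The action of an affine transformation \<open>w t\<^sub>\<mu>\<close> on affine roots: \<open>\<alpha> + n\<delta>\<close> goes to
  \<open>w\<alpha> + (n - \<langle>\<mu>, \<alpha>\<rangle>)\<delta>\<close>. It is written in terms of the transformation alone.\<close>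

definition affine_act :: "('a::euclidean_space \<Rightarrow> 'a) \<Rightarrow> 'a \<times> real \<Rightarrow> 'a \<times> real" where
  "affine_act x a = (x (fst a) - x 0, snd a - x 0 \<bullet> (x (fst a) - x 0))"

lemma affine_act_eq:
  assumes "w \<in> weyl K" shows "affine_act (w \<circ> transl \<mu>) (\<alpha>, n) = (w \<alpha>, n - \<mu> \<bullet> \<alpha>)"
  using weyl_inner[OF assms, of \<mu> \<alpha>] linear_add[OF linear_weyl[OF assms]]
  by (simp add: affine_act_def transl_def inner_diff_left)

lemma transl_comp: "transl \<mu> \<circ> transl \<nu> = transl (\<mu> + \<nu>)"
  by (simp add: fun_eq_iff transl_def)

lemma transl_weyl: assumes "u \<in> weyl K" shows "transl \<mu> \<circ> u = u \<circ> transl (inv u \<mu>)"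
  by (simp add: fun_eq_iff transl_def linear_add[OF linear_weyl[OF assms]] weyl_inv_right[OF assms])

lemma transl_comp_affine_refl:
  assumes "w \<in> weyl K"
  shows "w \<circ> transl \<mu> \<circ> affine_refl (\<beta>, n) =
    w \<circ> root_refl \<beta> \<circ> transl (\<mu> + (n - \<mu> \<bullet> \<beta>) *\<^sub>R coroot \<beta>)"
proof
  fix v
  have l: "root_refl \<beta> (u + u') = root_refl \<beta> u + root_refl \<beta> u'" for u u'
    using linear_add[OF linear_root_refl] .
  have "root_refl \<beta> (\<mu> + (n - \<mu> \<bullet> \<beta>) *\<^sub>R coroot \<beta>) = root_refl \<beta> (n *\<^sub>R coroot \<beta>) + \<mu>"
  proof -
    have "root_refl \<beta> \<mu> = \<mu> - (\<mu> \<bullet> \<beta>) *\<^sub>R coroot \<beta>" by (rule root_refl_coweight)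
    moreover have c: "root_refl \<beta> (k *\<^sub>R coroot \<beta>) = - k *\<^sub>R coroot \<beta>" for k
    proof -
      have "root_refl \<beta> (coroot \<beta>) = coroot (root_refl \<beta> \<beta>)"
        by (rule coroot_orthogonal[OF orthogonal_root_refl, symmetric])
      then have "root_refl \<beta> (coroot \<beta>) = - coroot \<beta>" by (simp add: root_refl_self coroot_uminus)
      then show ?thesis using linear_scale[OF linear_root_refl[of \<beta>], of k "coroot \<beta>"] by simp
    qed
    ultimately show ?thesis by (simp only: l c) (simp add: scaleR_left_diff_distrib)
  qed
  then show "(w \<circ> transl \<mu> \<circ> affine_refl (\<beta>, n)) v =
    (w \<circ> root_refl \<beta> \<circ> transl (\<mu> + (n - \<mu> \<bullet> \<beta>) *\<^sub>R coroot \<beta>)) v"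
    by (simp add: affine_refl_def transl_def l add.assoc)
qed

lemma affine_refl_uminus: "affine_refl (- a) = affine_refl a"
  by (simp add: affine_refl_def root_refl_uminus coroot_uminus)

locale irreducible_roots = finite_roots +
  assumes irreducible: "irreducible_root_system \<Phi>"
begin

lemma indecomposable_simple: "indecomposable \<Delta>"
proof -
  obtain \<beta> where "\<beta> \<in> \<Phi>" using irreducible by (auto simp: irreducible_root_system_def)
  then obtain i where "i \<in> \<Delta>" using root_coeff_nonzero by blast
  then obtain K where K: "K \<in> components \<Delta>" "i \<in> K" using Union_components[OF order_refl] by blast
  have KD: "K \<subseteq> \<Delta>" by (rule component_subset[OF order_refl K(1)])
  have "K = \<Delta>"
  proof (rule ccontr)
    assume "K \<noteq> \<Delta>"
    then obtain k where k: "k \<in> \<Delta>" "k \<notin> K" using KD by blast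
    let ?A = "par_roots \<Phi> K" and ?B = "\<Phi> - par_roots \<Phi> K"
    have A: "i \<in> ?A" using simple_par_pos[OF KD K(2)] by (simp add: par_pos_roots_def)
    have B: "k \<in> ?B" using k by (auto simp: par_root_iff[OF KD] simple_root fund_coweight_pairing)
    have AB: "?A \<union> ?B = \<Phi>" by (auto simp: par_roots_def)
    have orth: "a \<bullet> b = 0" if a: "a \<in> ?A" and b: "b \<in> P" "b \<notin> ?A" for a b
    proof -
      have "b \<in> PJ \<Delta>" using b by (simp add: par_pos_iff[OF order_refl])
      then obtain L where L: "L \<in> components \<Delta>" "b \<in> PJ L" using root_in_component[OF order_refl] by blast
      have ne: "K \<noteq> L" using L b by (auto simp: par_pos_roots_def)
      have LD: "L \<subseteq> \<Delta>" by (rule component_subset[OF order_refl L(1)])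
      have bL: "b \<in> par_roots \<Phi> L" using L by (simp add: par_pos_roots_def)
      have "a \<bullet> b = (\<Sum>i\<in>L. (\<omega> i \<bullet> b) * (a \<bullet> i))" by (rule pairing_expansion_par[OF LD bL])
      also have "\<dots> = 0"
        using inner_component_zero[OF order_refl K(1) L(1) ne _ a] by (intro sum.neutral) simp
      finally show ?thesis .
    qed
    have orth': "a \<bullet> b = 0" if a: "a \<in> ?A" and b: "b \<in> ?B" for a b
    proof (cases "b \<in> P")
      case False
      then have "- b \<in> P" using b pos_or_neg by blast
      moreover have "- b \<notin> ?A" using b by (auto simp: par_root_iff[OF KD])
      ultimately have "a \<bullet> (- b) = 0" using orth[OF a] by blast
      then show ?thesis by simp
    qed (use orth[OF a] b in blast)
    have "?A \<noteq> {} \<and> ?B \<noteq> {} \<and> ?A \<inter> ?B = {} \<and> ?A \<union> ?B = \<Phi> \<and> (\<forall>a\<in>?A. \<forall>b\<in>?B. a \<bullet> b = 0)"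
      by (intro conjI ballI) (use A B AB orth' in blast)+
    then have "\<exists>A B. A \<noteq> {} \<and> B \<noteq> {} \<and> A \<inter> B = {} \<and> A \<union> B = \<Phi> \<and> (\<forall>a\<in>A. \<forall>b\<in>B. a \<bullet> b = 0)"
      by (intro exI)
    then show False using irreducible unfolding irreducible_root_system_def by (elim conjE notE)
  qed
  then show ?thesis using component_indecomposable[OF order_refl K(1)] by simp
qed

abbreviation "\<theta> \<equiv> highest_root \<Phi> \<Delta>"

lemma highest_root_pos: "\<theta> \<in> P"
  using highest_root(1)[OF order_refl indecomposable_simple] by (simp add: par_pos_roots_def)

lemma highest_root_above: "\<beta> \<in> \<Phi> \<Longrightarrow> \<theta> - \<beta> \<in> nat_span \<Delta>"
  using highest_root(2)[OF order_refl indecomposable_simple] par_roots_simple by simp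

lemma maximal_highest_root: "maximal_root \<Delta> \<theta>"
  unfolding maximal_root_def par_roots_simple
proof (intro conjI ballI impI)
  show "\<theta> \<in> \<Phi>" using highest_root_pos pos_root by blast
  fix \<delta> assume d: "\<delta> \<in> \<Phi>" "\<delta> - \<theta> \<in> nat_span \<Delta>"
  have "- (\<delta> - \<theta>) \<in> nat_span \<Delta>" using highest_root_above[OF d(1)] by simp
  then have "\<delta> - \<theta> = 0" using nat_span_antisym[OF order_refl d(2)] by blast
  then show "\<delta> = \<theta>" by simp
qed

lemma highest_root_pairing_nonneg: assumes "\<beta> \<in> P" shows "0 \<le> coroot \<theta> \<bullet> \<beta>"
proof -
  have "\<beta> \<in> par_roots \<Phi> \<Delta>" using assms pos_root par_roots_simple by simp
  then have "\<theta> \<bullet> \<beta> = (\<Sum>i\<in>\<Delta>. (\<omega> i \<bullet> \<beta>) * (\<theta> \<bullet> i))" by (rule pairing_expansion_par[OF order_refl])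
  also have "\<dots> \<ge> 0"
    using assms maximal_root_dominant[OF order_refl maximal_highest_root]
    by (intro sum_nonneg mult_nonneg_nonneg) (auto simp: pos_root_iff)
  finally show ?thesis by (simp add: coroot_def)
qed

text \<open>
  If \<open>c = \<langle>\<theta>\<^sup>\<or>, \<beta>\<rangle> \<ge> 2\<close>, then the root \<open>-r\<^sub>\<theta>\<beta> = c\<theta> - \<beta>\<close> lies below \<open>\<theta>\<close>, so
  \<open>(\<theta> - \<beta>) + (c - 2)\<theta>\<close> has nonpositive coefficients, although both summands have nonnegative
  ones; this leaves only \<open>\<beta> = \<theta>\<close>.
\<close>

lemma highest_root_pairing_le_one:
  assumes b: "\<beta> \<in> \<Phi>" "\<beta> \<noteq> \<theta>" shows "coroot \<theta> \<bullet> \<beta> \<le> 1"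
proof (rule ccontr)
  assume n: "\<not> ?thesis"
  have t: "\<theta> \<in> \<Phi>" using highest_root_pos pos_root by blast
  obtain k where k: "coroot \<theta> \<bullet> \<beta> = of_int k" using coroot_root_int[OF t b(1)] by (rule Ints_cases)
  then have k2: "2 \<le> k" using n by simp
  have "root_refl \<theta> \<beta> \<in> \<Phi>" by (rule refl_root[OF t b(1)])
  then have "\<theta> + root_refl \<theta> \<beta> \<in> nat_span \<Delta>" using highest_root_above uminus_root by fastforce
  moreover have "\<theta> + root_refl \<theta> \<beta> = - ((\<theta> - \<beta>) + of_int (k - 2) *\<^sub>R \<theta>)"
    using k by (simp add: root_refl_def inner_commute scaleR_left_diff_distrib scaleR_2)
  ultimately have neg: "- ((\<theta> - \<beta>) + of_int (k - 2) *\<^sub>R \<theta>) \<in> nat_span \<Delta>" by simp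
  have tn: "of_int (k - 2) *\<^sub>R \<theta> \<in> nat_span \<Delta>"
  proof -
    have "\<theta> \<in> nat_span \<Delta>" using highest_root_pos by (simp add: pos_roots_def)
    moreover have "of_int (k - 2) \<in> (\<nat> :: real set)" using k2 by (simp add: Nats_altdef2 del: of_int_diff)
    ultimately show ?thesis by (auto simp: nat_span_iff[OF order_refl] intro: Nats_mult)
  qed
  have sum: "(\<theta> - \<beta>) + of_int (k - 2) *\<^sub>R \<theta> = 0"
    by (rule nat_span_antisym[OF order_refl nat_span_add[OF order_refl highest_root_above[OF b(1)] tn] neg])
  then have "- (\<theta> - \<beta>) = of_int (k - 2) *\<^sub>R \<theta>" by (metis minus_unique)
  then have "- (\<theta> - \<beta>) \<in> nat_span \<Delta>" using tn by simp
  then have "\<theta> - \<beta> = 0" using nat_span_antisym[OF order_refl highest_root_above[OF b(1)]] by blast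
  then show False using b by simp
qed

abbreviation "Waf \<equiv> affine_weyl \<Delta>"
abbreviation "AP \<equiv> affine_pos_roots \<Phi> \<Delta>"

definition affine_simple :: "('a \<times> real) set" where
  "affine_simple = insert (- \<theta>, 1) ((\<lambda>i. (i, 0)) ` \<Delta>)"

lemma affine_pos_iff: "(\<beta>, n) \<in> AP \<longleftrightarrow> n = 0 \<and> \<beta> \<in> P \<or> \<beta> \<in> \<Phi> \<and> n \<in> \<int> \<and> 0 < n"
  by (auto simp: affine_pos_roots_def)

lemma affine_pos_or_neg: "\<beta> \<in> \<Phi> \<Longrightarrow> n \<in> \<int> \<Longrightarrow> (\<beta>, n) \<in> AP \<or> - (\<beta>, n) \<in> AP"
  using pos_or_neg uminus_root by (auto simp: affine_pos_iff)

lemma affine_weyl_cases: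
  assumes "x \<in> Waf" obtains w \<mu> where "w \<in> weyl \<Delta>" "\<mu> \<in> coroot_lattice \<Delta>" "x = w \<circ> transl \<mu>"
  using assms unfolding affine_weyl_def by blast

lemma affine_weylI: "w \<in> weyl \<Delta> \<Longrightarrow> \<mu> \<in> coroot_lattice \<Delta> \<Longrightarrow> w \<circ> transl \<mu> \<in> Waf"
  unfolding affine_weyl_def by blast

lemma affine_weyl_comp_eq:
  assumes "u \<in> weyl \<Delta>" shows "(w \<circ> transl \<mu>) \<circ> (u \<circ> transl \<nu>) = (w \<circ> u) \<circ> transl (inv u \<mu> + \<nu>)"
proof -
  have "(w \<circ> transl \<mu>) \<circ> (u \<circ> transl \<nu>) = w \<circ> (transl \<mu> \<circ> u) \<circ> transl \<nu>" by (simp only: comp_assoc)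
  also have "\<dots> = (w \<circ> u) \<circ> (transl (inv u \<mu>) \<circ> transl \<nu>)" by (simp only: transl_weyl[OF assms] comp_assoc)
  finally show ?thesis by (simp only: transl_comp)
qed

lemma bij_transl: "bij (transl \<mu>)"
  by (rule o_bij[of "transl (- \<mu>)"]) (simp_all add: fun_eq_iff transl_def)

lemma bij_affine_weyl: "x \<in> Waf \<Longrightarrow> bij x"
  by (erule affine_weyl_cases) (simp only: bij_comp bij_transl bij_weyl)

text \<open>
  For the affine simple root \<open>-\<theta> + \<delta>\<close> the reflection sends \<open>\<beta> + m\<delta>\<close> to
  \<open>r\<^sub>\<theta>\<beta> + (m + \<langle>\<theta>\<^sup>\<or>, \<beta>\<rangle>)\<delta>\<close>, and \<open>\<langle>\<theta>\<^sup>\<or>, \<beta>\<rangle>\<close> is nonnegative for positive \<open>\<beta>\<close> and at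
  least \<open>-1\<close> for negative \<open>\<beta> \<noteq> -\<theta>\<close>.
\<close>

lemma affine_act_simple:
  assumes d: "d \<in> affine_simple" and a: "a \<in> AP" "a \<noteq> d"
  shows "affine_act (affine_refl d) a \<in> AP"
proof -
  obtain \<beta> m where bm: "a = (\<beta>, m)" by (cases a)
  have b: "\<beta> \<in> \<Phi>" "m \<in> \<int>" using a pos_root unfolding bm affine_pos_iff by auto
  have rin: "root_refl (fst d) \<in> weyl \<Delta>"
    using d highest_root_pos pos_root root_refl_in_weyl_full simple_root
    by (auto simp: affine_simple_def root_refl_uminus)
  have act: "affine_act (affine_refl d) a = (root_refl (fst d) \<beta>, m - snd d * (coroot (fst d) \<bullet> \<beta>))"
    unfolding bm affine_refl_def affine_act_eq[OF rin] by simp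
  show ?thesis
  proof (cases "d = (- \<theta>, 1)")
    case False
    then obtain i where i: "d = (i, 0)" "i \<in> \<Delta>" using d by (auto simp: affine_simple_def)
    show ?thesis unfolding act using a i bm b simple_refl_pos[OF i(2)] refl_root[OF simple_root[OF i(2)]]
      by (auto simp: affine_pos_iff)
  next
    case True
    let ?c = "coroot \<theta> \<bullet> \<beta>"
    have tP: "\<theta> \<in> \<Phi>" using highest_root_pos pos_root by blast
    have r: "root_refl \<theta> \<beta> \<in> \<Phi>" by (rule refl_root[OF tP b(1)])
    have cint: "?c \<in> \<int>" by (rule coroot_root_int[OF tP b(1)])
    have act': "affine_act (affine_refl d) a = (root_refl \<theta> \<beta>, m + ?c)"
      unfolding act by (simp add: True root_refl_uminus coroot_uminus)
    have int: "m + ?c \<in> \<int>" using b cint by simp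
    have refl: "root_refl \<theta> \<beta> = \<beta> - ?c *\<^sub>R \<theta>" by (simp add: root_refl_def inner_commute)
    have one: "1 \<le> m" if "0 < m" using that b(2) by (auto elim!: Ints_cases)
    consider "\<beta> \<in> P" | "- \<beta> \<in> P" "\<beta> = - \<theta>" | "- \<beta> \<in> P" "\<beta> \<noteq> - \<theta>" using pos_or_neg[OF b(1)] by blast
    then show ?thesis
    proof cases
      case 1
      then have c0: "0 \<le> ?c" by (rule highest_root_pairing_nonneg)
      have m0: "0 \<le> m" using a bm by (auto simp: affine_pos_iff)
      show ?thesis
      proof (cases "m + ?c = 0")
        case True
        then have "m = 0" "?c = 0" using c0 m0 by auto
        then show ?thesis unfolding act' using 1 refl by (simp add: affine_pos_iff)
      next
        case False
        then have "0 < m + ?c" using c0 m0 by simp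
        then show ?thesis unfolding act' using r int by (simp add: affine_pos_iff)
      qed
    next
      case 2
      have "0 < m" using a bm 2 uminus_notin_pos by (fastforce simp: affine_pos_iff)
      have "m \<noteq> 1" using a bm 2 True by blast
      have "\<theta> \<noteq> 0" using tP zero_notin_roots by metis
      then have c: "?c = - 2" using 2 inner_coroot_self[of \<theta>] by (simp add: inner_commute)
      obtain k where k: "m = of_int k" using b(2) by (rule Ints_cases)
      have "2 \<le> k" using k \<open>0 < m\<close> \<open>m \<noteq> 1\<close> by simp
      moreover have "root_refl \<theta> \<beta> = \<theta>" using 2 c refl by (simp add: scaleR_2)
      ultimately show ?thesis unfolding act' using r int c k highest_root_pos
        by (cases "k = 2") (auto simp: affine_pos_iff)
    next
      case 3
      have "0 < m" using a bm 3 uminus_notin_pos[of "- \<beta>"] by (auto simp: affine_pos_iff)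
      then have m1: "1 \<le> m" by (rule one)
      have ne: "- \<beta> \<noteq> \<theta>" using 3(2) by (metis minus_minus)
      have c: "- 1 \<le> ?c" using highest_root_pairing_le_one[OF pos_root[OF 3(1)] ne] by simp
      show ?thesis
      proof (cases "m + ?c = 0")
        case True
        then have "?c = - 1" using m1 c by simp
        then have e: "root_refl \<theta> \<beta> = \<theta> - (- \<beta>)" using refl by simp
        have "\<theta> - (- \<beta>) \<in> nat_span \<Delta>" by (rule highest_root_above[OF pos_root[OF 3(1)]])
        then have "root_refl \<theta> \<beta> \<in> P" using r unfolding e by (simp add: pos_roots_def)
        then show ?thesis unfolding act' True by (simp add: affine_pos_iff)
      next
        case False
        then have "0 < m + ?c" using c m1 by simp
        then show ?thesis unfolding act' using r int by (simp add: affine_pos_iff)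
      qed
    qed
  qed
qed

text \<open>
  Positivity on the affine simple roots gives \<open>-1 \<le> \<langle>\<mu>, \<theta>\<rangle> \<le> \<langle>\<mu>, \<beta>\<rangle> \<le> 0\<close> for \<open>\<beta> \<in> \<Phi>\<^sup>+\<close>, so
  \<open>\<mu> = 0\<close> by \<open>small_pairing_zero\<close>; and then \<open>w\<close> keeps the simple roots positive.
\<close>

lemma affine_trivial:
  assumes x: "x \<in> Waf" and pos: "\<And>d. d \<in> affine_simple \<Longrightarrow> affine_act x d \<in> AP"
  shows "x = id"
proof -
  obtain w \<mu> where w: "w \<in> weyl \<Delta>" and m: "\<mu> \<in> coroot_lattice \<Delta>" and xe: "x = w \<circ> transl \<mu>"
    using x by (rule affine_weyl_cases)
  have i: "\<mu> \<bullet> i \<le> 0" "\<mu> \<bullet> i = 0 \<Longrightarrow> w i \<in> P" if "i \<in> \<Delta>" for i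
    using pos[of "(i, 0)"] that unfolding xe affine_act_eq[OF w] by (auto simp: affine_simple_def affine_pos_iff)
  have np: "\<mu> \<bullet> \<beta> \<le> 0" if "\<beta> \<in> nat_span \<Delta>" for \<beta>
    unfolding pairing_expansion[of \<mu> \<beta>]
    using that i(1) Nats_nonneg by (intro sum_nonpos mult_nonneg_nonpos) (auto simp: nat_span_iff[OF order_refl])
  have "- 1 \<le> \<mu> \<bullet> \<theta>"
    using pos[of "(- \<theta>, 1)"] unfolding xe affine_act_eq[OF w] by (auto simp: affine_simple_def affine_pos_iff)
  then have "- (\<mu> \<bullet> \<beta>) \<le> 1" if "\<beta> \<in> \<Phi>" for \<beta>
    using np[OF highest_root_above[OF that]] by (simp add: inner_diff_right)
  then have "\<mu> \<bullet> \<beta> \<le> 1" if "\<beta> \<in> par_roots \<Phi> \<Delta>" for \<beta>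
    using that uminus_root[of \<beta>] unfolding par_roots_simple by fastforce
  then have "\<mu> = 0" using small_pairing_zero[OF order_refl m] by blast
  moreover from this have "w = id" using i weyl_trivial[OF w] by simp
  ultimately show ?thesis unfolding xe by (simp add: fun_eq_iff transl_def)
qed

sublocale affine: reflection_group Waf affine_act AP affine_simple uminus affine_refl
proof
  show "id \<in> Waf"
  proof -
    have "id = id \<circ> transl 0" by (simp add: fun_eq_iff transl_def)
    moreover have "0 \<in> coroot_lattice \<Delta>" by (simp add: coroot_lattice_def int_span_zero)
    ultimately show ?thesis using affine_weylI[OF id_in_weyl] by metis
  qed
  show "affine_act id a = a" for a :: "'a \<times> real" by (simp add: affine_act_def)
  show "- (- a) = a" for a :: "'a \<times> real" by simp
  show "- a \<notin> AP" if "a \<in> AP" for a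
    using that uminus_notin_pos by (cases a) (auto simp: affine_pos_iff)
  show "affine_refl (- a) = affine_refl a" for a :: "'a \<times> real" by (rule affine_refl_uminus)
  show "affine_simple \<subseteq> AP"
    using highest_root_pos pos_root uminus_root simple_pos_root by (auto simp: affine_simple_def affine_pos_iff)
next
  fix g h assume "g \<in> Waf" "h \<in> Waf"
  then obtain w \<mu> u \<nu> where g: "w \<in> weyl \<Delta>" "\<mu> \<in> coroot_lattice \<Delta>" "g = w \<circ> transl \<mu>"
    and h: "u \<in> weyl \<Delta>" "\<nu> \<in> coroot_lattice \<Delta>" "h = u \<circ> transl \<nu>" by (metis affine_weyl_cases)
  have iu: "inv u \<mu> + \<nu> \<in> coroot_lattice \<Delta>"
    using weyl_coroot_lattice[OF weyl_inv[OF h(1)] g(2)] h(2) int_span_add unfolding coroot_lattice_def by blast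
  show "g \<circ> h \<in> Waf"
    unfolding g(3) h(3) affine_weyl_comp_eq[OF h(1)] by (rule affine_weylI[OF weyl_comp[OF g(1) h(1)] iu])
  fix a :: "'a \<times> real"
  obtain \<alpha> n where a: "a = (\<alpha>, n)" by (cases a)
  show "affine_act (g \<circ> h) a = affine_act g (affine_act h a)"
    unfolding g(3) h(3) affine_weyl_comp_eq[OF h(1)] a affine_act_eq[OF weyl_comp[OF g(1) h(1)]]
      affine_act_eq[OF h(1)] affine_act_eq[OF g(1)]
    by (simp add: inner_add_left weyl_inner_inv[OF h(1)])
next
  fix g assume gW: "g \<in> Waf"
  then obtain w \<mu> where g: "w \<in> weyl \<Delta>" "\<mu> \<in> coroot_lattice \<Delta>" "g = w \<circ> transl \<mu>" by (rule affine_weyl_cases)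
  show "affine_act g (- a) = - affine_act g a" for a
    unfolding g(3) by (cases a) (simp add: affine_act_eq[OF g(1)] weyl_minus[OF g(1)])
  show "affine_act g a \<in> AP \<or> - affine_act g a \<in> AP" if a: "a \<in> AP" for a
  proof -
    obtain \<alpha> n where e: "a = (\<alpha>, n)" by (cases a)
    have an: "\<alpha> \<in> \<Phi>" "n \<in> \<int>" using a pos_root unfolding e affine_pos_iff by auto
    have "w \<alpha> \<in> \<Phi>" "n - \<mu> \<bullet> \<alpha> \<in> \<int>"
      using weyl_root[OF g(1) order_refl an(1)] an(2) coroot_lattice_pairing[OF g(2) an(1)] by auto
    then show ?thesis unfolding g(3) e affine_act_eq[OF g(1)] by (rule affine_pos_or_neg)
  qed
  show "affine_refl (affine_act g a) = g \<circ> affine_refl a \<circ> inv g" if a: "a \<in> AP" for a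
  proof -
    obtain \<alpha> n where e: "a = (\<alpha>, n)" by (cases a)
    have "affine_refl (affine_act g a) \<circ> g = g \<circ> affine_refl a"
    proof
      fix v
      have l: "root_refl (w \<alpha>) (u + u') = root_refl (w \<alpha>) u + root_refl (w \<alpha>) u'" for u u'
        using linear_add[OF linear_root_refl] .
      have c: "coroot (w \<alpha>) = w (coroot \<alpha>)" by (rule coroot_orthogonal[OF orthogonal_weyl[OF g(1)]])
      have r: "root_refl (w \<alpha>) (w u) = w (root_refl \<alpha> u)" for u by (rule root_refl_orthogonal[OF orthogonal_weyl[OF g(1)]])
      have lw: "w (u + u') = w u + w u'" "w (k *\<^sub>R u) = k *\<^sub>R w u" for u u' k
        using linear_add[OF linear_weyl[OF g(1)]] linear_scale[OF linear_weyl[OF g(1)]] by auto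
      have "(g \<circ> affine_refl a) v = (w \<circ> transl \<mu> \<circ> affine_refl (\<alpha>, n)) v" by (simp add: g(3) e)
      also have "\<dots> = (w \<circ> root_refl \<alpha> \<circ> transl (\<mu> + (n - \<mu> \<bullet> \<alpha>) *\<^sub>R coroot \<alpha>)) v"
        by (simp only: transl_comp_affine_refl[OF g(1)])
      also have "\<dots> = root_refl (w \<alpha>) (w (v + (\<mu> + (n - \<mu> \<bullet> \<alpha>) *\<^sub>R coroot \<alpha>)))"
        by (simp add: transl_def r)
      also have "\<dots> = (affine_refl (affine_act g a) \<circ> g) v"
        unfolding g(3) e affine_act_eq[OF g(1)]
        by (simp add: affine_refl_def transl_def lw c add.assoc)
      finally show "(affine_refl (affine_act g a) \<circ> g) v = (g \<circ> affine_refl a) v" ..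
    qed
    moreover have "g \<circ> inv g = id" using bij_affine_weyl[OF gW] by (simp add: fun_eq_iff bij_is_surj surj_f_inv_f)
    ultimately show ?thesis by (metis comp_assoc comp_id)
  qed
  show "finite {a \<in> AP. affine_act g a \<notin> AP}"
  proof (rule finite_subset)
    show "finite (\<Union>\<beta>\<in>\<Phi>. (\<lambda>k::int. (\<beta>, of_int k)) ` {0..\<lfloor>\<mu> \<bullet> \<beta>\<rfloor>})" using finite_root_set by simp
    show "{a \<in> AP. affine_act g a \<notin> AP} \<subseteq> (\<Union>\<beta>\<in>\<Phi>. (\<lambda>k::int. (\<beta>, of_int k :: real)) ` {0..\<lfloor>\<mu> \<bullet> \<beta>\<rfloor>})"
    proof clarify
      fix \<beta> n assume a: "(\<beta>, n) \<in> AP" and na: "affine_act g (\<beta>, n) \<notin> AP"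
      have b: "\<beta> \<in> \<Phi>" "n \<in> \<int>" "0 \<le> n" using a pos_root unfolding affine_pos_iff by auto
      have "w \<beta> \<in> \<Phi>" "n - \<mu> \<bullet> \<beta> \<in> \<int>"
        using weyl_root[OF g(1) order_refl b(1)] b(2) coroot_lattice_pairing[OF g(2) b(1)] by auto
      then have le: "n \<le> \<mu> \<bullet> \<beta>" using na unfolding g(3) affine_act_eq[OF g(1)] affine_pos_iff by auto
      obtain k where k: "n = of_int k" using b(2) by (rule Ints_cases)
      then have "k \<in> {0..\<lfloor>\<mu> \<bullet> \<beta>\<rfloor>}" using le b(3) by (simp add: le_floor_iff)
      then show "(\<beta>, n) \<in> (\<Union>\<beta>\<in>\<Phi>. (\<lambda>k::int. (\<beta>, of_int k)) ` {0..\<lfloor>\<mu> \<bullet> \<beta>\<rfloor>})" using b(1) k by blast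
    qed
  qed
next
  fix a assume a: "a \<in> AP"
  obtain \<alpha> n where e: "a = (\<alpha>, n)" by (cases a)
  have an: "\<alpha> \<in> \<Phi>" "n \<in> \<int>" using a pos_root unfolding e affine_pos_iff by auto
  have nz: "\<alpha> \<noteq> 0" using an zero_notin_roots by blast
  have r: "root_refl \<alpha> \<in> weyl \<Delta>" by (rule root_refl_in_weyl_full[OF an(1)])
  have "coroot \<alpha> \<in> coroot_lattice \<Delta>" using coroot_in_lattice[OF order_refl] an(1) par_roots_simple by simp
  then have "n *\<^sub>R coroot \<alpha> \<in> coroot_lattice \<Delta>" using int_span_scale_Ints an(2) unfolding coroot_lattice_def by blast
  then show "affine_refl a \<in> Waf" unfolding e affine_refl_def fst_conv snd_conv by (rule affine_weylI[OF r])
  have c: "coroot \<alpha> \<bullet> \<alpha> = 2" using inner_coroot_self[OF nz] by (simp add: inner_commute)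
  show "affine_act (affine_refl a) a = - a"
    unfolding e affine_refl_def fst_conv snd_conv affine_act_eq[OF r] by (simp add: root_refl_self c)
  show "affine_refl a \<circ> affine_refl a = id"
  proof -
    have "affine_refl a \<circ> affine_refl a = root_refl \<alpha> \<circ> transl (n *\<^sub>R coroot \<alpha>) \<circ> affine_refl (\<alpha>, n)"
      by (simp only: e affine_refl_def fst_conv snd_conv)
    also have "\<dots> = root_refl \<alpha> \<circ> root_refl \<alpha> \<circ> transl (n *\<^sub>R coroot \<alpha> + (n - (n *\<^sub>R coroot \<alpha>) \<bullet> \<alpha>) *\<^sub>R coroot \<alpha>)"
      by (rule transl_comp_affine_refl[OF r])
    also have "n *\<^sub>R coroot \<alpha> + (n - (n *\<^sub>R coroot \<alpha>) \<bullet> \<alpha>) *\<^sub>R coroot \<alpha> = 0"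
      using c by (simp flip: scaleR_left_distrib)
    finally show ?thesis by (simp add: root_refl_comp_self fun_eq_iff transl_def)
  qed
next
  fix d a assume "d \<in> affine_simple" "a \<in> AP" "a \<noteq> d"
  then show "affine_act (affine_refl d) a \<in> AP" by (rule affine_act_simple)
next
  fix g assume "g \<in> Waf" "\<And>d. d \<in> affine_simple \<Longrightarrow> affine_act g d \<in> AP"
  then show "g = id" by (rule affine_trivial)
qed

lemma affine_simple_refls_eq: "affine_simple_refls \<Phi> \<Delta> = affine_refl ` affine_simple"
proof -
  have "affine_refl (i, 0) = root_refl i" for i :: 'a
    by (simp add: affine_refl_def fun_eq_iff transl_def)
  moreover have "affine_refl (- \<theta>, 1) = root_refl \<theta> \<circ> transl (- coroot \<theta>)"
    by (simp add: affine_refl_def root_refl_uminus coroot_uminus)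
  ultimately show ?thesis
    unfolding affine_simple_refls_def affine_simple_def image_insert image_image by simp
qed

lemma affine_cover_iff:
  assumes "x \<in> Waf" "\<gamma> \<in> affine_roots \<Phi>"
  shows "affine_cover \<Phi> \<Delta> (x \<circ> affine_refl \<gamma>) x \<longleftrightarrow>
    affine.inv_num x = affine.inv_num (x \<circ> affine_refl \<gamma>) + 1"
proof -
  obtain \<beta> n where g: "\<gamma> = (\<beta>, n)" "\<beta> \<in> \<Phi>" "n \<in> \<int>" using assms(2) by (auto simp: affine_roots_def)
  obtain a where a: "a \<in> AP" "affine_refl a = affine_refl \<gamma>"
    using affine_pos_or_neg[OF g(2,3)] affine_refl_uminus g(1) by metis
  show ?thesis
    unfolding affine_cover_def affine_simple_refls_eq a(2)[symmetric] by (rule affine.cover_iff[OF assms(1) a(1)])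
qed

abbreviation "neg_ind w \<beta> \<equiv> (if w \<beta> \<in> P then 0 else (1::real))"

text \<open>
  For \<open>\<alpha> \<in> \<Phi>\<^sup>+\<close> put \<open>k = \<langle>\<mu>, \<alpha>\<rangle> + [w\<alpha> < 0]\<close>. The inversions with classical part \<open>\<alpha>\<close> are
  \<open>\<alpha> + j\<delta>\<close> with \<open>0 \<le> j < k\<close>, and those with classical part \<open>-\<alpha>\<close> are \<open>-\<alpha> + j\<delta>\<close> with
  \<open>1 \<le> j \<le> -k\<close>; together there are \<open>\<bar>k\<bar>\<close>.
\<close>

lemma affine_inv_num:
  assumes w: "w \<in> weyl \<Delta>" and m: "\<mu> \<in> coroot_lattice \<Delta>"
  shows "real (affine.inv_num (w \<circ> transl \<mu>)) = (\<Sum>\<alpha>\<in>P. \<bar>\<mu> \<bullet> \<alpha> + neg_ind w \<alpha>\<bar>)"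
proof -
  define k where "k = (\<lambda>\<alpha>. \<lfloor>\<mu> \<bullet> \<alpha>\<rfloor> + (if w \<alpha> \<in> P then 0 else 1))"
  have k: "of_int (k \<alpha>) = \<mu> \<bullet> \<alpha> + neg_ind w \<alpha>" if "\<alpha> \<in> P" for \<alpha>
    using coroot_lattice_pairing[OF m pos_root[OF that]] by (simp add: k_def of_int_floor)
  define up where "up = (\<lambda>\<alpha>. (\<lambda>j::int. (\<alpha>, of_int j :: real)) ` {0..<k \<alpha>})"
  define down where "down = (\<lambda>\<alpha>. (\<lambda>j::int. (- \<alpha>, of_int j :: real)) ` {1..<1 - k \<alpha>})"
  have up: "(\<alpha>, n) \<in> affine.inversions (w \<circ> transl \<mu>) \<longleftrightarrow> (\<alpha>, n) \<in> up \<alpha>" if a: "\<alpha> \<in> P" for \<alpha> n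
  proof -
    have wa: "w \<alpha> \<in> \<Phi>" using weyl_root[OF w order_refl pos_root[OF a]] .
    have mu: "\<mu> \<bullet> \<alpha> = of_int \<lfloor>\<mu> \<bullet> \<alpha>\<rfloor>" using coroot_lattice_pairing[OF m pos_root[OF a]] by (simp add: of_int_floor)
    have "(\<alpha>, n) \<in> affine.inversions (w \<circ> transl \<mu>) \<longleftrightarrow>
        n \<in> \<int> \<and> 0 \<le> n \<and> \<not> (n - \<mu> \<bullet> \<alpha> = 0 \<and> w \<alpha> \<in> P \<or> n - \<mu> \<bullet> \<alpha> \<in> \<int> \<and> 0 < n - \<mu> \<bullet> \<alpha>)"
      unfolding affine.inversions_def mem_Collect_eq affine_act_eq[OF w] affine_pos_iff
      using a pos_root[OF a] wa by auto
    also have "\<dots> \<longleftrightarrow> (\<exists>j. n = of_int j \<and> 0 \<le> j \<and> j < k \<alpha>)"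
      unfolding k_def by (subst (1 2 3) mu) (auto elim!: Ints_cases)
    also have "\<dots> \<longleftrightarrow> (\<alpha>, n) \<in> up \<alpha>" by (auto simp: up_def)
    finally show ?thesis .
  qed
  have down: "(- \<alpha>, n) \<in> affine.inversions (w \<circ> transl \<mu>) \<longleftrightarrow> (- \<alpha>, n) \<in> down \<alpha>" if a: "\<alpha> \<in> P" for \<alpha> n
  proof -
    have wa: "w \<alpha> \<in> \<Phi>" using weyl_root[OF w order_refl pos_root[OF a]] .
    have neg: "w (- \<alpha>) \<in> P \<longleftrightarrow> w \<alpha> \<notin> P" using not_pos_iff[OF wa] by (simp add: weyl_minus[OF w])
    have mu: "\<mu> \<bullet> \<alpha> = of_int \<lfloor>\<mu> \<bullet> \<alpha>\<rfloor>" using coroot_lattice_pairing[OF m pos_root[OF a]] by (simp add: of_int_floor)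
    have wa': "w (- \<alpha>) \<in> \<Phi>" using uminus_root[OF wa] by (simp add: weyl_minus[OF w])
    have "(- \<alpha>, n) \<in> affine.inversions (w \<circ> transl \<mu>) \<longleftrightarrow>
        n \<in> \<int> \<and> 0 < n \<and> \<not> (n + \<mu> \<bullet> \<alpha> = 0 \<and> w \<alpha> \<notin> P \<or> n + \<mu> \<bullet> \<alpha> \<in> \<int> \<and> 0 < n + \<mu> \<bullet> \<alpha>)"
      unfolding affine.inversions_def mem_Collect_eq affine_act_eq[OF w] affine_pos_iff neg
      using uminus_notin_pos[OF a] uminus_root[OF pos_root[OF a]] wa' by auto
    also have "\<dots> \<longleftrightarrow> (\<exists>j. n = of_int j \<and> 1 \<le> j \<and> j < 1 - k \<alpha>)"
      unfolding k_def by (subst (1 2 3) mu) (auto elim!: Ints_cases)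
    also have "\<dots> \<longleftrightarrow> (- \<alpha>, n) \<in> down \<alpha>" by (auto simp: down_def)
    finally show ?thesis .
  qed
  have inv: "affine.inversions (w \<circ> transl \<mu>) = (\<Union>\<alpha>\<in>P. up \<alpha> \<union> down \<alpha>)"
  proof (intro equalityI subsetI)
    fix a assume i: "a \<in> affine.inversions (w \<circ> transl \<mu>)"
    obtain \<beta> n where a: "a = (\<beta>, n)" by (cases a)
    have "\<beta> \<in> \<Phi>" using i pos_root unfolding a affine.inversions_def by (auto simp: affine_pos_iff)
    then have "\<beta> \<in> P \<or> - \<beta> \<in> P" by (rule pos_or_neg)
    then show "a \<in> (\<Union>\<alpha>\<in>P. up \<alpha> \<union> down \<alpha>)"
    proof
      assume p: "- \<beta> \<in> P"
      then have "a \<in> down (- \<beta>)" using down[OF p, of n] i a by simp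
      then show ?thesis using p by blast
    qed (use up i a in blast)
  next
    fix a assume "a \<in> (\<Union>\<alpha>\<in>P. up \<alpha> \<union> down \<alpha>)"
    then obtain \<alpha> where al: "\<alpha> \<in> P" "a \<in> up \<alpha> \<or> a \<in> down \<alpha>" by blast
    from al(2) show "a \<in> affine.inversions (w \<circ> transl \<mu>)"
    proof
      assume u: "a \<in> up \<alpha>"
      then obtain n where "a = (\<alpha>, n)" by (auto simp: up_def)
      then show ?thesis using u up[OF al(1)] by blast
    next
      assume d: "a \<in> down \<alpha>"
      then obtain n where "a = (- \<alpha>, n)" by (auto simp: down_def)
      then show ?thesis using d down[OF al(1)] by blast
    qed
  qed
  have card: "card (up \<alpha> \<union> down \<alpha>) = nat \<bar>k \<alpha>\<bar>" if a: "\<alpha> \<in> P" for \<alpha>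
  proof -
    have "\<alpha> \<noteq> - \<alpha>" using uminus_notin_pos[OF a] a by metis
    then have "up \<alpha> \<inter> down \<alpha> = {}" by (auto simp: up_def down_def)
    then have "card (up \<alpha> \<union> down \<alpha>) = card (up \<alpha>) + card (down \<alpha>)"
      by (intro card_Un_disjoint) (auto simp: up_def down_def)
    also have "card (up \<alpha>) = nat (k \<alpha>)" unfolding up_def by (subst card_image) (auto simp: inj_on_def)
    also have "card (down \<alpha>) = nat (- k \<alpha>)" unfolding down_def by (subst card_image) (auto simp: inj_on_def)
    finally show ?thesis by simp
  qed
  have fst_up: "fst a = \<alpha>" if "a \<in> up \<alpha>" for a \<alpha> using that by (auto simp: up_def)
  have fst_down: "fst a = - \<alpha>" if "a \<in> down \<alpha>" for a \<alpha> using that by (auto simp: down_def)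
  have disj: "(up \<alpha> \<union> down \<alpha>) \<inter> (up \<beta> \<union> down \<beta>) = {}" if "\<alpha> \<in> P" "\<beta> \<in> P" "\<alpha> \<noteq> \<beta>" for \<alpha> \<beta>
  proof -
    have "\<alpha> \<noteq> - \<beta>" "- \<alpha> \<noteq> \<beta>" "- \<alpha> \<noteq> - \<beta>" using that uminus_notin_pos[of \<alpha>] uminus_notin_pos[of \<beta>] by auto
    then show ?thesis using that(3) by (auto dest!: fst_up fst_down)
  qed
  have "affine.inv_num (w \<circ> transl \<mu>) = (\<Sum>\<alpha>\<in>P. card (up \<alpha> \<union> down \<alpha>))"
    unfolding affine.inv_num_def inv
    by (rule card_UN_disjoint) (use finite_pos disj in \<open>auto simp: up_def down_def\<close>)
  also have "\<dots> = (\<Sum>\<alpha>\<in>P. nat \<bar>k \<alpha>\<bar>)" by (intro sum.cong) (auto simp: card)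
  finally have "real (affine.inv_num (w \<circ> transl \<mu>)) = (\<Sum>\<alpha>\<in>P. real_of_int \<bar>k \<alpha>\<bar>)" by simp
  also have "\<dots> = (\<Sum>\<alpha>\<in>P. \<bar>\<mu> \<bullet> \<alpha> + neg_ind w \<alpha>\<bar>)" by (intro sum.cong) (simp_all add: k del: of_int_abs add: of_int_abs)
  finally show ?thesis .
qed

end

section \<open>Sums over the roots outside \<open>\<Phi>\<^sub>J\<close>\<close>

context finite_roots
begin

lemma weyl_sum_outside:
  assumes J: "J \<subseteq> \<Delta>" and g: "g \<in> weyl J" and f: "\<And>\<beta>. f (g \<beta>) = g (f \<beta>)"
  shows "g (\<Sum>\<beta>\<in>P - PJ J. f \<beta>) = (\<Sum>\<beta>\<in>P - PJ J. f \<beta>)"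
proof -
  have "g (\<Sum>\<beta>\<in>P - PJ J. f \<beta>) = (\<Sum>\<beta>\<in>P - PJ J. f (g \<beta>))"
    unfolding linear_sum[OF linear_weyl[OF g]] f ..
  also have "\<dots> = (\<Sum>\<beta>\<in>P - PJ J. f \<beta>)" by (rule sum.reindex_bij_betw[OF weyl_bij_outside[OF g J]])
  finally show ?thesis .
qed

text \<open>
  This is \<open>2\<rho> - 2\<rho>\<^sub>J\<close>, and \<open>2\<rho>\<close> for \<open>J = {}\<close>.
\<close>

definition outer_sum :: "'a set \<Rightarrow> 'a" where
  "outer_sum J = (\<Sum>\<beta>\<in>P - PJ J. \<beta>)"

lemma outer_sum_half_sums:
  "2 *\<^sub>R half_sum P - 2 *\<^sub>R half_sum (PJ J) = outer_sum J"
  using sum_diff[OF finite_pos, of "PJ J" "\<lambda>\<beta>. \<beta>"]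
  by (simp add: half_sum_def outer_sum_def par_pos_roots_def)

lemma weyl_outer_sum: "J \<subseteq> \<Delta> \<Longrightarrow> g \<in> weyl J \<Longrightarrow> g (outer_sum J) = outer_sum J"
  unfolding outer_sum_def using weyl_sum_outside[of J g "\<lambda>\<beta>. \<beta>"] by simp

lemma coroot_outer_sum_weyl:
  assumes "J \<subseteq> \<Delta>" "g \<in> weyl J"
  shows "coroot (g \<beta>) \<bullet> outer_sum J = coroot \<beta> \<bullet> outer_sum J"
  using weyl_inner[OF assms(2), of "coroot \<beta>" "outer_sum J"]
  unfolding weyl_outer_sum[OF assms] coroot_orthogonal[OF orthogonal_weyl[OF assms(2)]] .

lemma par_pos_empty: "PJ {} = {}"
proof -
  have "\<beta> \<notin> PJ {}" for \<beta>
    using root_coeff_nonzero[of \<beta>] by (auto simp: par_pos_iff pos_root)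
  then show ?thesis by blast
qed

lemma weyl_empty: "weyl {} = {id}"
  unfolding weyl_def words_group_def by auto

text \<open>
  The direction in which elements of \<open>Q\<^sup>\<or>\<close> can be made superantidominant without changing their
  pairings with \<open>\<Phi>\<^sub>J\<close> is given by the sum of the positive coroots outside \<open>\<Phi>\<^sub>J\<close>. It is invariant under
  \<open>W\<^sub>J\<close>, hence orthogonal to \<open>\<Phi>\<^sub>J\<close>. For \<open>i \<in> \<Delta> - J\<close>, the sum of all positive coroots pairs to \<open>2\<close> with
  \<open>i\<close>, and the coroots of \<open>\<Phi>\<^sub>J\<^sup>+\<close> pair to at most \<open>0\<close>.
\<close>

lemma outer_coroot_sum:
  assumes J: "J \<subseteq> \<Delta>"
  shows "\<exists>\<eta>\<in>coroot_lattice \<Delta>. (\<forall>\<beta>\<in>PJ J. \<eta> \<bullet> \<beta> = 0) \<and> (\<forall>\<beta>\<in>P - PJ J. 1 \<le> \<eta> \<bullet> \<beta>)"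
proof -
  let ?\<eta> = "\<Sum>\<beta>\<in>P - PJ J. coroot \<beta>"
  have lat: "coroot \<beta> \<in> coroot_lattice \<Delta>" if "\<beta> \<in> P" for \<beta>
    using coroot_in_lattice[OF order_refl] that pos_root par_roots_simple by simp
  have "(\<Sum>\<beta>\<in>S. coroot \<beta>) \<in> coroot_lattice \<Delta>" if "S \<subseteq> P" for S
    using finite_subset[OF that finite_pos] that
    by (induction rule: finite_induct) (auto simp: coroot_lattice_def int_span_zero intro!: int_span_add lat[unfolded coroot_lattice_def])
  then have inlat: "?\<eta> \<in> coroot_lattice \<Delta>" by blast
  have zero: "?\<eta> \<bullet> \<beta> = 0" if b: "\<beta> \<in> PJ J" for \<beta>
  proof -
    have "\<beta> \<in> par_roots \<Phi> J" using b by (simp add: par_pos_roots_def)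
    then have r: "root_refl \<beta> \<in> weyl J" by (rule root_refl_in_weyl[OF J])
    have "root_refl \<beta> ?\<eta> = ?\<eta>"
      by (rule weyl_sum_outside[OF J r]) (rule coroot_orthogonal[OF orthogonal_root_refl])
    then have "(?\<eta> \<bullet> \<beta>) *\<^sub>R coroot \<beta> = 0" by (simp add: root_refl_coweight)
    moreover have "\<beta> \<noteq> 0" using b pos_root zero_notin_roots by (auto simp: par_pos_roots_def)
    ultimately show ?thesis by (auto simp: coroot_def)
  qed
  have simple: "1 \<le> ?\<eta> \<bullet> i" if i: "i \<in> \<Delta> - J" for i
  proof -
    have iD: "i \<in> \<Delta>" using i by blast
    have iP: "i \<in> P" by (rule simple_pos_root[OF iD])
    have nz: "i \<noteq> 0" using iD simple_root zero_notin_roots by metis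
    let ?S = "\<Sum>\<beta>\<in>P - {i}. coroot \<beta>"
    have b: "bij_betw (root_refl i) (P - {i}) (P - {i})"
    proof (rule bij_betwI[where g="root_refl i"])
      have "root_refl i \<beta> \<in> P - {i}" if "\<beta> \<in> P - {i}" for \<beta>
      proof -
        have "root_refl i \<beta> \<noteq> i"
        proof
          assume "root_refl i \<beta> = i"
          then have "\<beta> = - i" by (metis root_refl_root_refl root_refl_self)
          then show False using that iP uminus_notin_pos by blast
        qed
        then show ?thesis using that simple_refl_pos[OF iD] by blast
      qed
      then show "root_refl i \<in> (P - {i}) \<rightarrow> P - {i}" "root_refl i \<in> (P - {i}) \<rightarrow> P - {i}" by blast+
    qed (simp_all add: root_refl_root_refl)
    have "root_refl i ?S = (\<Sum>\<beta>\<in>P - {i}. coroot (root_refl i \<beta>))"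
      unfolding linear_sum[OF linear_root_refl] coroot_orthogonal[OF orthogonal_root_refl] ..
    also have "\<dots> = ?S" by (rule sum.reindex_bij_betw[OF b])
    finally have "(?S \<bullet> i) *\<^sub>R coroot i = 0" by (simp add: root_refl_coweight)
    then have S0: "?S \<bullet> i = 0" using nz by (auto simp: coroot_def)
    have all: "(\<Sum>\<beta>\<in>P. coroot \<beta>) \<bullet> i = 2"
      unfolding sum.remove[OF finite_pos iP] inner_add_left S0 using inner_coroot_self[OF nz] by (simp add: inner_commute)
    have "(\<Sum>\<beta>\<in>PJ J. coroot \<beta>) \<bullet> i \<le> 0"
      unfolding inner_sum_left
    proof (rule sum_nonpos)
      fix \<beta> assume b: "\<beta> \<in> PJ J"
      then have bJ: "\<beta> \<in> par_roots \<Phi> J" "\<beta> \<in> P" by (auto simp: par_pos_roots_def)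
      have "i \<bullet> \<beta> = (\<Sum>k\<in>J. (\<omega> k \<bullet> \<beta>) * (i \<bullet> k))" by (rule pairing_expansion_par[OF J bJ(1)])
      also have "\<dots> \<le> 0"
      proof (rule sum_nonpos)
        fix k assume k: "k \<in> J"
        then have "i \<bullet> k \<le> 0" using simple_inner_nonpos[OF iD, of k] i J by blast
        moreover have "0 \<le> \<omega> k \<bullet> \<beta>" using bJ(2) k J by (auto simp: pos_root_iff)
        ultimately show "(\<omega> k \<bullet> \<beta>) * (i \<bullet> k) \<le> 0" by (rule mult_nonneg_nonpos[rotated])
      qed
      finally have "\<beta> \<bullet> i \<le> 0" by (simp add: inner_commute)
      then show "coroot \<beta> \<bullet> i \<le> 0" by (simp add: coroot_def divide_nonpos_nonneg)
    qed
    moreover have "?\<eta> = (\<Sum>\<beta>\<in>P. coroot \<beta>) - (\<Sum>\<beta>\<in>PJ J. coroot \<beta>)"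
      by (rule sum_diff[OF finite_pos]) (auto simp: par_pos_roots_def)
    ultimately show ?thesis using all by (simp add: inner_diff_left)
  qed
  have "1 \<le> ?\<eta> \<bullet> \<beta>" if b: "\<beta> \<in> P - PJ J" for \<beta>
  proof -
    have bP: "\<beta> \<in> P" "\<beta> \<in> \<Phi>" using b pos_root by auto
    obtain i where i: "i \<in> \<Delta> - J" "\<omega> i \<bullet> \<beta> \<noteq> 0" using b by (auto simp: par_pos_iff[OF J])
    obtain n where n: "\<omega> i \<bullet> \<beta> = of_int n" using coeff_root_int[OF bP(2), of i] i(1) by (auto elim: Ints_cases)
    have "0 \<le> \<omega> i \<bullet> \<beta>" using bP(1) i(1) by (simp add: pos_root_iff)
    then have one: "1 \<le> \<omega> i \<bullet> \<beta>" using i(2) n by simp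
    have nn: "0 \<le> (\<omega> k \<bullet> \<beta>) * (?\<eta> \<bullet> k)" if k: "k \<in> \<Delta>" for k
    proof -
      have "0 \<le> ?\<eta> \<bullet> k"
      proof (cases "k \<in> J")
        case True
        then show ?thesis using zero[OF simple_par_pos[OF J True]] by simp
      next
        case False
        then have "1 \<le> ?\<eta> \<bullet> k" using simple k by blast
        then show ?thesis by linarith
      qed
      moreover have "0 \<le> \<omega> k \<bullet> \<beta>" using bP(1) k by (simp add: pos_root_iff)
      ultimately show ?thesis by simp
    qed
    have "1 \<le> (\<omega> i \<bullet> \<beta>) * (?\<eta> \<bullet> i)" using mult_mono[OF one simple[OF i(1)]] one by simp
    also have "\<dots> \<le> (\<Sum>k\<in>\<Delta>. (\<omega> k \<bullet> \<beta>) * (?\<eta> \<bullet> k))"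
      using i(1) nn by (intro member_le_sum finite_simple) auto
    also have "\<dots> = ?\<eta> \<bullet> \<beta>" by (rule pairing_expansion[symmetric])
    finally show ?thesis .
  qed
  then show ?thesis using inlat zero by blast
qed

lemma wlength_comp_le:
  assumes g: "g \<in> weyl \<Delta>" and h: "h \<in> weyl \<Delta>"
  shows "wlength \<Delta> (g \<circ> h) \<le> wlength \<Delta> g + wlength \<Delta> h"
proof -
  \<comment> \<open>an inversion of \<open>g h\<close> is an inversion of \<open>h\<close> or is mapped by \<open>h\<close> to an inversion of \<open>g\<close>\<close>
  let ?A = "{\<beta> \<in> P. h \<beta> \<notin> P}" and ?B = "{\<beta> \<in> P. h \<beta> \<in> P \<and> g (h \<beta>) \<notin> P}"
  have "card ?B = card (h ` ?B)"
    using bij_weyl[OF h] by (intro card_image[symmetric]) (meson bij_is_inj inj_on_subset top_greatest)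
  also have "\<dots> \<le> card {\<beta> \<in> P. g \<beta> \<notin> P}" by (rule card_mono) (use finite_pos in auto)
  finally have B: "card ?B \<le> wlength \<Delta> g" by (simp add: wlength_eq[OF g])
  have "wlength \<Delta> (g \<circ> h) = card {\<beta> \<in> P. (g \<circ> h) \<beta> \<notin> P}" by (rule wlength_eq[OF weyl_comp[OF g h]])
  also have "\<dots> \<le> card (?A \<union> ?B)" by (rule card_mono) (use finite_pos in auto)
  also have "\<dots> \<le> card ?A + card ?B" by (rule card_Un_le)
  finally show ?thesis using B by (simp add: wlength_eq[OF h])
qed

lemma coroot_pairing_bound: "\<exists>C::nat. \<forall>\<gamma>\<in>\<Phi>. \<forall>\<delta>\<in>\<Phi>. coroot \<gamma> \<bullet> \<delta> \<le> real C"
proof -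
  let ?C = "\<Sum>\<gamma>\<in>\<Phi>. \<Sum>\<delta>\<in>\<Phi>. \<bar>coroot \<gamma> \<bullet> \<delta>\<bar>"
  have "coroot \<gamma> \<bullet> \<delta> \<le> ?C" if "\<gamma> \<in> \<Phi>" "\<delta> \<in> \<Phi>" for \<gamma> \<delta>
  proof -
    have "coroot \<gamma> \<bullet> \<delta> \<le> \<bar>coroot \<gamma> \<bullet> \<delta>\<bar>" by simp
    also have "\<dots> \<le> (\<Sum>\<delta>\<in>\<Phi>. \<bar>coroot \<gamma> \<bullet> \<delta>\<bar>)" using that by (intro member_le_sum finite_root_set) auto
    also have "\<dots> \<le> ?C" using that by (intro member_le_sum finite_root_set) (auto intro: sum_nonneg)
    finally show ?thesis .
  qed
  then show ?thesis by (intro exI[of _ "nat \<lceil>?C\<rceil>"]) (meson order_trans real_nat_ceiling_ge)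
qed

text \<open>
  The contributions to \<open>\<langle>\<beta>\<^sup>\<or>, 2\<rho>\<rangle>\<close> of the positive roots that stay positive under \<open>r\<^sub>\<beta>\<close> cancel,
  each of the \<open>\<ell>(r\<^sub>\<beta>)\<close> inversions contributes at least \<open>1\<close>, and \<open>\<beta>\<close> itself contributes \<open>2\<close>.
\<close>

lemma wlength_root_refl_le:
  assumes b: "\<beta> \<in> P"
  shows "real (wlength \<Delta> (root_refl \<beta>)) + 1 \<le> coroot \<beta> \<bullet> outer_sum {}"
proof -
  let ?r = "root_refl \<beta>" and ?I = "{\<gamma> \<in> P. root_refl \<beta> \<gamma> \<notin> P}"
  let ?R = "P - ?I"
  have bP: "\<beta> \<in> \<Phi>" using b pos_root by blast
  have nz: "\<beta> \<noteq> 0" using bP zero_notin_roots by blast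
  have bb: "coroot \<beta> \<bullet> \<beta> = 2" using inner_coroot_self[OF nz] by (simp add: inner_commute)
  have r: "?r \<in> weyl \<Delta>" by (rule root_refl_in_weyl_full[OF bP])
  have bij: "bij_betw ?r ?R ?R"
    by (rule bij_betwI[where g="?r"]) (auto simp: root_refl_root_refl)
  have flip: "coroot \<beta> \<bullet> ?r \<gamma> = - (coroot \<beta> \<bullet> \<gamma>)" for \<gamma>
    by (simp add: root_refl_def inner_diff_right bb inner_commute[of \<gamma>])
  have "(\<Sum>\<gamma>\<in>?R. coroot \<beta> \<bullet> \<gamma>) = (\<Sum>\<gamma>\<in>?R. coroot \<beta> \<bullet> ?r \<gamma>)" by (rule sum.reindex_bij_betw[OF bij, symmetric])
  also have "\<dots> = - (\<Sum>\<gamma>\<in>?R. coroot \<beta> \<bullet> \<gamma>)" unfolding flip sum_negf ..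
  finally have R0: "(\<Sum>\<gamma>\<in>?R. coroot \<beta> \<bullet> \<gamma>) = 0" by simp
  have fI: "finite ?I" using finite_pos by simp
  have bI: "\<beta> \<in> ?I" using b uminus_notin_pos by (simp add: root_refl_self)
  have one: "1 \<le> coroot \<beta> \<bullet> \<gamma>" if g: "\<gamma> \<in> ?I" for \<gamma>
  proof (rule ccontr)
    assume n: "\<not> ?thesis"
    have gP: "\<gamma> \<in> P" "?r \<gamma> \<notin> P" "\<gamma> \<in> \<Phi>" using g pos_root by auto
    obtain k where k: "coroot \<beta> \<bullet> \<gamma> = of_int k" using coroot_root_int[OF bP gP(3)] by (rule Ints_cases)
    have k0: "coroot \<beta> \<bullet> \<gamma> \<le> 0" using n k by simp
    have "0 \<le> \<omega> i \<bullet> ?r \<gamma>" if i: "i \<in> \<Delta>" for i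
    proof -
      have "0 \<le> \<omega> i \<bullet> \<gamma>" "0 \<le> \<omega> i \<bullet> \<beta>" using gP(1) b i by (auto simp: pos_root_iff)
      moreover have "(coroot \<beta> \<bullet> \<gamma>) * (\<omega> i \<bullet> \<beta>) \<le> 0"
        using k0 \<open>0 \<le> \<omega> i \<bullet> \<beta>\<close> by (rule mult_nonpos_nonneg)
      ultimately show ?thesis by (simp add: root_refl_def inner_diff_right inner_commute[of \<gamma>])
    qed
    then have "?r \<gamma> \<in> P" using refl_root[OF bP gP(3)] by (simp add: pos_root_iff)
    then show False using gP by blast
  qed
  have "coroot \<beta> \<bullet> outer_sum {} = (\<Sum>\<gamma>\<in>P. coroot \<beta> \<bullet> \<gamma>)"
    by (simp add: outer_sum_def par_pos_empty inner_sum_right)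
  also have "\<dots> = (\<Sum>\<gamma>\<in>?R. coroot \<beta> \<bullet> \<gamma>) + (\<Sum>\<gamma>\<in>?I. coroot \<beta> \<bullet> \<gamma>)"
    by (rule sum.subset_diff[OF _ finite_pos]) auto
  also have "\<dots> = 2 + (\<Sum>\<gamma>\<in>?I - {\<beta>}. coroot \<beta> \<bullet> \<gamma>)" unfolding R0 sum.remove[OF fI bI] bb by simp
  also have "\<dots> \<ge> 2 + (\<Sum>\<gamma>\<in>?I - {\<beta>}. 1)"
    using one by (intro add_left_mono sum_mono) blast
  finally have "2 + real (card (?I - {\<beta>})) \<le> coroot \<beta> \<bullet> outer_sum {}" by simp
  moreover have "card ?I = card (?I - {\<beta>}) + 1" using card_Suc_Diff1[OF fI bI] by simp
  ultimately show ?thesis by (simp add: wlength_eq[OF r])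
qed

lemma min_reps_empty: "min_reps \<Delta> {} = weyl \<Delta>"
  using min_reps_iff[of "{}"] par_pos_empty by auto

lemma min_rep_empty: assumes "w \<in> weyl \<Delta>" shows "min_rep \<Delta> {} w = w"
  using min_rep(2)[of "{}" w] assms by (simp add: weyl_empty)

lemma min_rep_comp:
  assumes J: "J \<subseteq> \<Delta>" and w: "w \<in> weyl \<Delta>" and u: "u \<in> weyl J"
  shows "min_rep \<Delta> J (w \<circ> u) = min_rep \<Delta> J w"
proof -
  obtain u' where u': "u' \<in> weyl J" "w = min_rep \<Delta> J w \<circ> u'" using min_rep(2)[OF J w] by blast
  then have "w \<circ> u = min_rep \<Delta> J w \<circ> (u' \<circ> u)" by (metis comp_assoc)
  then show ?thesis using min_rep_eqI[OF J min_rep(1)[OF J w] weyl_comp[OF u'(1) u]] by metis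
qed

lemma min_rep_id: "J \<subseteq> \<Delta> \<Longrightarrow> w \<in> min_reps \<Delta> J \<Longrightarrow> min_rep \<Delta> J w = w"
  using min_rep_eqI[OF _ _ id_in_weyl] by (metis comp_id)

end

section \<open>Lengths in \<open>\<Omega>\<^sub>J\<^sup>\<infinity>\<close>\<close>

context irreducible_roots
begin


text \<open>
  The condition that no root of \<open>\<Phi>\<^sub>J\<^sup>+\<close> contributes to the length of \<open>g t\<^sub>\<mu>\<close>. It characterises the
  elements of \<open>\<Omega>\<^sub>J\<^sup>\<infinity>\<close> among the products \<open>g t\<^sub>\<mu>\<close> with \<open>\<mu>\<close> superantidominant.
\<close>

definition balanced :: "'a set \<Rightarrow> ('a \<Rightarrow> 'a) \<Rightarrow> 'a \<Rightarrow> bool" where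
  "balanced J g \<mu> \<longleftrightarrow> (\<forall>\<beta>\<in>PJ J. \<mu> \<bullet> \<beta> = - neg_ind g \<beta>)"

context
  fixes J assumes J: "J \<subseteq> \<Delta>"
begin

lemma sum_neg_ind: "(\<Sum>\<beta>\<in>P - PJ J. neg_ind g \<beta>) = real (card {\<beta> \<in> P - PJ J. g \<beta> \<notin> P})"
proof -
  have "(\<Sum>\<beta>\<in>P - PJ J. neg_ind g \<beta>) = (\<Sum>\<beta>\<in>{\<beta> \<in> P - PJ J. g \<beta> \<notin> P}. neg_ind g \<beta>)"
    by (rule sum.mono_neutral_right) (use finite_pos in auto)
  also have "\<dots> = (\<Sum>\<beta>\<in>{\<beta> \<in> P - PJ J. g \<beta> \<notin> P}. 1)" by (rule sum.cong) auto
  finally show ?thesis by simp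
qed

text \<open>
  Outside \<open>\<Phi>\<^sub>J\<close> the summands of the length formula are nonpositive before the absolute value is
  taken, and the inversions of \<open>g\<close> there are as many as those of \<open>\<lfloor>g\<rfloor>\<close>. The last sum, over
  \<open>\<Phi>\<^sub>J\<^sup>+\<close>, measures how far \<open>g t\<^sub>\<mu>\<close> is from being shortest possible.
\<close>

lemma length_outer:
  assumes g: "g \<in> weyl \<Delta>" and m: "\<mu> \<in> coroot_lattice \<Delta>"
    and neg: "\<And>\<beta>. \<beta> \<in> P - PJ J \<Longrightarrow> \<mu> \<bullet> \<beta> \<le> - 1"
  shows "real (affine.inv_num (g \<circ> transl \<mu>)) =
    - (\<mu> \<bullet> outer_sum J) - real (wlength \<Delta> (min_rep \<Delta> J g)) + (\<Sum>\<beta>\<in>PJ J. \<bar>\<mu> \<bullet> \<beta> + neg_ind g \<beta>\<bar>)"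
proof -
  have PJP: "PJ J \<subseteq> P" by (auto simp: par_pos_roots_def)
  have "(\<Sum>\<beta>\<in>P - PJ J. \<bar>\<mu> \<bullet> \<beta> + neg_ind g \<beta>\<bar>) = (\<Sum>\<beta>\<in>P - PJ J. - (\<mu> \<bullet> \<beta>) - neg_ind g \<beta>)"
  proof (rule sum.cong[OF refl])
    fix \<beta> assume "\<beta> \<in> P - PJ J"
    then have "\<mu> \<bullet> \<beta> + neg_ind g \<beta> \<le> 0" using neg[of \<beta>] by simp
    then show "\<bar>\<mu> \<bullet> \<beta> + neg_ind g \<beta>\<bar> = - (\<mu> \<bullet> \<beta>) - neg_ind g \<beta>" by linarith
  qed
  also have "\<dots> = - (\<mu> \<bullet> outer_sum J) - real (card {\<beta> \<in> P - PJ J. g \<beta> \<notin> P})"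
    unfolding sum_subtractf sum_negf sum_neg_ind by (simp add: outer_sum_def inner_sum_right)
  finally have "(\<Sum>\<beta>\<in>P - PJ J. \<bar>\<mu> \<bullet> \<beta> + neg_ind g \<beta>\<bar>) =
      - (\<mu> \<bullet> outer_sum J) - real (wlength \<Delta> (min_rep \<Delta> J g))"
    by (simp add: wlength_min_rep[OF J g])
  moreover have "(\<Sum>\<beta>\<in>P. \<bar>\<mu> \<bullet> \<beta> + neg_ind g \<beta>\<bar>) =
      (\<Sum>\<beta>\<in>P - PJ J. \<bar>\<mu> \<bullet> \<beta> + neg_ind g \<beta>\<bar>) + (\<Sum>\<beta>\<in>PJ J. \<bar>\<mu> \<bullet> \<beta> + neg_ind g \<beta>\<bar>)"
    by (rule sum.subset_diff[OF PJP finite_pos])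
  ultimately show ?thesis unfolding affine_inv_num[OF g m] by linarith
qed

lemma balanced_defect: "balanced J g \<mu> \<longleftrightarrow> (\<Sum>\<beta>\<in>PJ J. \<bar>\<mu> \<bullet> \<beta> + neg_ind g \<beta>\<bar>) = 0"
proof -
  have fin: "finite (PJ J)" using finite_pos by (simp add: par_pos_roots_def)
  have "(\<Sum>\<beta>\<in>PJ J. \<bar>\<mu> \<bullet> \<beta> + neg_ind g \<beta>\<bar>) = 0 \<longleftrightarrow> (\<forall>\<beta>\<in>PJ J. \<bar>\<mu> \<bullet> \<beta> + neg_ind g \<beta>\<bar> = 0)"
    by (rule sum_nonneg_eq_0_iff[OF fin]) (rule abs_ge_zero)
  also have "\<dots> \<longleftrightarrow> balanced J g \<mu>" unfolding balanced_def abs_eq_0 eq_neg_iff_add_eq_0 ..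
  finally show ?thesis by blast
qed

text \<open>
  All summands of the length formula are nonpositive before the absolute value is taken, those
  of \<open>\<Phi>\<^sub>J\<^sup>+\<close> because they vanish.
\<close>

lemma length_balanced:
  assumes g: "g \<in> weyl \<Delta>" and m: "\<mu> \<in> coroot_lattice \<Delta>"
    and neg: "\<And>\<beta>. \<beta> \<in> P - PJ J \<Longrightarrow> \<mu> \<bullet> \<beta> \<le> - 1" and b: "balanced J g \<mu>"
  shows "real (affine.inv_num (g \<circ> transl \<mu>)) = - (\<mu> \<bullet> outer_sum {}) - real (wlength \<Delta> g)"
proof -
  have le: "\<mu> \<bullet> \<beta> + neg_ind g \<beta> \<le> 0" if "\<beta> \<in> P" for \<beta>
  proof (cases "\<beta> \<in> PJ J")
    case True
    then have "\<mu> \<bullet> \<beta> = - neg_ind g \<beta>" using b unfolding balanced_def by blast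
    then show ?thesis by linarith
  next
    case False
    then show ?thesis using neg[of \<beta>] that by simp
  qed
  have "(\<Sum>\<beta>\<in>P. \<bar>\<mu> \<bullet> \<beta> + neg_ind g \<beta>\<bar>) = (\<Sum>\<beta>\<in>P. - (\<mu> \<bullet> \<beta>) - neg_ind g \<beta>)"
  proof (rule sum.cong[OF refl])
    fix \<beta> assume "\<beta> \<in> P"
    then show "\<bar>\<mu> \<bullet> \<beta> + neg_ind g \<beta>\<bar> = - (\<mu> \<bullet> \<beta>) - neg_ind g \<beta>" using le[of \<beta>] by linarith
  qed
  also have "\<dots> = - (\<mu> \<bullet> outer_sum {}) - (\<Sum>\<beta>\<in>P. neg_ind g \<beta>)"
    unfolding sum_subtractf sum_negf by (simp add: outer_sum_def par_pos_empty inner_sum_right)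
  also have "(\<Sum>\<beta>\<in>P. neg_ind g \<beta>) = real (wlength \<Delta> g)"
  proof -
    have "(\<Sum>\<beta>\<in>P. neg_ind g \<beta>) = (\<Sum>\<beta>\<in>{\<beta> \<in> P. g \<beta> \<notin> P}. neg_ind g \<beta>)"
      by (rule sum.mono_neutral_right) (use finite_pos in auto)
    also have "\<dots> = (\<Sum>\<beta>\<in>{\<beta> \<in> P. g \<beta> \<notin> P}. 1)" by (rule sum.cong) auto
    finally show ?thesis by (simp add: wlength_eq[OF g])
  qed
  finally show ?thesis unfolding affine_inv_num[OF g m] .
qed

lemma z_elem_weyl: "J_adjusted \<Phi> \<Delta> J \<mu> \<Longrightarrow> z_elem \<Phi> \<Delta> J \<mu> \<in> weyl J"
  using z_elem_straightens[OF J] by (simp add: straightens_def)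

lemma balanced_min_rep:
  assumes w: "w \<in> min_reps \<Delta> J" and a: "J_adjusted \<Phi> \<Delta> J \<mu>"
  shows "balanced J (w \<circ> z_elem \<Phi> \<Delta> J \<mu>) \<mu>"
  unfolding balanced_def
proof
  let ?z = "z_elem \<Phi> \<Delta> J \<mu>"
  fix \<beta> assume b: "\<beta> \<in> PJ J"
  have z: "straightens J ?z \<mu>" by (rule z_elem_straightens[OF J a])
  have zW: "?z \<in> weyl J" by (rule z_elem_weyl[OF a])
  have wW: "w \<in> weyl \<Delta>" and wpos: "\<And>\<gamma>. \<gamma> \<in> PJ J \<Longrightarrow> w \<gamma> \<in> P" using w min_reps_iff[OF J] by auto
  have "\<beta> \<in> par_roots \<Phi> J" using b by (simp add: par_pos_roots_def)
  then have zb: "?z \<beta> \<in> par_roots \<Phi> J" by (rule weyl_par_root[OF zW J])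
  show "\<mu> \<bullet> \<beta> = - neg_ind (w \<circ> ?z) \<beta>"
  proof (cases "?z \<beta> \<in> P")
    case True
    then have "?z \<beta> \<in> PJ J" using zb by (simp add: par_pos_roots_def)
    then have "w (?z \<beta>) \<in> P" by (rule wpos)
    moreover have "\<mu> \<bullet> \<beta> = 0" using z b True by (simp add: straightens_def)
    ultimately show ?thesis by simp
  next
    case False
    then have "- ?z \<beta> \<in> PJ J" using par_pos_or_neg[OF J zb] by (auto simp: par_pos_roots_def)
    then have "- w (?z \<beta>) \<in> P" using wpos weyl_minus[OF wW] by metis
    then have "w (?z \<beta>) \<notin> P" using uminus_notin_pos by fastforce
    moreover have "\<mu> \<bullet> \<beta> \<noteq> 0" using z b False by (simp add: straightens_def)
    then have "\<mu> \<bullet> \<beta> = - 1" using a b unfolding J_adjusted_iff[OF J] minuscule_on_def by blast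
    ultimately show ?thesis by simp
  qed
qed

text \<open>
  The inversions of \<open>g\<close> in \<open>\<Phi>\<^sub>J\<^sup>+\<close> are those of \<open>z\<^sub>\<mu>\<close>, so \<open>g z\<^sub>\<mu>\<^sup>-\<^sup>1\<close> has none there.
\<close>

lemma balanced_adjusted:
  assumes g: "g \<in> weyl \<Delta>" and m: "\<mu> \<in> coroot_lattice \<Delta>" and b: "balanced J g \<mu>"
  shows "J_adjusted \<Phi> \<Delta> J \<mu>" and "g \<circ> inv (z_elem \<Phi> \<Delta> J \<mu>) \<in> min_reps \<Delta> J"
proof -
  have pair: "\<mu> \<bullet> \<beta> = - neg_ind g \<beta>" if "\<beta> \<in> PJ J" for \<beta> using b that unfolding balanced_def by blast
  show a: "J_adjusted \<Phi> \<Delta> J \<mu>"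
    unfolding J_adjusted_iff[OF J] minuscule_on_def using m pair by simp
  let ?z = "z_elem \<Phi> \<Delta> J \<mu>"
  have iz: "inv ?z \<in> weyl \<Delta>" using weyl_inv[OF z_elem_weyl[OF a]] weyl_mono[OF J] by blast
  have "g (inv ?z \<beta>) \<in> P" if "\<beta> \<in> PJ J" for \<beta>
  proof (rule straightens_comp_inv[OF J z_elem_straightens[OF J a] _ g that])
    show "g \<beta> \<in> P \<longleftrightarrow> \<mu> \<bullet> \<beta> = 0" if "\<beta> \<in> PJ J" for \<beta> using pair[OF that] by simp
  qed
  then show "g \<circ> inv ?z \<in> min_reps \<Delta> J" using weyl_comp[OF g iz] by (simp add: min_reps_iff[OF J])
qed

lemma Omega_intro:
  assumes g: "g \<in> weyl \<Delta>" and s: "J_superantidominant \<Phi> \<Delta> J M \<mu>" and b: "balanced J g \<mu>"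
  shows "g \<circ> transl \<mu> \<in> Omega_J \<Phi> \<Delta> J M"
proof -
  have m: "\<mu> \<in> coroot_lattice \<Delta>" using s by (simp add: J_superantidominant_def)
  note a = balanced_adjusted[OF g m b]
  let ?z = "z_elem \<Phi> \<Delta> J \<mu>"
  have "g = g \<circ> inv ?z \<circ> ?z" by (simp add: fun_eq_iff weyl_inv_left[OF z_elem_weyl[OF a(1)]])
  then have "g \<circ> transl \<mu> = g \<circ> inv ?z \<circ> ?z \<circ> transl \<mu>" by simp
  then show ?thesis unfolding Omega_J_def using s a by blast
qed

lemma superantidominantI:
  assumes "\<mu> \<in> coroot_lattice \<Delta>" "balanced J g \<mu>" "\<And>\<beta>. \<beta> \<in> P - PJ J \<Longrightarrow> \<mu> \<bullet> \<beta> \<le> - real M"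
  shows "J_superantidominant \<Phi> \<Delta> J M \<mu>"
  unfolding J_superantidominant_def
proof (intro conjI ballI)
  fix \<beta> assume b: "\<beta> \<in> P"
  show "\<mu> \<bullet> \<beta> \<le> 0"
  proof (cases "\<beta> \<in> PJ J")
    case True
    then have "\<mu> \<bullet> \<beta> = - neg_ind g \<beta>" using assms(2) unfolding balanced_def by blast
    then show ?thesis by simp
  next
    case False
    then show ?thesis using assms(3)[of \<beta>] b by (simp add: order_trans)
  qed
qed (use assms in auto)

lemma superantidominant_le: "J_superantidominant \<Phi> \<Delta> J M \<mu> \<Longrightarrow> \<beta> \<in> P - PJ J \<Longrightarrow> \<mu> \<bullet> \<beta> \<le> - real M"
  by (simp add: J_superantidominant_def)

text \<open>
  If \<open>z = z\<^sub>\<nu>\<close>, then \<open>\<nu> + \<phi>\<^sub>J(\<nu>)\<close> is \<open>J\<close>-adjusted with the same \<open>z\<close>, and subtracting a large multiple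
  of an element as in \<open>outer_coroot_sum\<close> keeps this and makes it superantidominant.
\<close>

lemma superantidominant_exists:
  assumes z: "z \<in> Sigma_J \<Phi> \<Delta> J"
  shows "\<exists>\<mu>. J_superantidominant \<Phi> \<Delta> J N \<mu> \<and> J_adjusted \<Phi> \<Delta> J \<mu> \<and> z = z_elem \<Phi> \<Delta> J \<mu>"
proof -
  obtain \<nu> where n: "\<nu> \<in> coroot_lattice \<Delta>" "z = z_elem \<Phi> \<Delta> J \<nu>" using z by (auto simp: Sigma_J_def)
  obtain \<phi> j where d: "J_decomp \<Phi> \<Delta> J \<nu> \<phi> j" using J_decomp_exists[OF J n(1)] by blast
  have s: "straightens J z (\<nu> + \<phi>)"
    using z_prod_straightens[OF J d] z_elem_eq[OF J d z_prod_straightens[OF J d]] n(2) by metis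
  have min: "minuscule_on J (\<nu> + \<phi>)" by (rule J_decomp_minuscule[OF J d])
  have f: "\<phi> \<in> coroot_lattice J" using d by (simp add: J_decomp_def)
  have lat: "\<nu> + \<phi> \<in> coroot_lattice \<Delta>"
    using f n coroot_lattice_mono[OF J order_refl] int_span_add unfolding coroot_lattice_def by blast
  obtain \<eta> where e: "\<eta> \<in> coroot_lattice \<Delta>" "\<And>\<beta>. \<beta> \<in> PJ J \<Longrightarrow> \<eta> \<bullet> \<beta> = 0" "\<And>\<beta>. \<beta> \<in> P - PJ J \<Longrightarrow> 1 \<le> \<eta> \<bullet> \<beta>"
    using outer_coroot_sum[OF J] by blast
  \<comment> \<open>large enough to outweigh every pairing of \<open>\<nu> + \<phi>\<close> with a positive root\<close>
  define m where "m = nat \<lceil>real N + (\<Sum>\<beta>\<in>P. \<bar>(\<nu> + \<phi>) \<bullet> \<beta>\<bar>)\<rceil>"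
  have m: "real N + (\<Sum>\<beta>\<in>P. \<bar>(\<nu> + \<phi>) \<bullet> \<beta>\<bar>) \<le> real m" unfolding m_def by (rule real_nat_ceiling_ge)
  let ?\<mu> = "(\<nu> + \<phi>) - of_int (int m) *\<^sub>R \<eta>"
  have mlat: "?\<mu> \<in> coroot_lattice \<Delta>"
    using lat e(1) int_span_diff int_span_scale unfolding coroot_lattice_def by blast
  have inner: "?\<mu> \<bullet> \<beta> = (\<nu> + \<phi>) \<bullet> \<beta>" if "\<beta> \<in> PJ J" for \<beta>
    using e(2)[OF that] by (simp add: inner_diff_left)
  have outer: "?\<mu> \<bullet> \<beta> \<le> - real N" if b: "\<beta> \<in> P - PJ J" for \<beta>
  proof -
    have "(\<nu> + \<phi>) \<bullet> \<beta> \<le> \<bar>(\<nu> + \<phi>) \<bullet> \<beta>\<bar>" by simp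
    also have "\<dots> \<le> (\<Sum>\<beta>\<in>P. \<bar>(\<nu> + \<phi>) \<bullet> \<beta>\<bar>)" using b by (intro member_le_sum finite_pos) auto
    finally have 1: "(\<nu> + \<phi>) \<bullet> \<beta> \<le> (\<Sum>\<beta>\<in>P. \<bar>(\<nu> + \<phi>) \<bullet> \<beta>\<bar>)" .
    have "real m * 1 \<le> real m * (\<eta> \<bullet> \<beta>)" using e(3)[OF b] by (intro mult_left_mono) auto
    then have "real m \<le> real m * (\<eta> \<bullet> \<beta>)" by simp
    moreover have "?\<mu> \<bullet> \<beta> = (\<nu> + \<phi>) \<bullet> \<beta> - real m * (\<eta> \<bullet> \<beta>)" by (simp add: inner_diff_left)
    ultimately show ?thesis using 1 m by linarith
  qed
  have mm: "minuscule_on J ?\<mu>" using min inner unfolding minuscule_on_def by metis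
  then have adj: "J_adjusted \<Phi> \<Delta> J ?\<mu>" using J_adjusted_iff[OF J] mlat by blast
  have "straightens J z ?\<mu>" using s inner unfolding straightens_def by metis
  then have "z_elem \<Phi> \<Delta> J ?\<mu> = z" by (rule z_elem_adjusted_eq[OF J adj])
  moreover have "J_superantidominant \<Phi> \<Delta> J N ?\<mu>"
    unfolding J_superantidominant_def
  proof (intro conjI ballI)
    fix \<beta> assume b: "\<beta> \<in> P"
    show "?\<mu> \<bullet> \<beta> \<le> 0"
    proof (cases "\<beta> \<in> PJ J")
      case True
      then have "?\<mu> \<bullet> \<beta> = 0 \<or> ?\<mu> \<bullet> \<beta> = - 1" using mm unfolding minuscule_on_def by blast
      then show ?thesis by linarith
    next
      case False
      then have "?\<mu> \<bullet> \<beta> \<le> - real N" using outer b by blast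
      then show ?thesis by linarith
    qed
  qed (use mlat outer in auto)
  ultimately show ?thesis using adj by blast
qed

lemma root_conj:
  assumes "z \<in> weyl J" shows "z \<circ> root_refl (inv z \<alpha>) = root_refl \<alpha> \<circ> z"
proof
  fix v
  show "(z \<circ> root_refl (inv z \<alpha>)) v = (root_refl \<alpha> \<circ> z) v"
    using root_refl_orthogonal[OF orthogonal_weyl[OF assms], of "inv z \<alpha>" v] by (simp add: weyl_inv_right[OF assms])
qed

lemma reflection_translation:
  assumes w: "w \<in> weyl \<Delta>" and z: "z \<in> weyl J"
  shows "w \<circ> z \<circ> transl \<mu> \<circ> affine_refl (inv z \<alpha>, \<kappa> + \<mu> \<bullet> inv z \<alpha>) =
      w \<circ> root_refl \<alpha> \<circ> z \<circ> transl (\<mu> + \<kappa> *\<^sub>R coroot (inv z \<alpha>))"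
    and "w \<circ> root_refl \<alpha> \<circ> transl (\<kappa> *\<^sub>R coroot \<alpha>) \<circ> z \<circ> transl \<mu> =
      w \<circ> root_refl \<alpha> \<circ> z \<circ> transl (\<mu> + \<kappa> *\<^sub>R coroot (inv z \<alpha>))"
proof -
  have zD: "z \<in> weyl \<Delta>" using z weyl_mono[OF J] by blast
  have wz: "w \<circ> z \<in> weyl \<Delta>" by (rule weyl_comp[OF w zD])
  have "w \<circ> z \<circ> transl \<mu> \<circ> affine_refl (inv z \<alpha>, \<kappa> + \<mu> \<bullet> inv z \<alpha>) =
      w \<circ> z \<circ> root_refl (inv z \<alpha>) \<circ> transl (\<mu> + ((\<kappa> + \<mu> \<bullet> inv z \<alpha>) - \<mu> \<bullet> inv z \<alpha>) *\<^sub>R coroot (inv z \<alpha>))"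
    by (rule transl_comp_affine_refl[OF wz])
  also have "w \<circ> z \<circ> root_refl (inv z \<alpha>) = w \<circ> root_refl \<alpha> \<circ> z"
    by (simp only: comp_assoc root_conj[OF z])
  finally show "w \<circ> z \<circ> transl \<mu> \<circ> affine_refl (inv z \<alpha>, \<kappa> + \<mu> \<bullet> inv z \<alpha>) =
      w \<circ> root_refl \<alpha> \<circ> z \<circ> transl (\<mu> + \<kappa> *\<^sub>R coroot (inv z \<alpha>))"
    unfolding add_diff_cancel_right' .
  have "inv z (\<kappa> *\<^sub>R coroot \<alpha>) = \<kappa> *\<^sub>R coroot (inv z \<alpha>)"
    unfolding coroot_orthogonal[OF orthogonal_weyl[OF weyl_inv[OF z]]]
    by (rule linear_scale[OF linear_weyl[OF weyl_inv[OF z]]])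
  then have "transl (\<kappa> *\<^sub>R coroot \<alpha>) \<circ> z \<circ> transl \<mu> = z \<circ> transl (\<mu> + \<kappa> *\<^sub>R coroot (inv z \<alpha>))"
    unfolding transl_weyl[OF z] by (simp only: comp_assoc transl_comp add.commute)
  then show "w \<circ> root_refl \<alpha> \<circ> transl (\<kappa> *\<^sub>R coroot \<alpha>) \<circ> z \<circ> transl \<mu> =
      w \<circ> root_refl \<alpha> \<circ> z \<circ> transl (\<mu> + \<kappa> *\<^sub>R coroot (inv z \<alpha>))" by (simp only: comp_assoc)
qed

lemma affine_decomp_unique:
  assumes "g \<in> weyl \<Delta>" "h \<in> weyl \<Delta>" "g \<circ> transl \<mu> = h \<circ> transl \<nu>"
  shows "g = h" "\<mu> = \<nu>"
proof -
  have eq: "g v + g \<mu> = h v + h \<nu>" for v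
    using fun_cong[OF assms(3), of v] linear_add[OF linear_weyl[OF assms(1)]] linear_add[OF linear_weyl[OF assms(2)]]
    by (simp add: transl_def)
  have "g \<mu> = h \<nu>" using eq[of 0] linear_0[OF linear_weyl[OF assms(1)]] linear_0[OF linear_weyl[OF assms(2)]] by simp
  then show gh: "g = h" using eq by (simp add: fun_eq_iff)
  then have "inv h (h \<mu>) = inv h (h \<nu>)" using \<open>g \<mu> = h \<nu>\<close> by simp
  then show "\<mu> = \<nu>" by (simp only: weyl_inv_left[OF assms(2)])
qed

text \<open>
  What both directions need to know about \<open>x = w z t\<^sub>\<mu>\<close> and its product with the reflection in
  \<open>\<beta> + (\<kappa> + \<langle>\<mu>, \<beta>\<rangle>)\<delta>\<close>, where \<open>\<beta> = z\<^sup>-\<^sup>1\<alpha>\<close>.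
\<close>

lemma reflection_setup:
  assumes w: "w \<in> min_reps \<Delta> J" and a: "J_adjusted \<Phi> \<Delta> J \<mu>" and al: "\<alpha> \<in> P - PJ J"
    and k: "\<kappa> \<in> \<int>"
  defines "z \<equiv> z_elem \<Phi> \<Delta> J \<mu>"
  defines "\<beta> \<equiv> inv z \<alpha>"
  defines "\<mu>' \<equiv> \<mu> + \<kappa> *\<^sub>R coroot \<beta>"
  shows "\<beta> \<in> P - PJ J" "\<beta> \<in> \<Phi>" "\<beta> \<notin> par_roots \<Phi> J" "\<mu> \<in> coroot_lattice \<Delta>" "\<mu>' \<in> coroot_lattice \<Delta>"
    "w \<in> weyl \<Delta>" "z \<in> weyl J" "w \<circ> z \<in> weyl \<Delta>" "w \<circ> root_refl \<alpha> \<in> weyl \<Delta>" "w \<circ> root_refl \<alpha> \<circ> z \<in> weyl \<Delta>"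
    "w \<circ> z \<circ> transl \<mu> \<in> Waf" "(\<beta>, \<kappa> + \<mu> \<bullet> \<beta>) \<in> affine_roots \<Phi>" "\<kappa> + \<mu> \<bullet> \<beta> \<in> \<int>"
    "\<mu>' \<bullet> outer_sum J = \<mu> \<bullet> outer_sum J + \<kappa> * (coroot \<alpha> \<bullet> outer_sum J)"
proof -
  show z: "z \<in> weyl J" unfolding z_def by (rule z_elem_weyl[OF a])
  have zD: "z \<in> weyl \<Delta>" using z weyl_mono[OF J] by blast
  show b: "\<beta> \<in> P - PJ J" unfolding \<beta>_def by (rule weyl_pos_outside[OF weyl_inv[OF z] J al])
  then show bP: "\<beta> \<in> \<Phi>" using pos_root by blast
  show "\<beta> \<notin> par_roots \<Phi> J" using b by (auto simp: par_pos_roots_def)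
  show m: "\<mu> \<in> coroot_lattice \<Delta>" using a by (simp add: J_adjusted_def)
  have "coroot \<beta> \<in> coroot_lattice \<Delta>" using coroot_in_lattice[OF order_refl] bP par_roots_simple by simp
  then show "\<mu>' \<in> coroot_lattice \<Delta>"
    unfolding \<mu>'_def using m k int_span_add int_span_scale_Ints unfolding coroot_lattice_def by blast
  show w: "w \<in> weyl \<Delta>" using w by (rule min_reps_weyl)
  show wz: "w \<circ> z \<in> weyl \<Delta>" by (rule weyl_comp[OF w zD])
  have "root_refl \<alpha> \<in> weyl \<Delta>" using root_refl_in_weyl_full al pos_root by blast
  then show wr: "w \<circ> root_refl \<alpha> \<in> weyl \<Delta>" by (rule weyl_comp[OF w])
  show "w \<circ> root_refl \<alpha> \<circ> z \<in> weyl \<Delta>" by (rule weyl_comp[OF wr zD])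
  show "w \<circ> z \<circ> transl \<mu> \<in> Waf" by (rule affine_weylI[OF wz m])
  show n: "\<kappa> + \<mu> \<bullet> \<beta> \<in> \<int>" using k coroot_lattice_pairing[OF m bP] by simp
  show "(\<beta>, \<kappa> + \<mu> \<bullet> \<beta>) \<in> affine_roots \<Phi>" using n bP by (simp add: affine_roots_def)
  have "coroot \<beta> \<bullet> outer_sum J = coroot \<alpha> \<bullet> outer_sum J"
    unfolding \<beta>_def by (rule coroot_outer_sum_weyl[OF J weyl_inv[OF z]])
  then show "\<mu>' \<bullet> outer_sum J = \<mu> \<bullet> outer_sum J + \<kappa> * (coroot \<alpha> \<bullet> outer_sum J)"
    by (simp add: \<mu>'_def inner_add_left)
qed

lemma affine_neg_rootI: "\<beta> \<in> \<Phi> \<Longrightarrow> n \<in> \<int> \<Longrightarrow> n < 0 \<Longrightarrow> (\<beta>, n) \<in> affine_neg_roots \<Phi> \<Delta>"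
  unfolding affine_neg_roots_def
  by (rule image_eqI[of _ _ "(- \<beta>, - n)"]) (simp_all add: affine_pos_iff uminus_root)

section \<open>Edges lift to covers\<close>

text \<open>
  The threshold for \<open>\<mu>\<close> exceeds the one asked of the cover, because the translation part of \<open>y\<close>
  may differ from \<open>\<mu>\<close> by a coroot. The element \<open>y\<close> is in \<open>\<Omega>\<^sub>J\<^sup>\<infinity>\<close> once the contribution of \<open>\<Phi>\<^sub>J\<^sup>+\<close> to
  its length vanishes.
\<close>

lemma edge_lifts:
  assumes M: "1 \<le> M" and MN: "M + 1 \<le> N" and C: "\<And>\<gamma> \<delta>. \<gamma> \<in> \<Phi> \<Longrightarrow> \<delta> \<in> \<Phi> \<Longrightarrow> real M + coroot \<gamma> \<bullet> \<delta> \<le> real N"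
    and edge: "\<kappa> = 0 \<and> qb_bruhat_edge \<Phi> \<Delta> J w \<alpha> v \<or> \<kappa> = 1 \<and> qb_quantum_edge \<Phi> \<Delta> J w \<alpha> v"
    and s: "J_superantidominant \<Phi> \<Delta> J N \<mu>" and a: "J_adjusted \<Phi> \<Delta> J \<mu>"
  defines "z \<equiv> z_elem \<Phi> \<Delta> J \<mu>"
  defines "x \<equiv> w \<circ> z \<circ> transl \<mu>"
  defines "\<gamma> \<equiv> (inv z \<alpha>, \<kappa> + \<mu> \<bullet> inv z \<alpha>)"
  shows "\<gamma> \<in> affine_neg_roots \<Phi> \<Delta>" "Omega_cover \<Phi> \<Delta> J M (x \<circ> affine_refl \<gamma>) x"
proof -
  have lab: "w \<in> min_reps \<Delta> J" "\<alpha> \<in> P - PJ J" "v = min_rep \<Delta> J (w \<circ> root_refl \<alpha>)"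
    using edge unfolding qb_bruhat_edge_def qb_quantum_edge_def qb_label_def by auto
  have k01: "\<kappa> = 0 \<or> \<kappa> = 1" using edge by blast
  then have kint: "\<kappa> \<in> \<int>" by auto
  let ?\<beta> = "inv z \<alpha>" and ?\<mu>' = "\<mu> + \<kappa> *\<^sub>R coroot (inv z \<alpha>)" and ?h = "w \<circ> root_refl \<alpha> \<circ> z"
  note S = reflection_setup[OF lab(1) a lab(2) kint, folded z_def]
  have y: "x \<circ> affine_refl \<gamma> = ?h \<circ> transl ?\<mu>'"
    unfolding x_def \<gamma>_def by (rule reflection_translation(1)[OF S(6) S(7)])
  have muN: "\<mu> \<bullet> \<delta> \<le> - real N" if "\<delta> \<in> P - PJ J" for \<delta> by (rule superantidominant_le[OF s that])
  have mu'M: "?\<mu>' \<bullet> \<delta> \<le> - real M" if d: "\<delta> \<in> P - PJ J" for \<delta>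
  proof -
    have "\<delta> \<in> \<Phi>" using d pos_root by blast
    then have "real M + coroot ?\<beta> \<bullet> \<delta> \<le> real N" using C S(2) by blast
    then show ?thesis using muN[OF d] k01 MN by (auto simp: inner_add_left)
  qed
  have mu1: "\<mu> \<bullet> \<delta> \<le> - 1" if "\<delta> \<in> P - PJ J" for \<delta> using muN[OF that] M MN by linarith
  have mu'1: "?\<mu>' \<bullet> \<delta> \<le> - 1" if "\<delta> \<in> P - PJ J" for \<delta> using mu'M[OF that] M by linarith
  have n0: "\<kappa> + \<mu> \<bullet> ?\<beta> < 0" using muN[OF S(1)] k01 M MN by auto
  show neg: "\<gamma> \<in> affine_neg_roots \<Phi> \<Delta>" unfolding \<gamma>_def by (rule affine_neg_rootI[OF S(2) S(13) n0])
  have aff: "\<gamma> \<in> affine_roots \<Phi>" unfolding \<gamma>_def by (rule S(12))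
  have xW: "x \<in> Waf" unfolding x_def by (rule S(11))
  have balx: "balanced J (w \<circ> z) \<mu>" unfolding z_def by (rule balanced_min_rep[OF lab(1) a])
  have "min_rep \<Delta> J (w \<circ> z) = w" by (rule min_rep_eqI[OF J lab(1) S(7)])
  then have lenx: "real (affine.inv_num x) = - (\<mu> \<bullet> outer_sum J) - real (wlength \<Delta> w)"
    using length_outer[OF S(8) S(4) mu1] balx unfolding x_def balanced_defect by simp
  have mv: "min_rep \<Delta> J ?h = v" unfolding lab(3) by (rule min_rep_comp[OF J S(9) S(7)])
  \<comment> \<open>the contribution of \<open>\<Phi>\<^sub>J\<^sup>+\<close> to the length of \<open>y\<close>\<close>
  let ?D = "\<Sum>\<delta>\<in>PJ J. \<bar>?\<mu>' \<bullet> \<delta> + neg_ind ?h \<delta>\<bar>"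
  have leny: "real (affine.inv_num (x \<circ> affine_refl \<gamma>)) =
      - (\<mu> \<bullet> outer_sum J + \<kappa> * (coroot \<alpha> \<bullet> outer_sum J)) - real (wlength \<Delta> v) + ?D"
    using length_outer[OF S(10) S(5) mu'1] unfolding y mv S(14) .
  have D: "?D = 0 \<and> affine.inv_num x = affine.inv_num (x \<circ> affine_refl \<gamma>) + 1"
    using edge
  proof
    assume e: "\<kappa> = 0 \<and> qb_bruhat_edge \<Phi> \<Delta> J w \<alpha> v"
    then have len: "wlength \<Delta> (w \<circ> root_refl \<alpha>) = wlength \<Delta> w + 1" by (simp add: qb_bruhat_edge_def)
    have wr: "w \<circ> root_refl \<alpha> \<in> min_reps \<Delta> J" by (rule bruhat_cover_min_rep(1)[OF J lab(1,2) len])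
    have "balanced J ?h \<mu>" unfolding z_def by (rule balanced_min_rep[OF wr a])
    then have D0: "?D = 0" using e unfolding balanced_defect by simp
    have "v = w \<circ> root_refl \<alpha>" unfolding lab(3) by (rule min_rep_id[OF J wr])
    then show ?thesis using D0 leny lenx len e by simp
  next
    assume e: "\<kappa> = 1 \<and> qb_quantum_edge \<Phi> \<Delta> J w \<alpha> v"
    then have len: "real (wlength \<Delta> v) = real (wlength \<Delta> w) + 1 - coroot \<alpha> \<bullet> outer_sum J"
      by (simp add: qb_quantum_edge_def outer_sum_half_sums)
    have D1: "real (affine.inv_num (x \<circ> affine_refl \<gamma>)) = real (affine.inv_num x) - 1 + ?D"
      using leny lenx len e by simp
    have Dnn: "0 \<le> ?D" by (rule sum_nonneg) simp
    \<comment> \<open>\<open>-\<gamma>\<close> is a positive affine root that \<open>x\<close> makes negative, so \<open>y\<close> is shorter than \<open>x\<close>\<close>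
    have pos: "- \<gamma> \<in> AP"
      unfolding \<gamma>_def uminus_Pair affine_pos_iff using uminus_root[OF S(2)] Ints_minus[OF S(13)] n0 by simp
    have "affine_act x (- \<gamma>) = (- (w \<circ> z) ?\<beta>, - \<kappa>)"
      unfolding x_def \<gamma>_def uminus_Pair affine_act_eq[OF S(8)] by (simp only: weyl_minus[OF S(8)]) simp
    then have "affine_act x (- \<gamma>) \<notin> AP" using e by (simp add: affine_pos_iff)
    then have "affine.inv_num (x \<circ> affine_refl (- \<gamma>)) < affine.inv_num x"
      by (rule affine.inv_num_comp_refl_less[OF xW pos])
    then have "real (affine.inv_num (x \<circ> affine_refl \<gamma>)) + 1 \<le> real (affine.inv_num x)"
      unfolding affine_refl_uminus by linarith
    then have "?D = 0" using D1 Dnn by linarith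
    then show ?thesis using D1 by linarith
  qed
  have balh: "balanced J ?h ?\<mu>'" unfolding balanced_defect using D by blast
  have sy: "J_superantidominant \<Phi> \<Delta> J M ?\<mu>'" by (rule superantidominantI[OF S(5) balh mu'M])
  have yO: "x \<circ> affine_refl \<gamma> \<in> Omega_J \<Phi> \<Delta> J M" unfolding y by (rule Omega_intro[OF S(10) sy balh])
  have "\<mu> \<bullet> \<delta> \<le> - real M" if "\<delta> \<in> P - PJ J" for \<delta> using muN[OF that] MN by linarith
  then have "J_superantidominant \<Phi> \<Delta> J M \<mu>" by (rule superantidominantI[OF S(4) balx])
  then have xO: "x \<in> Omega_J \<Phi> \<Delta> J M" unfolding x_def by (rule Omega_intro[OF S(8) _ balx])
  have cov: "affine_cover \<Phi> \<Delta> (x \<circ> affine_refl \<gamma>) x" using affine_cover_iff[OF xW aff] D by blast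
  have "fst \<gamma> \<in> \<Phi> - par_roots \<Phi> J" unfolding \<gamma>_def using S(2,3) by simp
  then show "Omega_cover \<Phi> \<Delta> J M (x \<circ> affine_refl \<gamma>) x"
    unfolding Omega_cover_def using xO yO cov aff by blast
qed

lemma edges_lift_to_covers:
  assumes M: "2 \<le> M"
  shows "\<exists>N\<ge>M.
      (\<forall>z\<in>Sigma_J \<Phi> \<Delta> J.
         \<exists>\<mu>. J_superantidominant \<Phi> \<Delta> J N \<mu> \<and> J_adjusted \<Phi> \<Delta> J \<mu> \<and> z = z_elem \<Phi> \<Delta> J \<mu>) \<and>
      (\<forall>w \<alpha> v z \<mu> \<kappa>.
         (\<kappa> = 0 \<and> qb_bruhat_edge \<Phi> \<Delta> J w \<alpha> v \<or> \<kappa> = 1 \<and> qb_quantum_edge \<Phi> \<Delta> J w \<alpha> v) \<and>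
         z \<in> Sigma_J \<Phi> \<Delta> J \<and>
         J_superantidominant \<Phi> \<Delta> J N \<mu> \<and> J_adjusted \<Phi> \<Delta> J \<mu> \<and> z = z_elem \<Phi> \<Delta> J \<mu> \<longrightarrow>
         (let x = w \<circ> z \<circ> transl \<mu>;
              \<alpha>' = (inv z \<alpha>, \<kappa> + \<mu> \<bullet> inv z \<alpha>);
              y = x \<circ> affine_refl \<alpha>'
          in y = w \<circ> root_refl \<alpha> \<circ> transl (\<kappa> *\<^sub>R coroot \<alpha>) \<circ> z \<circ> transl \<mu> \<and>
             \<alpha>' \<in> affine_neg_roots \<Phi> \<Delta> \<and>
             Omega_cover \<Phi> \<Delta> J M y x))"
proof -
  obtain C :: nat where C: "\<And>\<gamma> \<delta>. \<gamma> \<in> \<Phi> \<Longrightarrow> \<delta> \<in> \<Phi> \<Longrightarrow> coroot \<gamma> \<bullet> \<delta> \<le> real C"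
    using coroot_pairing_bound by blast
  show ?thesis
  proof (rule exI[of _ "M + C + 1"], intro conjI ballI allI impI)
    fix z assume "z \<in> Sigma_J \<Phi> \<Delta> J"
    then show "\<exists>\<mu>. J_superantidominant \<Phi> \<Delta> J (M + C + 1) \<mu> \<and> J_adjusted \<Phi> \<Delta> J \<mu> \<and> z = z_elem \<Phi> \<Delta> J \<mu>"
      by (rule superantidominant_exists)
  next
    fix w v z :: "'a \<Rightarrow> 'a" and \<alpha> \<mu> :: 'a and \<kappa> :: real
    assume "(\<kappa> = 0 \<and> qb_bruhat_edge \<Phi> \<Delta> J w \<alpha> v \<or> \<kappa> = 1 \<and> qb_quantum_edge \<Phi> \<Delta> J w \<alpha> v) \<and>
       z \<in> Sigma_J \<Phi> \<Delta> J \<and>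
       J_superantidominant \<Phi> \<Delta> J (M + C + 1) \<mu> \<and> J_adjusted \<Phi> \<Delta> J \<mu> \<and> z = z_elem \<Phi> \<Delta> J \<mu>"
    then have e: "\<kappa> = 0 \<and> qb_bruhat_edge \<Phi> \<Delta> J w \<alpha> v \<or> \<kappa> = 1 \<and> qb_quantum_edge \<Phi> \<Delta> J w \<alpha> v"
      and s: "J_superantidominant \<Phi> \<Delta> J (M + C + 1) \<mu>" and a: "J_adjusted \<Phi> \<Delta> J \<mu>"
      and z: "z = z_elem \<Phi> \<Delta> J \<mu>" by blast+
    have "w \<in> min_reps \<Delta> J" using e unfolding qb_bruhat_edge_def qb_quantum_edge_def qb_label_def by blast
    then have w: "w \<in> weyl \<Delta>" by (rule min_reps_weyl)
    have zJ: "z \<in> weyl J" unfolding z by (rule z_elem_weyl[OF a])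
    have M1: "1 \<le> M" "M + 1 \<le> M + C + 1" using M by auto
    have bound: "real M + coroot \<gamma> \<bullet> \<delta> \<le> real (M + C + 1)" if "\<gamma> \<in> \<Phi>" "\<delta> \<in> \<Phi>" for \<gamma> \<delta>
      using C[OF that] by simp
    have "w \<circ> z \<circ> transl \<mu> \<circ> affine_refl (inv z \<alpha>, \<kappa> + \<mu> \<bullet> inv z \<alpha>) =
        w \<circ> root_refl \<alpha> \<circ> transl (\<kappa> *\<^sub>R coroot \<alpha>) \<circ> z \<circ> transl \<mu>"
      unfolding reflection_translation[OF w zJ] ..
    then show "let x = w \<circ> z \<circ> transl \<mu>;
            \<alpha>' = (inv z \<alpha>, \<kappa> + \<mu> \<bullet> inv z \<alpha>);
            y = x \<circ> affine_refl \<alpha>'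
        in y = w \<circ> root_refl \<alpha> \<circ> transl (\<kappa> *\<^sub>R coroot \<alpha>) \<circ> z \<circ> transl \<mu> \<and>
           \<alpha>' \<in> affine_neg_roots \<Phi> \<Delta> \<and>
           Omega_cover \<Phi> \<Delta> J M y x"
      unfolding Let_def using edge_lifts[OF M1 bound e s a, folded z] by blast
  qed simp
qed

section \<open>Covers project to edges\<close>

text \<open>
  A cover lowers the length by one. Writing the two lengths by means of \<open>W\<close> and by means of
  \<open>W\<^sup>J\<close> gives one edge condition each, and the first one also bounds \<open>\<kappa>\<close>.
\<close>

lemma covers_project_to_edges:
  assumes M: "2 \<le> M" and cov: "Omega_cover \<Phi> \<Delta> J M y x"
  shows "\<exists>w z \<mu> \<alpha> n \<gamma>.
         w \<in> min_reps \<Delta> J \<and> z = z_elem \<Phi> \<Delta> J \<mu> \<and> z \<in> weyl J \<and>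
         J_superantidominant \<Phi> \<Delta> J M \<mu> \<and> J_adjusted \<Phi> \<Delta> J \<mu> \<and>
         x = w \<circ> z \<circ> transl \<mu> \<and>
         \<alpha> \<in> pos_roots \<Phi> \<Delta> - par_pos_roots \<Phi> \<Delta> J \<and> n \<in> \<int> \<and>
         \<gamma> = (inv z \<alpha>, n) \<and> \<gamma> \<in> affine_roots \<Phi> \<and> y = x \<circ> affine_refl \<gamma> \<and>
         (let \<kappa> = n - \<mu> \<bullet> inv z \<alpha>
          in \<kappa> \<in> {0, 1} \<and>
             \<gamma> = (inv z \<alpha>, \<kappa> + \<mu> \<bullet> inv z \<alpha>) \<and> \<gamma> \<in> affine_neg_roots \<Phi> \<Delta> \<and>
             (\<kappa> = 0 \<longrightarrow>
                qb_bruhat_edge \<Phi> \<Delta> {} (w \<circ> z) (inv z \<alpha>) (w \<circ> root_refl \<alpha> \<circ> z) \<and>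
                qb_bruhat_edge \<Phi> \<Delta> J w \<alpha> (min_rep \<Delta> J (w \<circ> root_refl \<alpha>))) \<and>
             (\<kappa> = 1 \<longrightarrow>
                qb_quantum_edge \<Phi> \<Delta> {} (w \<circ> z) (inv z \<alpha>) (w \<circ> root_refl \<alpha> \<circ> z) \<and>
                qb_quantum_edge \<Phi> \<Delta> J w \<alpha> (min_rep \<Delta> J (w \<circ> root_refl \<alpha>))))"
proof -
  obtain w \<mu> where w: "w \<in> min_reps \<Delta> J" and s: "J_superantidominant \<Phi> \<Delta> J M \<mu>" and a: "J_adjusted \<Phi> \<Delta> J \<mu>"
    and x: "x = w \<circ> z_elem \<Phi> \<Delta> J \<mu> \<circ> transl \<mu>"
    using cov unfolding Omega_cover_def Omega_J_def by blast
  obtain w' \<mu>' where w': "w' \<in> min_reps \<Delta> J" and s': "J_superantidominant \<Phi> \<Delta> J M \<mu>'" and a': "J_adjusted \<Phi> \<Delta> J \<mu>'"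
    and y': "y = w' \<circ> z_elem \<Phi> \<Delta> J \<mu>' \<circ> transl \<mu>'"
    using cov unfolding Omega_cover_def Omega_J_def by blast
  obtain \<gamma>0 where g0: "\<gamma>0 \<in> affine_roots \<Phi>" "y = x \<circ> affine_refl \<gamma>0" "fst \<gamma>0 \<in> \<Phi> - par_roots \<Phi> J"
    and ac: "affine_cover \<Phi> \<Delta> y x"
    using cov unfolding Omega_cover_def by blast
  define z where "z = z_elem \<Phi> \<Delta> J \<mu>"
  have zJ: "z \<in> weyl J" unfolding z_def by (rule z_elem_weyl[OF a])
  \<comment> \<open>the connecting root is determined up to sign; its classical part is taken positive\<close>
  obtain \<beta> n where bn: "\<beta> \<in> P - PJ J" "n \<in> \<int>" "affine_refl (\<beta>, n) = affine_refl \<gamma>0"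
  proof (cases "fst \<gamma>0 \<in> P")
    case True
    then show ?thesis using that[of "fst \<gamma>0" "snd \<gamma>0"] g0 by (auto simp: affine_roots_def par_pos_roots_def)
  next
    case False
    then have p: "- fst \<gamma>0 \<in> P" using g0(3) pos_or_neg by blast
    have "- fst \<gamma>0 \<notin> PJ J" using g0(3) uminus_root[of "fst \<gamma>0"] by (auto simp: par_pos_roots_def par_root_iff[OF J])
    moreover have "(- fst \<gamma>0, - snd \<gamma>0) = - \<gamma>0" by (simp add: prod_eq_iff)
    ultimately show ?thesis
      using that[of "- fst \<gamma>0" "- snd \<gamma>0"] g0(1) p affine_refl_uminus[of \<gamma>0] by (auto simp: affine_roots_def)
  qed
  define \<alpha> where "\<alpha> = z \<beta>"
  define \<kappa> where "\<kappa> = n - \<mu> \<bullet> \<beta>"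
  have al: "\<alpha> \<in> P - PJ J" unfolding \<alpha>_def by (rule weyl_pos_outside[OF zJ J bn(1)])
  have b: "inv z \<alpha> = \<beta>" unfolding \<alpha>_def by (rule weyl_inv_left[OF zJ])
  have mlat: "\<mu> \<in> coroot_lattice \<Delta>" using a by (simp add: J_adjusted_def)
  have bPhi: "\<beta> \<in> \<Phi>" using bn(1) pos_root by blast
  have kint: "\<kappa> \<in> \<int>" unfolding \<kappa>_def using bn(2) coroot_lattice_pairing[OF mlat bPhi] by simp
  have kn: "\<kappa> + \<mu> \<bullet> \<beta> = n" by (simp add: \<kappa>_def)
  let ?h = "w \<circ> root_refl \<alpha> \<circ> z"
  let ?\<nu> = "\<mu> + \<kappa> *\<^sub>R coroot \<beta>"
  note S = reflection_setup[OF w a al kint, folded z_def, unfolded b]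
  have yx: "y = x \<circ> affine_refl (\<beta>, \<kappa> + \<mu> \<bullet> \<beta>)" using g0(2) bn(3) kn by simp
  have yh: "y = ?h \<circ> transl ?\<nu>"
    unfolding yx x z_def[symmetric] using reflection_translation(1)[OF S(6) zJ, of \<mu> \<alpha> \<kappa>] unfolding b .
  have wz': "w' \<circ> z_elem \<Phi> \<Delta> J \<mu>' \<in> weyl \<Delta>"
    using weyl_comp[OF min_reps_weyl[OF w']] z_elem_weyl[OF a'] weyl_mono[OF J] by blast
  have eq: "?h = w' \<circ> z_elem \<Phi> \<Delta> J \<mu>'" "?\<nu> = \<mu>'"
    using affine_decomp_unique[OF S(10) wz'] yh y' by metis+
  have balx: "balanced J (w \<circ> z) \<mu>" unfolding z_def by (rule balanced_min_rep[OF w a])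
  have baly: "balanced J ?h ?\<nu>" unfolding eq by (rule balanced_min_rep[OF w' a'])
  have mu: "\<mu> \<bullet> \<delta> \<le> - 2" "?\<nu> \<bullet> \<delta> \<le> - 2" if "\<delta> \<in> P - PJ J" for \<delta>
    using superantidominant_le[OF s that] superantidominant_le[OF s' that] M unfolding eq(2) by auto
  have mu1: "\<mu> \<bullet> \<delta> \<le> - 1" "?\<nu> \<bullet> \<delta> \<le> - 1" if "\<delta> \<in> P - PJ J" for \<delta> using mu[OF that] by linarith+
  have xz: "x = w \<circ> z \<circ> transl \<mu>" unfolding x z_def ..
  have xW: "x \<in> Waf" unfolding xz by (rule S(11))
  have one: "affine.inv_num x = affine.inv_num y + 1"
    using affine_cover_iff[OF xW S(12)] ac unfolding yx by blast
  \<comment> \<open>in terms of \<open>2\<rho>\<close>, which leads to the edge condition in \<open>QB(W)\<close>\<close>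
  have "real (affine.inv_num x) = - (\<mu> \<bullet> outer_sum {}) - real (wlength \<Delta> (w \<circ> z))"
    unfolding xz by (rule length_balanced[OF S(8) S(4) mu1(1) balx])
  moreover have "real (affine.inv_num y) = - (?\<nu> \<bullet> outer_sum {}) - real (wlength \<Delta> ?h)"
    unfolding yh by (rule length_balanced[OF S(10) S(5) mu1(2) baly])
  ultimately have W: "\<kappa> * (coroot \<beta> \<bullet> outer_sum {}) = 1 + real (wlength \<Delta> (w \<circ> z)) - real (wlength \<Delta> ?h)"
    using one by (simp add: inner_add_left)
  \<comment> \<open>in terms of \<open>2\<rho> - 2\<rho>\<^sub>J\<close>, which leads to the edge condition in \<open>QB(W\<^sup>J)\<close>\<close>
  have mrx: "min_rep \<Delta> J (w \<circ> z) = w" by (rule min_rep_eqI[OF J w zJ])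
  have mry: "min_rep \<Delta> J ?h = min_rep \<Delta> J (w \<circ> root_refl \<alpha>)" by (rule min_rep_comp[OF J S(9) zJ])
  have "real (affine.inv_num x) = - (\<mu> \<bullet> outer_sum J) - real (wlength \<Delta> w)"
    using length_outer[OF S(8) S(4) mu1(1)] balx unfolding xz balanced_defect mrx by simp
  moreover have "real (affine.inv_num y) = - (\<mu> \<bullet> outer_sum J + \<kappa> * (coroot \<alpha> \<bullet> outer_sum J))
      - real (wlength \<Delta> (min_rep \<Delta> J (w \<circ> root_refl \<alpha>)))"
    using length_outer[OF S(10) S(5) mu1(2)] baly unfolding yh balanced_defect mry S(14) by simp
  ultimately have WJ: "real (wlength \<Delta> (min_rep \<Delta> J (w \<circ> root_refl \<alpha>))) =
      real (wlength \<Delta> w) + 1 - \<kappa> * (coroot \<alpha> \<bullet> outer_sum J)"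
    using one by simp
  \<comment> \<open>the lengths of \<open>w z\<close> and \<open>w z r\<^sub>\<beta>\<close> differ by at most \<open>\<ell>(r\<^sub>\<beta>)\<close>, which is less than \<open>\<langle>\<beta>\<^sup>\<or>, 2\<rho>\<rangle>\<close>\<close>
  have hr: "?h = w \<circ> z \<circ> root_refl \<beta>" using root_conj[OF zJ, of \<alpha>] unfolding b by (metis comp_assoc)
  have bP: "\<beta> \<in> P" using bn(1) by blast
  have rW: "root_refl \<beta> \<in> weyl \<Delta>" by (rule root_refl_in_weyl_full[OF bPhi])
  have le1: "wlength \<Delta> ?h \<le> wlength \<Delta> (w \<circ> z) + wlength \<Delta> (root_refl \<beta>)"
    unfolding hr by (rule wlength_comp_le[OF S(8) rW])
  have "w \<circ> z = ?h \<circ> root_refl \<beta>" unfolding hr by (simp only: comp_assoc root_refl_comp_self comp_id)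
  then have le2: "wlength \<Delta> (w \<circ> z) \<le> wlength \<Delta> ?h + wlength \<Delta> (root_refl \<beta>)"
    using wlength_comp_le[OF S(10) rW] by simp
  let ?H = "coroot \<beta> \<bullet> outer_sum {}"
  have H: "real (wlength \<Delta> (root_refl \<beta>)) + 1 \<le> ?H" by (rule wlength_root_refl_le[OF bP])
  then have Hpos: "0 < ?H" by linarith
  have "\<kappa> * ?H \<le> 1 * ?H" using W le2 H by linarith
  then have kle: "\<kappa> \<le> 1" using Hpos by simp
  have "(- 1) * ?H < \<kappa> * ?H" using W le1 H by linarith
  then have kge: "- 1 < \<kappa>" using Hpos by (metis mult_less_cancel_right_pos)
  obtain k where k: "\<kappa> = of_int k" using kint by (rule Ints_cases)
  have k01: "\<kappa> = 0 \<or> \<kappa> = 1"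
  proof -
    have "k = 0 \<or> k = 1" using kle kge k by simp linarith
    then show ?thesis using k by auto
  qed
  have n0: "\<kappa> + \<mu> \<bullet> \<beta> < 0" using k01 mu(1)[OF bn(1)] by auto
  have neg: "(\<beta>, \<kappa> + \<mu> \<bullet> \<beta>) \<in> affine_neg_roots \<Phi> \<Delta>" by (rule affine_neg_rootI[OF S(2) S(13) n0])
  have label0: "qb_label \<Phi> \<Delta> {} (w \<circ> z) \<beta> ?h"
  proof -
    have "?h = min_rep \<Delta> {} (w \<circ> z \<circ> root_refl \<beta>)" using min_rep_empty[OF S(10)] unfolding hr by simp
    then show ?thesis unfolding qb_label_def min_reps_empty par_pos_empty using S(8) bP by blast
  qed
  have labelJ: "qb_label \<Phi> \<Delta> J w \<alpha> (min_rep \<Delta> J (w \<circ> root_refl \<alpha>))"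
    unfolding qb_label_def using w al by blast
  have B: "qb_bruhat_edge \<Phi> \<Delta> {} (w \<circ> z) \<beta> ?h \<and>
      qb_bruhat_edge \<Phi> \<Delta> J w \<alpha> (min_rep \<Delta> J (w \<circ> root_refl \<alpha>))" if k0: "\<kappa> = 0"
  proof
    have "real (wlength \<Delta> ?h) = real (wlength \<Delta> (w \<circ> z)) + 1" using W k0 by simp
    then have "wlength \<Delta> (w \<circ> z \<circ> root_refl \<beta>) = wlength \<Delta> (w \<circ> z) + 1" unfolding hr by linarith
    then show "qb_bruhat_edge \<Phi> \<Delta> {} (w \<circ> z) \<beta> ?h" unfolding qb_bruhat_edge_def using label0 by blast
    have "\<mu>' = \<mu>" using eq(2) k0 by simp
    then have "w \<circ> root_refl \<alpha> \<circ> z = w' \<circ> z" using eq(1) unfolding z_def by simp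
    then have e: "(w \<circ> root_refl \<alpha>) (z v) = w' (z v)" for v by (metis comp_apply)
    have "w \<circ> root_refl \<alpha> = w'"
    proof
      fix v show "(w \<circ> root_refl \<alpha>) v = w' v" using e[of "inv z v"] by (simp only: weyl_inv_right[OF zJ])
    qed
    then have "min_rep \<Delta> J (w \<circ> root_refl \<alpha>) = w \<circ> root_refl \<alpha>" using min_rep_id[OF J w'] by simp
    then have "real (wlength \<Delta> (w \<circ> root_refl \<alpha>)) = real (wlength \<Delta> w) + 1" using WJ k0 by simp
    then have "wlength \<Delta> (w \<circ> root_refl \<alpha>) = wlength \<Delta> w + 1" by linarith
    then show "qb_bruhat_edge \<Phi> \<Delta> J w \<alpha> (min_rep \<Delta> J (w \<circ> root_refl \<alpha>))"
      unfolding qb_bruhat_edge_def using labelJ by blast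
  qed
  have Q: "qb_quantum_edge \<Phi> \<Delta> {} (w \<circ> z) \<beta> ?h \<and>
      qb_quantum_edge \<Phi> \<Delta> J w \<alpha> (min_rep \<Delta> J (w \<circ> root_refl \<alpha>))" if k1: "\<kappa> = 1"
    unfolding qb_quantum_edge_def outer_sum_half_sums using label0 labelJ W WJ k1 by simp
  have aff: "(\<beta>, n) \<in> affine_roots \<Phi>" and yn: "y = x \<circ> affine_refl (\<beta>, n)"
    and negn: "(\<beta>, n) \<in> affine_neg_roots \<Phi> \<Delta>"
    using S(12) yx neg unfolding kn by blast+
  show ?thesis
    by (rule exI[of _ w], rule exI[of _ z], rule exI[of _ \<mu>], rule exI[of _ \<alpha>], rule exI[of _ n],
        rule exI[of _ "(\<beta>, n)"], unfold Let_def b, fold \<kappa>_def, unfold kn)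
      (use w z_def zJ s a xz al bn(2) aff yn negn k01 B Q in blast)
qed

end

end

theorem theorem5p2:
  fixes \<Phi> \<Delta> J :: "'a::euclidean_space set"
  assumes "irreducible_root_system \<Phi>" and "simple_roots \<Phi> \<Delta>" and "J \<subseteq> \<Delta>"
  shows "\<exists>M0::nat. \<forall>M\<ge>M0.
    (\<exists>N\<ge>M.
      (\<forall>z\<in>Sigma_J \<Phi> \<Delta> J.
         \<exists>\<mu>. J_superantidominant \<Phi> \<Delta> J N \<mu> \<and> J_adjusted \<Phi> \<Delta> J \<mu> \<and> z = z_elem \<Phi> \<Delta> J \<mu>) \<and>
      (\<forall>w \<alpha> v z \<mu> \<kappa>.
         (\<kappa> = 0 \<and> qb_bruhat_edge \<Phi> \<Delta> J w \<alpha> v \<or> \<kappa> = 1 \<and> qb_quantum_edge \<Phi> \<Delta> J w \<alpha> v) \<and>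
         z \<in> Sigma_J \<Phi> \<Delta> J \<and>
         J_superantidominant \<Phi> \<Delta> J N \<mu> \<and> J_adjusted \<Phi> \<Delta> J \<mu> \<and> z = z_elem \<Phi> \<Delta> J \<mu> \<longrightarrow>
         (let x = w \<circ> z \<circ> transl \<mu>;
              \<alpha>' = (inv z \<alpha>, \<kappa> + \<mu> \<bullet> inv z \<alpha>);
              y = x \<circ> affine_refl \<alpha>'
          in y = w \<circ> root_refl \<alpha> \<circ> transl (\<kappa> *\<^sub>R coroot \<alpha>) \<circ> z \<circ> transl \<mu> \<and>
             \<alpha>' \<in> affine_neg_roots \<Phi> \<Delta> \<and>
             Omega_cover \<Phi> \<Delta> J M y x))) \<and>
    (\<forall>x y. Omega_cover \<Phi> \<Delta> J M y x \<longrightarrow>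
      (\<exists>w z \<mu> \<alpha> n \<gamma>.
         w \<in> min_reps \<Delta> J \<and> z = z_elem \<Phi> \<Delta> J \<mu> \<and> z \<in> weyl J \<and>
         J_superantidominant \<Phi> \<Delta> J M \<mu> \<and> J_adjusted \<Phi> \<Delta> J \<mu> \<and>
         x = w \<circ> z \<circ> transl \<mu> \<and>
         \<alpha> \<in> pos_roots \<Phi> \<Delta> - par_pos_roots \<Phi> \<Delta> J \<and> n \<in> \<int> \<and>
         \<gamma> = (inv z \<alpha>, n) \<and> \<gamma> \<in> affine_roots \<Phi> \<and> y = x \<circ> affine_refl \<gamma> \<and>
         (let \<kappa> = n - \<mu> \<bullet> inv z \<alpha>
          in \<kappa> \<in> {0, 1} \<and>
             \<gamma> = (inv z \<alpha>, \<kappa> + \<mu> \<bullet> inv z \<alpha>) \<and> \<gamma> \<in> affine_neg_roots \<Phi> \<Delta> \<and>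
             (\<kappa> = 0 \<longrightarrow>
                qb_bruhat_edge \<Phi> \<Delta> {} (w \<circ> z) (inv z \<alpha>) (w \<circ> root_refl \<alpha> \<circ> z) \<and>
                qb_bruhat_edge \<Phi> \<Delta> J w \<alpha> (min_rep \<Delta> J (w \<circ> root_refl \<alpha>))) \<and>
             (\<kappa> = 1 \<longrightarrow>
                qb_quantum_edge \<Phi> \<Delta> {} (w \<circ> z) (inv z \<alpha>) (w \<circ> root_refl \<alpha> \<circ> z) \<and>
                qb_quantum_edge \<Phi> \<Delta> J w \<alpha> (min_rep \<Delta> J (w \<circ> root_refl \<alpha>))))))"
proof -
  interpret irreducible_roots \<Phi> \<Delta>
    using assms by unfold_locales (simp_all add: irreducible_root_system_def)
  \<comment> \<open>From the threshold \<open>2\<close> on, \<open>\<chi> + \<langle>\<mu>, z\<^sup>-\<^sup>1\<alpha>\<rangle>\<close> is negative even for \<open>\<chi> = 1\<close>.\<close>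
  show ?thesis
    by (rule exI[of _ 2], intro allI impI conjI)
      (rule edges_lift_to_covers[OF assms(3)], assumption,
       rule covers_project_to_edges[OF assms(3)], assumption+)
qed

end
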